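(* Let $G,F\in\mathcal M_3(\mathbb R)$ have nonnegative off-diagonal entries, with $G+\alpha F$ irreducible for all $\alpha>0$. Suppose the Perron eigenvalue $\lambda_P(\alpha)$ of $G+\alpha F$ is bounded on $(0,+\infty)$ and attains its global maximum over $(0,+\infty)$ at $\alpha^*$, and that $G+\alpha^*F$ is diagonalizable over $\mathbb R$, with eigenvalues $\lambda_1^*=\lambda_P(\alpha^* ),\lambda_2^*,\lambda_3^*$, basis of right eigenvectors $(e_1^*,e_2^*,e_3^* )$ and dual basis of left eigenvectors (row vectors) $(\phi_1^*,\phi_2^*,\phi_3^* )$, $\phi_i^*e_j^*=\delta_{ij}$. Let $\theta>0$ and let $\gamma:\mathbb R\to\mathbb R$ be a bounded measurable $\theta$-periodic function. Then the directional derivative of the Floquet eigenvalue vanishes at $\epsilon=0$: $$\left.\frac{d\lambda_F(\alpha^*+\epsilon\gamma)}{d\epsilon}\right|_{\epsilon=0}=0,$$ and the second directional derivative at $\epsilon=0$ is $$\left.\frac{d^2\lambda_F(\alpha^*+\epsilon\gamma)}{d\epsilon^2}\right|_{\epsilon=0}=2\sum_{i=2}^3\langle\gamma_i^2\rangle_\theta\,\frac{(\phi_1^*Fe_i^* )(\phi_i^*Fe_1^* )}{\lambda_1^*-\lambda_i^*},$$ where $\gamma_i$ is the unique $\theta$-periodic solution of $$\frac{\dot\gamma_i(t)}{\lambda_1^*-\lambda_i^*}+\gamma_i(t)=\gamma(t).$$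
   Context: For $\alpha>0$, $\lambda_P(\alpha)$ is the simple dominant real eigenvalue of $G+\alpha F$ given by Perron–Frobenius. For a $\theta$-periodic positive control $\alpha(t)$, the Floquet eigenvalue $\lambda_F(\alpha)$ is the unique real number for which there is a positive $\theta$-periodic vector function $e_\alpha(t)$ with $\frac{d}{dt}e_\alpha(t)+\lambda_F(\alpha)e_\alpha(t)=(G+\alpha(t)F)e_\alpha(t)$. For $|\epsilon|$ small, $\alpha^*+\epsilon\gamma$ is such a control. Time average: $\langle f\rangle_\theta=\frac1\theta\int_0^\theta f(t)\,dt$. *)

theory Defs
  imports "HOL-Analysis.Analysis" "HOL-Computational_Algebra.Polynomial"
begin

definition charpoly :: "'a::comm_ring_1^'n^'n \<Rightarrow> 'a poly" where
  "charpoly A = det (mat [:0, 1:] - (\<chi> i j. [:A $ i $ j:]))"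

definition is_eigenvalue :: "'a::field^'n^'n \<Rightarrow> 'a \<Rightarrow> bool" where
  "is_eigenvalue A z \<longleftrightarrow> (\<exists>v. v \<noteq> 0 \<and> A *v v = z *s v)"

definition metzler :: "real^'n^'n \<Rightarrow> bool" where
  "metzler A \<longleftrightarrow> (\<forall>i j. i \<noteq> j \<longrightarrow> A $ i $ j \<ge> 0)"

text \<open>No simultaneous permutation of rows and columns makes the matrix block triangular:
  there is no zero block with row set \<open>I\<close> and column set \<open>- I\<close>, for a proper nonempty \<open>I\<close>.\<close>

definition irreducible_matrix :: "real^'n^'n \<Rightarrow> bool" where
  "irreducible_matrix A \<longleftrightarrow>
     \<not> (\<exists>I. I \<noteq> {} \<and> I \<noteq> UNIV \<and> (\<forall>i\<in>I. \<forall>j\<in>-I. A $ i $ j = 0))"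

text \<open>The simple dominant real eigenvalue: algebraic multiplicity one, and every other complex
  eigenvalue has strictly smaller real part. (Off-diagonal entries are nonnegative, diagonal
  entries are arbitrary, so dominance concerns real parts and not moduli.)\<close>

definition is_perron_eigenvalue :: "real^'n^'n \<Rightarrow> real \<Rightarrow> bool" where
  "is_perron_eigenvalue A l \<longleftrightarrow>
     is_eigenvalue A l \<and> order l (charpoly A) = 1 \<and>
     (\<forall>z. is_eigenvalue (\<chi> i j. complex_of_real (A $ i $ j)) z \<and> z \<noteq> complex_of_real l
          \<longrightarrow> Re z < l)"

definition perron_eigenvalue :: "real^'n^'n \<Rightarrow> real" where
  "perron_eigenvalue A = (THE l. is_perron_eigenvalue A l)"

text \<open>The controls are only bounded and measurable, so differential equations are understood in
  the sense of Caratheodory: the solution is locally absolutely continuous, and the equation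
  holds almost everywhere. That \<open>x\<close> is locally absolutely continuous with almost everywhere
  derivative \<open>v\<close> is expressed by saying that \<open>x\<close> is an indefinite Lebesgue integral of \<open>v\<close>.\<close>

definition has_ae_derivative ::
  "(real \<Rightarrow> 'a::euclidean_space) \<Rightarrow> (real \<Rightarrow> 'a) \<Rightarrow> bool" where
  "has_ae_derivative x v \<longleftrightarrow>
     (\<forall>s t. s \<le> t \<longrightarrow> v absolutely_integrable_on {s..t} \<and> x t - x s = integral {s..t} v)"

definition is_floquet_eigenvalue ::
  "real^'n^'n \<Rightarrow> real^'n^'n \<Rightarrow> real \<Rightarrow> (real \<Rightarrow> real) \<Rightarrow> real \<Rightarrow> bool" where
  "is_floquet_eigenvalue G F \<theta> \<alpha> l \<longleftrightarrow>
     (\<exists>e e'. (\<forall>t i. e t $ i > 0) \<and> (\<forall>t. e (t + \<theta>) = e t) \<and> has_ae_derivative e e' \<and>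
        (AE t in lebesgue. e' t + l *\<^sub>R e t = (G + \<alpha> t *\<^sub>R F) *v e t))"

definition floquet_eigenvalue ::
  "real^'n^'n \<Rightarrow> real^'n^'n \<Rightarrow> real \<Rightarrow> (real \<Rightarrow> real) \<Rightarrow> real" where
  "floquet_eigenvalue G F \<theta> \<alpha> = (THE l. is_floquet_eigenvalue G F \<theta> \<alpha> l)"

definition time_average :: "real \<Rightarrow> (real \<Rightarrow> real) \<Rightarrow> real" where
  "time_average \<theta> f = (1 / \<theta>) * integral {0..\<theta>} f"

definition is_filtered_control ::
  "real \<Rightarrow> real \<Rightarrow> (real \<Rightarrow> real) \<Rightarrow> (real \<Rightarrow> real) \<Rightarrow> bool" where
  "is_filtered_control \<theta> k \<gamma> g \<longleftrightarrow>
     (\<forall>t. g (t + \<theta>) = g t) \<and>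
     (\<exists>g'. has_ae_derivative g g' \<and> (AE t in lebesgue. g' t / k + g t = \<gamma> t))"

definition filtered_control :: "real \<Rightarrow> real \<Rightarrow> (real \<Rightarrow> real) \<Rightarrow> real \<Rightarrow> real" where
  "filtered_control \<theta> k \<gamma> = (THE g. is_filtered_control \<theta> k \<gamma> g)"

end

theory Submission
  imports Defs "HOL-Library.Periodic_Fun"
begin

text \<open>Write \<open>A = G + \<alpha>\<^sup>* F\<close> and \<open>L = A - \<lambda>\<^sub>1\<close>. Normalising positive solutions of \<open>x' = (A + \<epsilon> \<gamma> F) x\<close> by \<open>\<phi>\<^sub>1 x = 1\<close> gives
  the projective equation \<open>z' = L z + \<epsilon> \<gamma> (F z - (\<phi>\<^sub>1 F z) z)\<close>, whose periodic solution near \<open>e\<^sub>1\<close> is the fixed point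
  of a contraction, \<open>z = e\<^sub>1 + \<epsilon> T (\<gamma> N z)\<close>, where \<open>T\<close> solves \<open>w' = L w + h\<close> periodically on the span of the other
  eigenvectors. Then \<open>\<lambda>\<^sub>F = \<lambda>\<^sub>1 + \<epsilon> \<langle>\<gamma> \<phi>\<^sub>1 F z\<rangle>\<close>. The same construction for the adjoint equation gives \<open>y\<close>, and the
  logarithmic derivative of \<open>y(\<epsilon>') \<bullet> z(\<epsilon>)\<close> has mean zero, so that
  \<open>\<lambda>\<^sub>F(\<epsilon>) - \<lambda>\<^sub>F(\<epsilon>') = (\<epsilon> - \<epsilon>') \<langle>\<gamma> (y(\<epsilon>') \<bullet> F z(\<epsilon>)) / (y(\<epsilon>') \<bullet> z(\<epsilon>))\<rangle>\<close>. Hence \<open>\<lambda>\<^sub>F'(\<epsilon>)\<close> is this mean at \<open>\<epsilon>' = \<epsilon>\<close>, and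
  inserting the first order expansions of \<open>y\<close> and \<open>z\<close> gives \<open>\<lambda>\<^sub>F''(0)\<close>. The first derivative at \<open>0\<close> is
  \<open>\<langle>\<gamma>\<rangle> \<phi>\<^sub>1 F e\<^sub>1\<close>, and \<open>\<phi>\<^sub>1 F e\<^sub>1 = 0\<close> because constant controls have Floquet eigenvalue \<open>\<lambda>\<^sub>P\<close>, which is maximal
  at \<open>\<alpha>\<^sup>*\<close>.\<close>

section \<open>Primitives of locally bounded measurable functions\<close>

text \<open>The controls are merely measurable, so solutions need not be differentiable everywhere.
  The calculus therefore works with integrands: \<open>has_lb_derivative\<close> fixes one
  everywhere defined, locally bounded representative \<open>v\<close>. Such integrands survive the
  products that occur and make \<open>x\<close> locally Lipschitz, and equations between them hold
  at every point. The a.e. equations of the definitions are translated into this form and back.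
  Solutions are never differentiated in \<epsilon>. Pairing solutions at two parameters yields an
  exact difference quotient, so a Lipschitz bound and a first order expansion, both uniform in time,
  are enough for two derivatives. The same pairing gives uniqueness of the Floquet eigenvalue,
  without which the definite description has no known value. The factor 2 in the second derivative
  arises because the primal and the adjoint first order terms contribute equally, by integration by
  parts over a period. Perron-Frobenius theory supplies positive left and right eigenvectors and a
  one-dimensional eigenspace. Dimension three is used for the algebraic multiplicity of the Perron
  root, via principal minors.\<close>

definition has_lb_derivative ::
  "(real \<Rightarrow> 'a::euclidean_space) \<Rightarrow> (real \<Rightarrow> 'a) \<Rightarrow> bool" where
  "has_lb_derivative x v \<longleftrightarrow> v \<in> borel_measurable lebesgue \<and> (\<forall>a b. bounded (v ` {a..b})) \<and>
     (\<forall>s t. s \<le> t \<longrightarrow> x t - x s = integral {s..t} v)"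

lemma lb_absolutely_integrable:
  fixes v :: "real \<Rightarrow> 'a::euclidean_space"
  assumes "v \<in> borel_measurable lebesgue" "bounded (v ` {a..b})"
  shows "v absolutely_integrable_on {a..b}"
proof -
  obtain B where B: "\<forall>t\<in>{a..b}. norm (v t) \<le> B"
    using assms(2) unfolding bounded_iff by blast
  show ?thesis
  proof (rule measurable_bounded_by_integrable_imp_absolutely_integrable[where g = "\<lambda>_. B"])
    show "v \<in> borel_measurable (lebesgue_on {a..b})"
      using assms(1) by (simp add: measurable_restrict_space1)
  qed (use B in auto)
qed

lemma lb_integrable:
  fixes v :: "real \<Rightarrow> 'a::euclidean_space"
  assumes "v \<in> borel_measurable lebesgue" "bounded (v ` {a..b})"
  shows "v integrable_on {a..b}"
  using lb_absolutely_integrable[OF assms] set_lebesgue_integral_eq_integral(1) by blast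

lemma has_lb_derivativeD:
  assumes "has_lb_derivative x v"
  shows "v \<in> borel_measurable lebesgue" "bounded (v ` {a..b})" "v integrable_on {a..b}"
    and "s \<le> t \<Longrightarrow> x t - x s = integral {s..t} v"
  using assms lb_integrable[of v a b] unfolding has_lb_derivative_def by auto

lemma has_lb_derivative_imp_ae:
  assumes "has_lb_derivative x v"
  shows "has_ae_derivative x v"
  unfolding has_ae_derivative_def
proof (intro allI impI conjI)
  fix s t :: real assume "s \<le> t"
  show "v absolutely_integrable_on {s..t}"
    using assms by (intro lb_absolutely_integrable has_lb_derivativeD)
  show "x t - x s = integral {s..t} v"
    by (rule has_lb_derivativeD(4)[OF assms \<open>s \<le> t\<close>])
qed

lemma integral_AE_cong:
  fixes v w :: "real \<Rightarrow> 'a::euclidean_space"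
  assumes "AE t in lebesgue. v t = w t"
  shows "integral S v = integral S w"
proof -
  obtain N where N: "N \<in> null_sets lebesgue" "{t. v t \<noteq> w t} \<subseteq> N"
    using assms by (auto simp: eventually_ae_filter)
  then have "negligible N" by (simp add: negligible_iff_null_sets)
  then show ?thesis
    by (rule integral_spike) (use N(2) in force)
qed

text \<open>Integrals do not see null sets, so the right-hand side of an a.e. equation, locally
  bounded as soon as the solution is, can replace the unknown integrand \<open>v\<close>.\<close>

lemma has_ae_derivative_imp_lb:
  assumes "has_ae_derivative x v" "AE t in lebesgue. v t = w t"
    and "w \<in> borel_measurable lebesgue" "\<And>a b. bounded (w ` {a..b})"
  shows "has_lb_derivative x w"
  unfolding has_lb_derivative_def
proof (intro allI impI conjI assms)
  fix s t :: real assume "s \<le> t"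
  then have "x t - x s = integral {s..t} v" using assms(1) unfolding has_ae_derivative_def by blast
  then show "x t - x s = integral {s..t} w" using integral_AE_cong[OF assms(2)] by simp
qed

lemma has_integral_Icc_norm_bound:
  fixes f :: "real \<Rightarrow> 'a::euclidean_space"
  assumes "(f has_integral i) {s..t}" "s \<le> t" "\<And>r. r \<in> {s..t} \<Longrightarrow> norm (f r) \<le> B"
  shows "norm i \<le> B * (t - s)"
proof -
  have "norm (integral {s..t} f) \<le> integral {s..t} (\<lambda>_. B)"
    by (rule integral_norm_bound_integral) (use assms in auto)
  then show ?thesis
    using assms(1,2) by (simp add: mult.commute integral_unique)
qed

lemma has_lb_derivative_bound:
  fixes x :: "real \<Rightarrow> 'a::euclidean_space"
  assumes "has_lb_derivative x v" "s \<le> t" "\<And>r. r \<in> {s..t} \<Longrightarrow> norm (v r) \<le> B"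
  shows "norm (x t - x s) \<le> B * (t - s)"
  using has_integral_Icc_norm_bound[OF integrable_integral assms(2), of v B]
    has_lb_derivativeD(3)[OF assms(1)] has_lb_derivativeD(4)[OF assms(1,2)] assms(3) by metis

lemma lb_bound_ex:
  fixes v :: "real \<Rightarrow> 'a::real_normed_vector"
  assumes "bounded (v ` {a..b})"
  shows "\<exists>B\<ge>0. \<forall>r\<in>{a..b}. norm (v r) \<le> B"
proof -
  obtain B where "\<forall>r\<in>{a..b}. norm (v r) \<le> B" using assms by (auto simp: bounded_iff)
  then have "\<forall>r\<in>{a..b}. norm (v r) \<le> max B 0" by auto
  then show ?thesis by (meson max.cobounded2)
qed

lemma has_lb_derivative_continuous:
  fixes x :: "real \<Rightarrow> 'a::euclidean_space"
  assumes "has_lb_derivative x v"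
  shows "continuous_on UNIV x"
proof -
  have "isCont x s" for s
  proof -
    obtain B where B: "B \<ge> 0" "\<forall>r\<in>{s-1..s+1}. norm (v r) \<le> B"
      using lb_bound_ex has_lb_derivativeD(2)[OF assms] by blast
    have lip: "dist (x t) (x s) \<le> B * dist t s" if "dist t s < 1" for t
    proof (cases "s \<le> t")
      case True
      then show ?thesis
        using has_lb_derivative_bound[OF assms, of s t B] B that by (auto simp: dist_norm dist_real_def)
    next
      case False
      then show ?thesis
        using has_lb_derivative_bound[OF assms, of t s B] B that
        by (auto simp: dist_norm dist_real_def norm_minus_commute)
    qed
    have "((\<lambda>t. dist (x t) (x s)) \<longlongrightarrow> 0) (at s)"
    proof (rule tendsto_sandwich[of "\<lambda>_. 0"])
      show "\<forall>\<^sub>F t in at s. dist (x t) (x s) \<le> B * dist t s"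
        unfolding eventually_at using lip by (intro exI[of _ 1]) auto
      show "((\<lambda>t. B * dist t s) \<longlongrightarrow> 0) (at s)"
        by (rule tendsto_eq_intros refl | simp)+
    qed auto
    then show ?thesis
      unfolding isCont_def by (subst tendsto_dist_iff)
  qed
  then show ?thesis by (simp add: continuous_on_eq_continuous_at)
qed

lemma continuous_lb:
  fixes x :: "real \<Rightarrow> 'a::euclidean_space"
  assumes "continuous_on UNIV x"
  shows "x \<in> borel_measurable lebesgue" "bounded (x ` {a..b})"
proof -
  show "x \<in> borel_measurable lebesgue"
    using borel_measurable_continuous_onI[OF assms] by (simp add: measurable_completion)
  show "bounded (x ` {a..b})"
    using compact_imp_bounded[OF compact_continuous_image[OF continuous_on_subset[OF assms]]] by simp
qed

lemma has_lb_derivative_exists: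
  fixes v :: "real \<Rightarrow> 'a::euclidean_space"
  assumes m: "v \<in> borel_measurable lebesgue" and b: "\<And>a b. bounded (v ` {a..b})"
  shows "\<exists>x. has_lb_derivative x v"
proof -
  define x where "x t = (if 0 \<le> t then integral {0..t} v else - integral {t..0} v)" for t
  note i = lb_integrable[OF m b]
  note c = Henstock_Kurzweil_Integration.integral_combine[OF _ _ i]
  have "x t - x s = integral {s..t} v" if "s \<le> t" for s t
  proof -
    consider "0 \<le> s" | "s < 0" "0 \<le> t" | "t < 0" by linarith
    then show ?thesis
    proof cases
      case 1
      then have "x t - x s = integral {0..t} v - integral {0..s} v" using that by (simp add: x_def)
      then show ?thesis using c[of 0 s t] 1 that by (metis add_diff_cancel_left')
    next
      case 2
      then have "x t - x s = integral {0..t} v + integral {s..0} v" by (simp add: x_def)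
      then show ?thesis using c[of s 0 t] 2 by (metis add.commute less_imp_le)
    next
      case 3
      then have "x t - x s = integral {s..0} v - integral {t..0} v" using that by (simp add: x_def)
      then show ?thesis using c[of s t 0] 3 that by (metis add_diff_cancel_right' less_imp_le)
    qed
  qed
  then have "has_lb_derivative x v" unfolding has_lb_derivative_def using m b by simp
  then show ?thesis by blast
qed

section \<open>Product, chain and shift rules for primitives\<close>

lemma small_increments_imp_const:
  fixes D :: "real \<Rightarrow> 'a::real_normed_vector"
  assumes "\<And>s e. e > 0 \<Longrightarrow> \<exists>d>0. \<forall>t. \<bar>t - s\<bar> < d \<longrightarrow> norm (D t - D s) \<le> e * \<bar>t - s\<bar>"
  shows "D t = D s"
proof -
  have "(D has_derivative (\<lambda>_. 0)) (at s)" for s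
    unfolding has_derivative_at_alt using assms by auto
  then show ?thesis
    using has_derivative_zero_unique[of UNIV D s t] by simp
qed

text \<open>To show \<open>y' = q\<close> it is enough to compare the increments of \<open>y\<close> with the integral of \<open>q\<close> up to
  \<open>o(t - s)\<close>: the difference of \<open>y\<close> and a primitive of \<open>q\<close> then has derivative zero everywhere,
  so no almost everywhere differentiation theorem is needed.\<close>

lemma has_lb_derivativeI:
  fixes y :: "real \<Rightarrow> 'a::euclidean_space"
  assumes m: "q \<in> borel_measurable lebesgue" and b: "\<And>a b. bounded (q ` {a..b})"
    and small: "\<And>u e. e > 0 \<Longrightarrow> \<exists>d>0. \<forall>s t. s \<le> t \<and> u - d < s \<and> t < u + d \<longrightarrow>
      norm (y t - y s - integral {s..t} q) \<le> e * (t - s)"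
  shows "has_lb_derivative y q"
proof -
  obtain P where P: "has_lb_derivative P q" using has_lb_derivative_exists[OF m b] by blast
  define D where "D t = y t - P t" for t
  have inc: "D t - D s = y t - y s - integral {s..t} q" if "s \<le> t" for s t
    using has_lb_derivativeD(4)[OF P that] by (simp add: D_def algebra_simps)
  have "D t = D s" for s t
  proof (rule small_increments_imp_const)
    fix u e :: real assume "e > 0"
    obtain d where d: "d > 0" "\<forall>s t. s \<le> t \<and> u - d < s \<and> t < u + d \<longrightarrow>
      norm (y t - y s - integral {s..t} q) \<le> e * (t - s)"
      using small[OF \<open>e > 0\<close>, of u] by (elim exE conjE)
    have "norm (D t - D u) \<le> e * \<bar>t - u\<bar>" if "\<bar>t - u\<bar> < d" for t
    proof (cases "u \<le> t")
      case True
      then show ?thesis using d(2)[rule_format, of u t] inc[of u t] that d(1) by simp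
    next
      case False
      then show ?thesis using d(2)[rule_format, of t u] inc[of t u] that d(1)
        by (simp add: norm_minus_commute[of "D t"] abs_if)
    qed
    then show "\<exists>d>0. \<forall>t. \<bar>t - u\<bar> < d \<longrightarrow> norm (D t - D u) \<le> e * \<bar>t - u\<bar>"
      using d(1) by blast
  qed
  then have "y t - y s = P t - P s" for s t
    by (simp add: D_def algebra_simps)
  then show ?thesis using P m b unfolding has_lb_derivative_def by simp
qed

text \<open>The increment of the product splits exactly as
  \<open>p (x t - x s) (y s) + p (x t) (y t - y s)\<close>. Writing both parts as integrals and
  subtracting \<open>q\<close> leaves an integrand of size O(t - s), hence an error of order (t -
  s)^2, small enough for \<open>has_lb_derivativeI\<close>.\<close>

lemma has_lb_derivative_prod:
  fixes x :: "real \<Rightarrow> 'a::euclidean_space" and y :: "real \<Rightarrow> 'b::euclidean_space"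
    and p :: "'a \<Rightarrow> 'b \<Rightarrow> 'c::euclidean_space"
  assumes p: "bounded_bilinear p" and X: "has_lb_derivative x v" and Y: "has_lb_derivative y w"
  shows "has_lb_derivative (\<lambda>t. p (x t) (y t)) (\<lambda>t. p (x t) (w t) + p (v t) (y t))"
proof -
  interpret bounded_bilinear p by fact
  obtain K where K: "K > 0" "\<And>a b. norm (p a b) \<le> norm a * norm b * K" using pos_bounded by blast
  have contp: "continuous_on UNIV (\<lambda>z. p (fst z) (snd z))"
    by (intro continuous_on continuous_intros)
  have mp: "(\<lambda>t. p (f t) (g t)) \<in> borel_measurable lebesgue"
    if "f \<in> borel_measurable lebesgue" "g \<in> borel_measurable lebesgue" for f g
    by (rule borel_measurable_continuous_Pair[OF that contp])
  have bp: "bounded ((\<lambda>t. p (f t) (g t)) ` {a..b})"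
    if bf: "bounded (f ` {a..b})" and bg: "bounded (g ` {a..b})" for f g and a b :: real
  proof -
    obtain M where "M \<ge> 0" "\<forall>r\<in>{a..b}. norm (f r) \<le> M" using lb_bound_ex[OF bf] by blast
    moreover obtain N where "N \<ge> 0" "\<forall>r\<in>{a..b}. norm (g r) \<le> N"
      using lb_bound_ex[OF bg] by blast
    ultimately have "\<forall>r\<in>{a..b}. norm (p (f r) (g r)) \<le> M * N * K"
      using K by (meson mult_mono mult_right_mono norm_ge_zero order_trans less_imp_le)
    then show ?thesis by (auto simp: bounded_iff)
  qed
  note cx = continuous_lb[OF has_lb_derivative_continuous[OF X]]
  note cy = continuous_lb[OF has_lb_derivative_continuous[OF Y]]
  note vx = has_lb_derivativeD[OF X] and vy = has_lb_derivativeD[OF Y]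
  define q where "q t = p (x t) (w t) + p (v t) (y t)" for t
  have qm: "q \<in> borel_measurable lebesgue"
    unfolding q_def[abs_def] by (intro borel_measurable_add mp cx cy vx vy)
  have qb: "bounded (q ` {a..b})" for a b
    unfolding q_def[abs_def] by (intro bounded_plus_comp bp cx cy vx vy)
  have "has_lb_derivative (\<lambda>t. p (x t) (y t)) q"
  proof (rule has_lb_derivativeI[OF qm qb])
    fix u e :: real assume e: "e > 0"
    obtain M where M: "M \<ge> 0" "\<forall>r\<in>{u-1..u+1}. norm (v r) \<le> M"
      using lb_bound_ex[OF vx(2)] by blast
    obtain N where N: "N \<ge> 0" "\<forall>r\<in>{u-1..u+1}. norm (w r) \<le> N"
      using lb_bound_ex[OF vy(2)] by blast
    \<comment> \<open>Two error terms of size \<open>M * N * K * (t - s)\<close> each; the summand 1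
      keeps \<open>C\<close> positive, so that it can be divided by.\<close>
    define C where "C = 2 * M * N * K + 1"
    have C: "C > 0" using M N K by (simp add: C_def add_nonneg_pos)
    have est: "norm (p (x t) (y t) - p (x s) (y s) - integral {s..t} q) \<le> C * (t - s) * (t - s)"
      if st: "s \<le> t" "u - 1 < s" "t < u + 1" for s t
    proof -
      have ivv: "((\<lambda>r. p (v r) (y s)) has_integral p (x t - x s) (y s)) {s..t}"
        using has_integral_linear[OF integrable_integral[OF vx(3)[of s t]] bounded_linear_left[of "y s"]]
          vx(4)[OF st(1)] by (simp add: o_def)
      have ivw: "((\<lambda>r. p (x t) (w r)) has_integral p (x t) (y t - y s)) {s..t}"
        using has_integral_linear[OF integrable_integral[OF vy(3)[of s t]] bounded_linear_right[of "x t"]]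
          vy(4)[OF st(1)] by (simp add: o_def)
      have iq: "(q has_integral integral {s..t} q) {s..t}"
        using lb_integrable[OF qm qb] by (rule integrable_integral)
      have "((\<lambda>r. p (v r) (y s) + p (x t) (w r) - q r) has_integral
         p (x t - x s) (y s) + p (x t) (y t - y s) - integral {s..t} q) {s..t}"
        by (intro has_integral_add has_integral_diff ivv ivw iq)
      moreover have "p (x t - x s) (y s) + p (x t) (y t - y s) = p (x t) (y t) - p (x s) (y s)"
        by (simp add: diff_left diff_right)
      ultimately have I: "((\<lambda>r. p (v r) (y s) + p (x t) (w r) - q r) has_integral
         p (x t) (y t) - p (x s) (y s) - integral {s..t} q) {s..t}" by simp
      have "norm (p (x t) (y t) - p (x s) (y s) - integral {s..t} q)
        \<le> (C * (t - s)) * (t - s)"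
      proof (rule has_integral_Icc_norm_bound[OF I st(1)])
        fix r assume r: "r \<in> {s..t}"
        have 1: "norm (x t - x r) \<le> M * (t - s)"
          using has_lb_derivative_bound[OF X, of r t M] M r st
          by (smt (verit, best) atLeastAtMost_iff mult_left_mono)
        have 2: "norm (y s - y r) \<le> N * (t - s)"
          using has_lb_derivative_bound[OF Y, of s r N] N r st
          by (smt (verit, best) atLeastAtMost_iff mult_left_mono norm_minus_commute)
        have 3: "norm (v r) \<le> M" "norm (w r) \<le> N" using M N r st by auto
        have "p (v r) (y s) + p (x t) (w r) - q r = p (v r) (y s - y r) + p (x t - x r) (w r)"
          by (simp add: q_def diff_left diff_right)
        also have "norm \<dots> \<le> norm (v r) * norm (y s - y r) * K + norm (x t - x r) * norm (w r) * K"
          using K(2) norm_triangle_mono by blast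
        also have "\<dots> \<le> M * (N * (t - s)) * K + (M * (t - s)) * N * K"
          using 1 2 3 K M N st by (intro add_mono mult_right_mono mult_mono) auto
        also have "\<dots> \<le> C * (t - s)"
          using st by (simp add: C_def algebra_simps)
        finally show "norm (p (v r) (y s) + p (x t) (w r) - q r) \<le> C * (t - s)" .
      qed
      then show ?thesis using st by simp
    qed
    \<comment> \<open>Points within \<open>d\<close> of \<open>u\<close> are at most
      \<open>2 * d \<le> e / C\<close> apart.\<close>
    define d where "d = min 1 (e / (2 * C))"
    have d: "d > 0" using C e by (simp add: d_def)
    have "norm (p (x t) (y t) - p (x s) (y s) - integral {s..t} q) \<le> e * (t - s)"
      if st: "s \<le> t" "u - d < s" "t < u + d" for s t
    proof -
      have "t - s \<le> e / C" using st by (simp add: d_def min_def field_simps split: if_splits)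
      then have "C * (t - s) \<le> e" using C by (simp add: field_simps)
      then have "C * (t - s) * (t - s) \<le> e * (t - s)" using st by (intro mult_right_mono) auto
      moreover have "u - 1 < s" "t < u + 1" using st by (auto simp: d_def)
      ultimately show ?thesis using est[of s t] st(1) by linarith
    qed
    then show "\<exists>d>0. \<forall>s t. s \<le> t \<and> u - d < s \<and> t < u + d \<longrightarrow>
        norm (p (x t) (y t) - p (x s) (y s) - integral {s..t} q) \<le> e * (t - s)"
      using d by blast
  qed
  then show ?thesis by (simp add: q_def[abs_def])
qed

lemma has_lb_derivative_linear:
  fixes x :: "real \<Rightarrow> 'a::euclidean_space" and f :: "'a \<Rightarrow> 'b::euclidean_space"
  assumes f: "bounded_linear f" and X: "has_lb_derivative x v"
  shows "has_lb_derivative (\<lambda>t. f (x t)) (\<lambda>t. f (v t))"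
proof -
  interpret bounded_linear f by fact
  note D = has_lb_derivativeD[OF X]
  have "(\<lambda>t. f (v t)) \<in> borel_measurable lebesgue"
    using measurable_compose[OF D(1) borel_measurable_continuous_onI[OF linear_continuous_on[OF f]]] .
  moreover have "bounded ((\<lambda>t. f (v t)) ` {a..b})" for a b
    using bounded_linear_image[OF D(2) f] by (simp add: image_image)
  moreover have "f (x t) - f (x s) = integral {s..t} (\<lambda>t. f (v t))" if "s \<le> t" for s t
    using integral_linear[OF D(3) f, of s t] D(4)[OF that] by (simp add: o_def diff[symmetric])
  ultimately show ?thesis unfolding has_lb_derivative_def by blast
qed

lemma has_lb_derivative_add:
  assumes "has_lb_derivative x v" "has_lb_derivative y w"
  shows "has_lb_derivative (\<lambda>t. x t + y t) (\<lambda>t. v t + w t)"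
proof -
  note D = has_lb_derivativeD[OF assms(1)] and E = has_lb_derivativeD[OF assms(2)]
  have "x t + y t - (x s + y s) = integral {s..t} (\<lambda>t. v t + w t)" if "s \<le> t" for s t
    using D(4)[OF that] E(4)[OF that] integral_add[OF D(3) E(3), of s t] by (simp add: algebra_simps)
  then show ?thesis
    unfolding has_lb_derivative_def
    using borel_measurable_add[OF D(1) E(1)] bounded_plus_comp[OF D(2) E(2)] by blast
qed

lemma has_lb_derivative_diff:
  assumes "has_lb_derivative x v" "has_lb_derivative y w"
  shows "has_lb_derivative (\<lambda>t. x t - y t) (\<lambda>t. v t - w t)"
proof -
  note D = has_lb_derivativeD[OF assms(1)] and E = has_lb_derivativeD[OF assms(2)]
  have "x t - y t - (x s - y s) = integral {s..t} (\<lambda>t. v t - w t)" if "s \<le> t" for s t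
    using D(4)[OF that] E(4)[OF that] integral_diff[OF D(3) E(3), of s t] by (simp add: algebra_simps)
  then show ?thesis
    unfolding has_lb_derivative_def
    using borel_measurable_diff[OF D(1) E(1)] bounded_minus_comp[OF D(2) E(2)] by blast
qed

lemma has_lb_derivative_const: "has_lb_derivative (\<lambda>_. c) (\<lambda>_. 0)"
  unfolding has_lb_derivative_def by (auto simp: bounded_iff)

lemma has_lb_derivative_sum:
  assumes "\<And>i. i \<in> I \<Longrightarrow> has_lb_derivative (x i) (v i)"
  shows "has_lb_derivative (\<lambda>t. \<Sum>i\<in>I. x i t) (\<lambda>t. \<Sum>i\<in>I. v i t)"
  using assms
  by (induction I rule: infinite_finite_induct)
    (auto intro: has_lb_derivative_const has_lb_derivative_add)

lemma has_lb_derivative_zero_const: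
  assumes "has_lb_derivative x v" "\<And>t. v t = 0"
  shows "x t = x s"
proof -
  have "v = (\<lambda>_. 0)" using assms(2) by auto
  then have "x t - x s = 0" if "s \<le> t" for s t
    using has_lb_derivativeD(4)[OF assms(1) that] by simp
  then show ?thesis by (metis eq_iff_diff_eq_0 linear)
qed

text \<open>The translated integrand is passed as a separate \<open>w\<close>: where the lemma is
  applied, periodicity makes it a constant multiple of \<open>v\<close>, so its measurability is
  immediate.\<close>

lemma has_lb_derivative_shift:
  fixes x :: "real \<Rightarrow> 'a::euclidean_space"
  assumes "has_lb_derivative x v" "w \<in> borel_measurable lebesgue" "\<And>t. w t = v (t + c)"
  shows "has_lb_derivative (\<lambda>t. x (t + c)) w"
proof -
  have w: "w = (\<lambda>t. v (t + c))" using assms(3) by auto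
  have "w ` {a..b} = v ` {a+c..b+c}" for a b
  proof -
    have "w ` {a..b} = v ` ((\<lambda>t. t + c) ` {a..b})" unfolding w image_image ..
    also have "(\<lambda>t. t + c) ` {a..b} = {a+c..b+c}" by (rule image_add_atLeastAtMost')
    finally show ?thesis .
  qed
  then have "bounded (w ` {a..b})" for a b
    using has_lb_derivativeD(2)[OF assms(1)] by metis
  moreover have "x (t + c) - x (s + c) = integral {s..t} w" if "s \<le> t" for s t
    using has_lb_derivativeD(4)[OF assms(1), of "s+c" "t+c"] that
      integral_shift_real_ivl[of "s+c" c "t+c" v] w by simp
  ultimately show ?thesis unfolding has_lb_derivative_def using assms(2) by blast
qed

lemma has_lb_derivative_C1:
  fixes f :: "real \<Rightarrow> real"
  assumes f: "\<And>t. (f has_real_derivative f' t) (at t)" "continuous_on UNIV f'"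
  shows "has_lb_derivative f f'"
  unfolding has_lb_derivative_def
proof (intro conjI allI impI)
  show "f' \<in> borel_measurable lebesgue" "\<And>a b. bounded (f' ` {a..b})"
    using continuous_lb[OF f(2)] by blast+
  fix s t :: real assume "s \<le> t"
  then have "(f' has_integral f t - f s) {s..t}"
    by (intro fundamental_theorem_of_calculus)
      (auto simp: has_real_derivative_iff_has_vector_derivative[symmetric]
        intro: f(1) has_field_derivative_at_within)
  then show "f t - f s = integral {s..t} f'" by (simp add: integral_unique)
qed

text \<open>Since \<open>x\<close> is only locally Lipschitz, the chain rule is proved by freezing
  the factor at \<open>s\<close>: both the increment of \<open>exp (x t)\<close> and the integral
  are compared with \<open>exp (x s) * (x t - x s)\<close>.\<close>

lemma has_lb_derivative_exp:
  assumes X: "has_lb_derivative x v"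
  shows "has_lb_derivative (\<lambda>t. exp (x t :: real)) (\<lambda>t. exp (x t) * v t)"
proof -
  note D = has_lb_derivativeD[OF X]
  have cx: "continuous_on UNIV x" by (rule has_lb_derivative_continuous[OF X])
  have ce: "continuous_on UNIV (\<lambda>t. exp (x t))" by (intro continuous_intros cx)
  have qm: "(\<lambda>t. exp (x t) * v t) \<in> borel_measurable lebesgue"
    by (intro borel_measurable_times continuous_lb[OF ce] D)
  have qb: "bounded ((\<lambda>t. exp (x t) * v t) ` {a..b})" for a b
  proof -
    obtain M where "M \<ge> 0" "\<forall>r\<in>{a..b}. norm (exp (x r)) \<le> M"
      using lb_bound_ex[OF continuous_lb(2)[OF ce]] by blast
    moreover obtain N where "N \<ge> 0" "\<forall>r\<in>{a..b}. norm (v r) \<le> N"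
      using lb_bound_ex[OF D(2)] by blast
    ultimately have "\<forall>r\<in>{a..b}. norm (exp (x r) * v r) \<le> M * N"
      by (simp add: abs_mult mult_mono)
    then show ?thesis unfolding bounded_iff by blast
  qed
  show ?thesis
  proof (rule has_lb_derivativeI[OF qm qb])
    fix u e :: real assume e: "e > 0"
    obtain M where M: "M \<ge> 0" "\<forall>r\<in>{u-1..u+1}. norm (v r) \<le> M"
      using lb_bound_ex[OF D(2)] by blast
    \<comment> \<open>Each of the two comparisons costs at most \<open>2 * e1 * M * (t - s)\<close>;
      using \<open>M + 1\<close> avoids division by zero.\<close>
    define e1 where "e1 = e / (4 * (M + 1))"
    have e1: "e1 > 0" using e M by (simp add: e1_def)
    have "isCont (\<lambda>t. exp (x t)) u" using ce by (simp add: continuous_on_eq_continuous_at)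
    then obtain d0 where d0: "d0 > 0" "\<And>t. \<bar>t - u\<bar> < d0 \<Longrightarrow> \<bar>exp (x t) - exp (x u)\<bar> < e1"
      unfolding continuous_at_eps_delta using e1 by (metis dist_real_def)
    define d where "d = min 1 d0"
    have "norm (exp (x t) - exp (x s) - integral {s..t} (\<lambda>t. exp (x t) * v t)) \<le> e * (t - s)"
      if st: "s \<le> t" "u - d < s" "t < u + d" for s t
    proof -
      have near: "\<bar>exp (x r) - exp (x s)\<bar> \<le> 2 * e1" if "r \<in> {s..t}" for r
      proof -
        have "\<bar>r - u\<bar> < d0" "\<bar>s - u\<bar> < d0" using that st by (auto simp: d_def)
        then show ?thesis using d0(2)[of r] d0(2)[of s] by linarith
      qed
      have 1: "\<bar>exp (x t) - exp (x s) - exp (x s) * (x t - x s)\<bar> \<le> 2 * e1 * \<bar>x t - x s\<bar>"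
      proof -
        \<comment> \<open>By convexity the increment of exp lies between
          \<open>exp a * (b - a)\<close> and \<open>exp b * (b - a)\<close>.\<close>
        have "\<bar>exp b - exp a - exp a * (b - a)\<bar> \<le> \<bar>exp b - exp a\<bar> * \<bar>b - a\<bar>" for a b :: real
        proof -
          have l: "exp a * (b - a) \<le> exp b - exp a"
            using exp_ge_add_one_self[of "b - a"] mult_left_mono[of "1 + (b-a)" "exp (b-a)" "exp a"]
            by (simp add: exp_diff algebra_simps)
          have r: "exp b - exp a \<le> exp b * (b - a)"
            using exp_ge_add_one_self[of "a - b"] mult_left_mono[of "1 + (a-b)" "exp (a-b)" "exp b"]
            by (simp add: exp_diff algebra_simps)
          have "\<bar>exp b - exp a - exp a * (b - a)\<bar> \<le> (exp b - exp a) * (b - a)"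
            using l r by (simp add: algebra_simps)
          also have "\<dots> \<le> \<bar>(exp b - exp a) * (b - a)\<bar>" by simp
          finally show ?thesis by (simp add: abs_mult)
        qed
        then have "\<bar>exp (x t) - exp (x s) - exp (x s) * (x t - x s)\<bar> \<le> \<bar>exp (x t) - exp (x s)\<bar> * \<bar>x t - x s\<bar>" .
        also have "\<dots> \<le> 2 * e1 * \<bar>x t - x s\<bar>"
          using near[of t] st by (intro mult_right_mono) auto
        finally show ?thesis .
      qed
      have vM: "\<bar>v r\<bar> \<le> M" if "r \<in> {s..t}" for r
      proof -
        have "u - 1 < s" "t < u + 1" using st by (auto simp: d_def)
        then have "r \<in> {u-1..u+1}" using that by auto
        then show ?thesis using M by auto
      qed
      have 2: "\<bar>x t - x s\<bar> \<le> M * (t - s)"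
        using has_lb_derivative_bound[OF X, of s t M] vM st by simp
      have I: "((\<lambda>r. exp (x r) * v r - exp (x s) * v r) has_integral
         integral {s..t} (\<lambda>t. exp (x t) * v t) - exp (x s) * (x t - x s)) {s..t}"
        using lb_integrable[OF qm qb] integrable_integral[OF D(3)[of s t]] D(4)[OF st(1)]
        by (intro has_integral_diff integrable_integral has_integral_mult_right) auto
      have 3: "\<bar>integral {s..t} (\<lambda>t. exp (x t) * v t) - exp (x s) * (x t - x s)\<bar> \<le> (2 * e1 * M) * (t - s)"
      proof (rule has_integral_Icc_norm_bound[OF I st(1), unfolded real_norm_def])
        fix r assume r: "r \<in> {s..t}"
        have "\<bar>exp (x r) * v r - exp (x s) * v r\<bar> = \<bar>exp (x r) - exp (x s)\<bar> * \<bar>v r\<bar>"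
          by (simp add: abs_mult[symmetric] algebra_simps)
        also have "\<dots> \<le> 2 * e1 * M"
          using near[OF r] vM[OF r] e1 by (intro mult_mono) auto
        finally show "\<bar>exp (x r) * v r - exp (x s) * v r\<bar> \<le> 2 * e1 * M" .
      qed
      have "\<bar>exp (x t) - exp (x s) - integral {s..t} (\<lambda>t. exp (x t) * v t)\<bar>
        \<le> 2 * e1 * \<bar>x t - x s\<bar> + (2 * e1 * M) * (t - s)"
        using 1 3 st by simp
      also have "\<dots> \<le> 2 * e1 * (M * (t - s)) + (2 * e1 * M) * (t - s)"
        using 2 e1 by simp
      also have "\<dots> = (4 * e1 * M) * (t - s)" by (simp add: algebra_simps)
      also have "\<dots> \<le> e * (t - s)"
        using e M st by (intro mult_right_mono) (auto simp: e1_def field_simps)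
      finally show ?thesis by simp
    qed
    then show "\<exists>d>0. \<forall>s t. s \<le> t \<and> u - d < s \<and> t < u + d \<longrightarrow>
        norm (exp (x t) - exp (x s) - integral {s..t} (\<lambda>t. exp (x t) * v t)) \<le> e * (t - s)"
      using d0(1) by (intro exI[of _ d]) (auto simp: d_def)
  qed
qed

section \<open>Periodic solutions of scalar linear equations\<close>

definition periodic_control :: "real \<Rightarrow> (real \<Rightarrow> 'a::euclidean_space) \<Rightarrow> bool" where
  "periodic_control \<theta> h \<longleftrightarrow>
     h \<in> borel_measurable lebesgue \<and> bounded (range h) \<and> (\<forall>t. h (t + \<theta>) = h t)"

lemma periodic_controlD:
  assumes "periodic_control \<theta> h"
  shows "h \<in> borel_measurable lebesgue" "bounded (range h)" "h (t + \<theta>) = h t"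
    and "bounded (h ` {a..b})" "h integrable_on {a..b}"
proof -
  show 1: "h \<in> borel_measurable lebesgue" "bounded (range h)" "h (t + \<theta>) = h t"
    using assms unfolding periodic_control_def by auto
  show 2: "bounded (h ` {a..b})" using 1(2) by (rule bounded_subset) auto
  show "h integrable_on {a..b}" using lb_integrable[OF 1(1) 2] .
qed

lemma continuous_periodic_control:
  fixes z :: "real \<Rightarrow> 'a::euclidean_space"
  assumes "\<theta> > 0" "continuous_on UNIV z" "\<And>t. z (t + \<theta>) = z t"
  shows "periodic_control \<theta> z"
proof -
  interpret periodic_fun_simple z \<theta> by standard (rule assms(3))
  have "z t \<in> z ` {0..\<theta>}" for t
  proof -
    define n where "n = \<lfloor>t / \<theta>\<rfloor>"
    have "of_int n \<le> t / \<theta>" "t / \<theta> < of_int n + 1" unfolding n_def by linarith+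
    then have "of_int n * \<theta> \<le> t" "t \<le> of_int n * \<theta> + \<theta>"
      using assms(1) by (simp_all add: field_simps)
    then have "t - of_int n * \<theta> \<in> {0..\<theta>}" by simp
    moreover have "z (t - of_int n * \<theta>) = z t" by (rule minus_of_int)
    ultimately show ?thesis by (metis imageI)
  qed
  then have "range z \<subseteq> z ` {0..\<theta>}" by auto
  then have "bounded (range z)" using continuous_lb(2)[OF assms(2)] bounded_subset by blast
  then show ?thesis
    unfolding periodic_control_def using continuous_lb(1)[OF assms(2)] assms(3) by blast
qed

lemma periodic_control_bilinear:
  fixes p :: "'a::euclidean_space \<Rightarrow> 'b::euclidean_space \<Rightarrow> 'c::euclidean_space"
  assumes p: "bounded_bilinear p" and f: "periodic_control \<theta> f" and g: "periodic_control \<theta> g"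
  shows "periodic_control \<theta> (\<lambda>t. p (f t) (g t))"
proof -
  interpret bounded_bilinear p by fact
  obtain K where K: "K > 0" "\<And>a b. norm (p a b) \<le> norm a * norm b * K" using pos_bounded by blast
  have contp: "continuous_on UNIV (\<lambda>z. p (fst z) (snd z))"
    by (intro continuous_on continuous_intros)
  obtain M where M: "\<And>r. norm (f r) \<le> M"
    using periodic_controlD(2)[OF f] unfolding bounded_iff by blast
  obtain N where N: "\<And>r. norm (g r) \<le> N"
    using periodic_controlD(2)[OF g] unfolding bounded_iff by blast
  have "norm (p (f r) (g r)) \<le> M * N * K" for r
    using K(2)[of "f r" "g r"] mult_right_mono[OF mult_mono[OF M N _ norm_ge_zero, of r r]] K(1)
      order_trans[OF norm_ge_zero M] by (meson less_imp_le order_trans)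
  then have "bounded (range (\<lambda>t. p (f t) (g t)))" unfolding bounded_iff by blast
  moreover have "(\<lambda>t. p (f t) (g t)) \<in> borel_measurable lebesgue"
    by (rule borel_measurable_continuous_Pair[OF periodic_controlD(1)[OF f] periodic_controlD(1)[OF g] contp])
  ultimately show ?thesis
    unfolding periodic_control_def using periodic_controlD(3)[OF f] periodic_controlD(3)[OF g] by simp
qed

lemmas periodic_control_mult = periodic_control_bilinear[OF bounded_bilinear_mult]
lemmas periodic_control_scaleR = periodic_control_bilinear[OF bounded_bilinear_scaleR]
lemmas periodic_control_inner = periodic_control_bilinear[OF bounded_bilinear_inner]

lemma periodic_control_linear:
  fixes f :: "'a::euclidean_space \<Rightarrow> 'b::euclidean_space"
  assumes f: "bounded_linear f" and h: "periodic_control \<theta> h"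
  shows "periodic_control \<theta> (\<lambda>t. f (h t))"
proof -
  have "(\<lambda>t. f (h t)) \<in> borel_measurable lebesgue"
    using measurable_compose[OF periodic_controlD(1)[OF h]
        borel_measurable_continuous_onI[OF linear_continuous_on[OF f]]] .
  moreover have "bounded (range (\<lambda>t. f (h t)))"
    using bounded_linear_image[OF periodic_controlD(2)[OF h] f] by (simp add: image_image)
  ultimately show ?thesis unfolding periodic_control_def using periodic_controlD(3)[OF h] by simp
qed

lemma periodic_control_add:
  assumes "periodic_control \<theta> f" "periodic_control \<theta> g"
  shows "periodic_control \<theta> (\<lambda>t. f t + g t)"
  using borel_measurable_add[OF periodic_controlD(1)[OF assms(1)] periodic_controlD(1)[OF assms(2)]]
    bounded_plus_comp[OF periodic_controlD(2)[OF assms(1)] periodic_controlD(2)[OF assms(2)]]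
    periodic_controlD(3)[OF assms(1)] periodic_controlD(3)[OF assms(2)]
  unfolding periodic_control_def by simp

lemma periodic_control_diff:
  assumes "periodic_control \<theta> f" "periodic_control \<theta> g"
  shows "periodic_control \<theta> (\<lambda>t. f t - g t)"
  using borel_measurable_diff[OF periodic_controlD(1)[OF assms(1)] periodic_controlD(1)[OF assms(2)]]
    bounded_minus_comp[OF periodic_controlD(2)[OF assms(1)] periodic_controlD(2)[OF assms(2)]]
    periodic_controlD(3)[OF assms(1)] periodic_controlD(3)[OF assms(2)]
  unfolding periodic_control_def by simp

lemma periodic_control_const: "periodic_control \<theta> (\<lambda>_. c)"
  unfolding periodic_control_def by simp

text \<open>The periodic solution of y' = h - k y. Variation of constants over one period gives
  exp(k (t + \<theta>)) y(t + \<theta>) - exp(k t) y(t) as the integral of exp(k s) h(s), and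
  periodicity of y then determines y(t), for either sign of \<open>k\<close>.\<close>

definition periodic_filter :: "real \<Rightarrow> real \<Rightarrow> (real \<Rightarrow> real) \<Rightarrow> real \<Rightarrow> real" where
  "periodic_filter \<theta> k h t =
     exp (- k * t) * integral {t..t+\<theta>} (\<lambda>s. exp (k * s) * h s) / (exp (k * \<theta>) - 1)"

text \<open>Sup norm bound of the filter: \<theta> is the length of the window, and
  \<open>exp (\<bar>k\<bar> * \<theta>)\<close> bounds exp(k (s - t)) on it for both signs of
  \<open>k\<close>.\<close>

definition filter_bound :: "real \<Rightarrow> real \<Rightarrow> real" where
  "filter_bound \<theta> k = \<theta> * exp (\<bar>k\<bar> * \<theta>) / \<bar>exp (k * \<theta>) - 1\<bar>"

lemma filter_bound_nonneg: "\<theta> > 0 \<Longrightarrow> filter_bound \<theta> k \<ge> 0"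
  by (simp add: filter_bound_def)

lemma exp_weighted_measurable:
  assumes "periodic_control \<theta> h"
  shows "(\<lambda>s. exp (k * s) * h s :: real) \<in> borel_measurable lebesgue"
    and "bounded ((\<lambda>s. exp (k * s) * h s) ` {a..b})"
    and "(\<lambda>s. exp (k * s) * h s) integrable_on {a..b}"
proof -
  have c: "continuous_on UNIV (\<lambda>s. exp (k * s))" by (intro continuous_intros)
  show 1: "(\<lambda>s. exp (k * s) * h s :: real) \<in> borel_measurable lebesgue"
    by (intro borel_measurable_times continuous_lb[OF c] periodic_controlD[OF assms])
  obtain M where "M \<ge> 0" "\<forall>r\<in>{a..b}. norm (exp (k * r)) \<le> M"
    using lb_bound_ex[OF continuous_lb(2)[OF c]] by blast
  moreover obtain N where "N \<ge> 0" "\<forall>r\<in>{a..b}. norm (h r) \<le> N"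
    using lb_bound_ex[OF periodic_controlD(4)[OF assms]] by blast
  ultimately have "\<forall>r\<in>{a..b}. norm (exp (k * r) * h r) \<le> M * N"
    by (simp add: abs_mult mult_mono)
  then show 2: "bounded ((\<lambda>s. exp (k * s) * h s) ` {a..b})" unfolding bounded_iff by blast
  show "(\<lambda>s. exp (k * s) * h s) integrable_on {a..b}" using lb_integrable[OF 1 2] .
qed

lemma periodic_filter_bound:
  assumes "\<theta> > 0" "periodic_control \<theta> h" "\<And>t. \<bar>h t\<bar> \<le> M"
  shows "\<bar>periodic_filter \<theta> k h t\<bar> \<le> filter_bound \<theta> k * M"
proof -
  have M: "M \<ge> 0" using assms(3)[of 0] by linarith
  have i: "((\<lambda>s. exp (k * s) * h s) has_integral integral {t..t+\<theta>} (\<lambda>s. exp (k * s) * h s)) {t..t+\<theta>}"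
    using exp_weighted_measurable(3)[OF assms(2)] by (rule integrable_integral)
  have "\<bar>integral {t..t+\<theta>} (\<lambda>s. exp (k * s) * h s)\<bar>
    \<le> (exp (k * t) * exp (\<bar>k\<bar> * \<theta>) * M) * (t + \<theta> - t)"
  proof (rule has_integral_Icc_norm_bound[OF i, unfolded real_norm_def])
    fix r assume r: "r \<in> {t..t+\<theta>}"
    have "k * (r - t) \<le> \<bar>k\<bar> * (r - t)" using r by (intro mult_right_mono) auto
    also have "\<dots> \<le> \<bar>k\<bar> * \<theta>" using r by (intro mult_left_mono) auto
    finally have "k * r \<le> k * t + \<bar>k\<bar> * \<theta>" by (simp add: algebra_simps)
    then have "exp (k * r) \<le> exp (k * t) * exp (\<bar>k\<bar> * \<theta>)" by (simp add: exp_add[symmetric])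
    then show "\<bar>exp (k * r) * h r\<bar> \<le> exp (k * t) * exp (\<bar>k\<bar> * \<theta>) * M"
      using assms(3)[of r] M by (simp add: abs_mult mult_mono)
  qed (use assms(1) in simp)
  then have "exp (- k * t) * \<bar>integral {t..t+\<theta>} (\<lambda>s. exp (k * s) * h s)\<bar>
    \<le> exp (- k * t) * ((exp (k * t) * exp (\<bar>k\<bar> * \<theta>) * M) * \<theta>)"
    by (intro mult_left_mono) auto
  also have "\<dots> = \<theta> * exp (\<bar>k\<bar> * \<theta>) * M"
    by (simp add: exp_minus field_simps)
  finally have "exp (- k * t) * \<bar>integral {t..t+\<theta>} (\<lambda>s. exp (k * s) * h s)\<bar> / \<bar>exp (k * \<theta>) - 1\<bar>
    \<le> \<theta> * exp (\<bar>k\<bar> * \<theta>) * M / \<bar>exp (k * \<theta>) - 1\<bar>"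
    by (rule divide_right_mono) simp
  then show ?thesis
    by (simp add: periodic_filter_def filter_bound_def abs_mult)
qed

lemma periodic_filter_diff:
  assumes "periodic_control \<theta> g" "periodic_control \<theta> h"
  shows "periodic_filter \<theta> k (\<lambda>t. g t - h t) t = periodic_filter \<theta> k g t - periodic_filter \<theta> k h t"
  using integral_diff[OF exp_weighted_measurable(3)[OF assms(1), of k t "t+\<theta>"]
      exp_weighted_measurable(3)[OF assms(2), of k t "t+\<theta>"]]
  by (simp add: periodic_filter_def right_diff_distrib diff_divide_distrib)

lemma periodic_filter_cmult:
  "periodic_filter \<theta> k (\<lambda>t. c * h t) t = c * periodic_filter \<theta> k h t"
proof -
  have "(\<lambda>s. exp (k * s) * (c * h s)) = (\<lambda>s. c * (exp (k * s) * h s))" by (simp add: fun_eq_iff)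
  then show ?thesis by (simp add: periodic_filter_def)
qed

text \<open>The window integral is \<open>g t = H (t + \<theta>) - H t\<close> for a primitive
  \<open>H\<close> of the weighted integrand \<open>v\<close>. As \<open>v\<close> is multiplied by
  \<open>c\<close> under a shift by \<theta>, the derivative of \<open>g\<close> is
  \<open>(c - 1) * v\<close>, and the factor cancels against the denominator.\<close>

lemma periodic_filter_derivative:
  assumes "\<theta> > 0" "k \<noteq> 0" "periodic_control \<theta> h"
  shows "has_lb_derivative (periodic_filter \<theta> k h) (\<lambda>t. h t - k * periodic_filter \<theta> k h t)"
    and "periodic_filter \<theta> k h (t + \<theta>) = periodic_filter \<theta> k h t"
proof -
  define c where "c = exp (k * \<theta>)"
  have c: "c \<noteq> 1" using assms(1,2) by (simp add: c_def)
  define v where "v s = exp (k * s) * h s" for s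
  have v: "v \<in> borel_measurable lebesgue" "bounded (v ` {a..b})" for a b
    using exp_weighted_measurable[OF assms(3)] unfolding v_def[abs_def] by blast+
  obtain H where H: "has_lb_derivative H v" using has_lb_derivative_exists[OF v] by blast
  have vs: "v (t + \<theta>) = c * v t" for t
    by (simp add: periodic_controlD(3)[OF assms(3)] v_def c_def exp_add distrib_left)
  have Hs: "has_lb_derivative (\<lambda>t. H (t + \<theta>)) (\<lambda>t. c * v t)"
    by (rule has_lb_derivative_shift[OF H]) (use v vs in auto)
  have cH: "has_lb_derivative (\<lambda>t. c * H t) (\<lambda>t. c * v t)"
    using has_lb_derivative_linear[OF bounded_linear_mult_right H] .
  define g where "g t = H (t + \<theta>) - H t" for t
  have g: "g t = integral {t..t+\<theta>} (\<lambda>s. exp (k * s) * h s)" for t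
    using has_lb_derivativeD(4)[OF H, of t "t + \<theta>"] assms(1) by (simp add: g_def v_def[abs_def])
  have g': "has_lb_derivative g (\<lambda>t. c * v t - v t)"
    unfolding g_def[abs_def] by (rule has_lb_derivative_diff[OF Hs H])
  have F: "periodic_filter \<theta> k h t = exp (- k * t) / (c - 1) * g t" for t
    by (simp add: periodic_filter_def g c_def)
  have E: "has_lb_derivative (\<lambda>t. exp (- k * t) / (c - 1)) (\<lambda>t. - k * (exp (- k * t) / (c - 1)))"
    by (rule has_lb_derivative_C1) (use c in \<open>auto intro!: derivative_eq_intros continuous_intros\<close>)
  have "has_lb_derivative (\<lambda>t. exp (- k * t) / (c - 1) * g t)
     (\<lambda>t. exp (- k * t) / (c - 1) * (c * v t - v t) + - k * (exp (- k * t) / (c - 1)) * g t)"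
    by (rule has_lb_derivative_prod[OF bounded_bilinear_mult E g'])
  also have "(\<lambda>t. exp (- k * t) / (c - 1) * (c * v t - v t) + - k * (exp (- k * t) / (c - 1)) * g t)
    = (\<lambda>t. h t - k * periodic_filter \<theta> k h t)"
  proof
    fix t
    have "c * v t - v t = (c - 1) * v t" by (simp add: left_diff_distrib)
    then have "exp (- k * t) / (c - 1) * (c * v t - v t) = exp (- k * t) * v t * ((c - 1) / (c - 1))"
      by simp
    also have "\<dots> = exp (- k * t) * v t" using c by simp
    also have "\<dots> = h t" by (simp add: v_def exp_minus)
    finally show "exp (- k * t) / (c - 1) * (c * v t - v t) + - k * (exp (- k * t) / (c - 1)) * g t
      = h t - k * periodic_filter \<theta> k h t"
      by (simp add: F)
  qed
  finally show "has_lb_derivative (periodic_filter \<theta> k h) (\<lambda>t. h t - k * periodic_filter \<theta> k h t)"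
    using F by (simp add: F[abs_def])
  \<comment> \<open>Constancy of this difference, used at distance \<theta>, shows that
    \<open>g\<close> is multiplied by \<open>c\<close> over a period; the prefactor
    \<open>exp (- k * t)\<close> undoes this.\<close>
  have "H (t + \<theta>) - c * H t = H (s + \<theta>) - c * H s" for s t
    by (rule has_lb_derivative_zero_const[OF has_lb_derivative_diff[OF Hs cH]]) simp
  then have "g (t + \<theta>) = c * g t"
    using \<open>\<And>s t. H (t + \<theta>) - c * H t = H (s + \<theta>) - c * H s\<close>[of "t + \<theta>" t]
    by (simp add: g_def algebra_simps)
  moreover have "exp (- k * t) = exp (- k * (t + \<theta>)) * c"
    by (simp add: c_def exp_add[symmetric] algebra_simps)
  ultimately show "periodic_filter \<theta> k h (t + \<theta>) = periodic_filter \<theta> k h t"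
    by (simp add: F)
qed

lemma has_lb_derivative_exp_linear: "has_lb_derivative (\<lambda>t. exp (k * t) :: real) (\<lambda>t. k * exp (k * t))"
  by (rule has_lb_derivative_C1) (auto intro!: derivative_eq_intros continuous_intros)

text \<open>The difference \<open>d\<close> of two solutions makes \<open>exp (k * t) * d t\<close>
  constant, and periodicity then gives \<open>exp (k * \<theta>) * d t = d t\<close>, which forces
  \<open>d t = 0\<close> because \<open>k * \<theta>\<close> is nonzero.\<close>

lemma periodic_filter_unique:
  assumes "\<theta> > 0" "k \<noteq> 0" "periodic_control \<theta> h"
    and y: "has_lb_derivative y (\<lambda>t. h t - k * y t)" "\<And>t. y (t + \<theta>) = y t"
  shows "y = periodic_filter \<theta> k h"
proof -
  note F = periodic_filter_derivative[OF assms(1-3)]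
  define d where "d t = y t - periodic_filter \<theta> k h t" for t
  have d: "has_lb_derivative d (\<lambda>t. (h t - k * y t) - (h t - k * periodic_filter \<theta> k h t))"
    unfolding d_def[abs_def] by (rule has_lb_derivative_diff[OF y(1) F(1)])
  have const: "exp (k * t) * d t = exp (k * s) * d s" for s t
    by (rule has_lb_derivative_zero_const[OF has_lb_derivative_prod[OF bounded_bilinear_mult
            has_lb_derivative_exp_linear d]]) (simp add: d_def algebra_simps)
  have per: "d (t + \<theta>) = d t" for t using y(2) F(2) by (simp add: d_def)
  have "d t = 0" for t
  proof -
    have "exp (k * t) * (exp (k * \<theta>) * d t) = exp (k * t) * d t"
      using const[of "t + \<theta>" t] per[of t] by (simp add: distrib_left exp_add)
    then have "exp (k * \<theta>) * d t = d t" by (subst (asm) mult_cancel_left) simp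
    then show ?thesis using assms(1,2) by auto
  qed
  then show ?thesis by (auto simp: d_def fun_eq_iff)
qed

section \<open>The projective equation\<close>

locale spectral_frame =
  fixes L F :: "real^'n^'n" and k :: "'n \<Rightarrow> real" and e \<phi> :: "'n \<Rightarrow> real^'n"
    and b :: 'n and \<theta> :: real and \<gamma> :: "real \<Rightarrow> real"
  assumes theta_pos: "\<theta> > 0" and gamma: "periodic_control \<theta> \<gamma>"
    and L_e: "\<And>i. L *v e i = - k i *\<^sub>R e i" and k_b: "k b = 0" and k_nz: "\<And>i. i \<noteq> b \<Longrightarrow> k i \<noteq> 0"
    and dual: "\<And>i j. \<phi> i \<bullet> e j = (if i = j then 1 else 0)"
    and expansion: "\<And>x. x = (\<Sum>i\<in>UNIV. (\<phi> i \<bullet> x) *\<^sub>R e i)"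
begin

definition T :: "(real \<Rightarrow> real^'n) \<Rightarrow> real \<Rightarrow> real^'n" where
  "T h t = (\<Sum>i\<in>-{b}. periodic_filter \<theta> (k i) (\<lambda>s. \<phi> i \<bullet> h s) t *\<^sub>R e i)"

definition T_bound :: real where
  "T_bound = (\<Sum>i\<in>-{b}. filter_bound \<theta> (k i) * norm (\<phi> i) * norm (e i))"

lemma T_bound_nonneg: "T_bound \<ge> 0"
  unfolding T_bound_def using theta_pos by (intro sum_nonneg) (simp add: filter_bound_nonneg)

lemma coordinate_control: "periodic_control \<theta> h \<Longrightarrow> periodic_control \<theta> (\<lambda>s. \<phi> i \<bullet> h s)"
  by (intro periodic_control_inner periodic_control_const)

lemma T_periodic: "periodic_control \<theta> h \<Longrightarrow> T h (t + \<theta>) = T h t"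
  unfolding T_def using periodic_filter_derivative(2)[OF theta_pos k_nz coordinate_control] by simp

lemma phi_T: "\<phi> b \<bullet> T h t = 0"
  unfolding T_def by (auto simp: inner_sum_right dual intro!: sum.neutral)

lemma T_derivative:
  assumes "periodic_control \<theta> h"
  shows "has_lb_derivative (T h) (\<lambda>t. L *v T h t + (h t - (\<phi> b \<bullet> h t) *\<^sub>R e b))"
proof -
  let ?f = "\<lambda>i. periodic_filter \<theta> (k i) (\<lambda>s. \<phi> i \<bullet> h s)"
  have "has_lb_derivative (\<lambda>t. ?f i t *\<^sub>R e i) (\<lambda>t. (\<phi> i \<bullet> h t - k i * ?f i t) *\<^sub>R e i)"
    if "i \<noteq> b" for i
    using has_lb_derivative_linear[OF bounded_linear_scaleR_left
        periodic_filter_derivative(1)[OF theta_pos k_nz[OF that] coordinate_control[OF assms]]] .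
  then have "has_lb_derivative (T h) (\<lambda>t. \<Sum>i\<in>-{b}. (\<phi> i \<bullet> h t - k i * ?f i t) *\<^sub>R e i)"
    unfolding T_def[abs_def] by (intro has_lb_derivative_sum) auto
  also have "(\<lambda>t. \<Sum>i\<in>-{b}. (\<phi> i \<bullet> h t - k i * ?f i t) *\<^sub>R e i)
    = (\<lambda>t. L *v T h t + (h t - (\<phi> b \<bullet> h t) *\<^sub>R e b))"
  proof
    fix t
    have 1: "L *v T h t = (\<Sum>i\<in>-{b}. - (k i * ?f i t) *\<^sub>R e i)"
      unfolding T_def linear_sum[OF matrix_vector_mul_linear]
      by (simp add: L_e matrix_vector_mult_scaleR mult.commute)
    have "h t = (\<Sum>i\<in>UNIV. (\<phi> i \<bullet> h t) *\<^sub>R e i)" by (rule expansion)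
    also have "\<dots> = (\<phi> b \<bullet> h t) *\<^sub>R e b + (\<Sum>i\<in>-{b}. (\<phi> i \<bullet> h t) *\<^sub>R e i)"
      by (subst sum.remove[of _ b]) (auto simp: Compl_eq_Diff_UNIV)
    finally have 2: "h t - (\<phi> b \<bullet> h t) *\<^sub>R e b = (\<Sum>i\<in>-{b}. (\<phi> i \<bullet> h t) *\<^sub>R e i)"
      by (metis add_diff_cancel_left')
    show "(\<Sum>i\<in>-{b}. (\<phi> i \<bullet> h t - k i * ?f i t) *\<^sub>R e i) = L *v T h t + (h t - (\<phi> b \<bullet> h t) *\<^sub>R e b)"
      unfolding 1 2 sum.distrib[symmetric] by (simp add: scaleR_left_diff_distrib)
  qed
  finally show ?thesis .
qed

lemma T_norm_le:
  assumes "periodic_control \<theta> h" "\<And>t. norm (h t) \<le> M"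
  shows "norm (T h t) \<le> T_bound * M"
proof -
  have "norm (periodic_filter \<theta> (k i) (\<lambda>s. \<phi> i \<bullet> h s) t *\<^sub>R e i)
     \<le> filter_bound \<theta> (k i) * norm (\<phi> i) * norm (e i) * M" for i
  proof -
    have "\<bar>\<phi> i \<bullet> h s\<bar> \<le> norm (\<phi> i) * M" for s
      using Cauchy_Schwarz_ineq2[of "\<phi> i" "h s"] mult_left_mono[OF assms(2)[of s] norm_ge_zero[of "\<phi> i"]]
      by linarith
    then have "\<bar>periodic_filter \<theta> (k i) (\<lambda>s. \<phi> i \<bullet> h s) t\<bar> \<le> filter_bound \<theta> (k i) * (norm (\<phi> i) * M)"
      by (rule periodic_filter_bound[OF theta_pos coordinate_control[OF assms(1)]])
    then have "\<bar>periodic_filter \<theta> (k i) (\<lambda>s. \<phi> i \<bullet> h s) t\<bar> * norm (e i)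
      \<le> filter_bound \<theta> (k i) * (norm (\<phi> i) * M) * norm (e i)"
      by (rule mult_right_mono) simp
    then show ?thesis by (simp add: mult_ac)
  qed
  then show ?thesis
    unfolding T_def T_bound_def sum_distrib_right by (intro order_trans[OF norm_sum] sum_mono)
qed

lemma T_diff:
  assumes "periodic_control \<theta> g" "periodic_control \<theta> h"
  shows "T (\<lambda>t. g t - h t) t = T g t - T h t"
  unfolding T_def
  by (simp add: inner_diff_right periodic_filter_diff[OF coordinate_control[OF assms(1)] coordinate_control[OF assms(2)]]
    scaleR_left_diff_distrib sum_subtractf)

section \<open>The nonlinearity and the contraction\<close>

definition N :: "real^'n \<Rightarrow> real^'n" where
  "N z = F *v z - (\<phi> b \<bullet> (F *v z)) *\<^sub>R z"

text \<open>On this hyperplane the nonlinearity has no \<open>e b\<close> component, so the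
  projection built into \<open>T\<close> removes nothing from it and the fixed point solves the full
  equation.\<close>

lemma phi_N: "\<phi> b \<bullet> z = 1 \<Longrightarrow> \<phi> b \<bullet> N z = 0"
  by (simp add: N_def inner_diff_right)

lemma N_control:
  assumes "periodic_control \<theta> z"
  shows "periodic_control \<theta> (\<lambda>t. N (z t))"
  unfolding N_def
  by (intro periodic_control_diff periodic_control_scaleR periodic_control_inner periodic_control_const
      periodic_control_linear[OF matrix_vector_mul_bounded_linear] assms)

text \<open>\<open>N\<close> is at most quadratic, so its Lipschitz bound is local; the unit ball
  around \<open>e b\<close> is the one on which the contraction is run.\<close>

lemma N_bounds:
  "\<exists>B\<ge>0. \<forall>w w'. norm w \<le> 1 \<and> norm w' \<le> 1 \<longrightarrow>
    norm (N (e b + w)) \<le> B \<and> norm (N (e b + w) - N (e b + w')) \<le> B * norm (w - w')"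
proof -
  obtain f where f: "f > 0" "\<And>x. norm (F *v x) \<le> norm x * f"
    using bounded_linear.pos_bounded[OF matrix_vector_mul_bounded_linear[of F]] by blast
  define p where "p = norm (\<phi> b)"
  define a where "a = norm (e b) + 1"
  have p: "\<bar>\<phi> b \<bullet> (F *v x)\<bar> \<le> p * f * norm x" for x
    using Cauchy_Schwarz_ineq2[of "\<phi> b" "F *v x"]
      mult_left_mono[OF f(2)[of x] norm_ge_zero[of "\<phi> b"]] by (simp add: p_def mult_ac)
  have p0: "p \<ge> 0" and a0: "a \<ge> 0" by (simp_all add: p_def a_def)
  have za: "norm (e b + w) \<le> a" if "norm w \<le> 1" for w
    using norm_triangle_ineq[of "e b" w] that by (simp add: a_def)
  have pa: "\<bar>\<phi> b \<bullet> (F *v (e b + w))\<bar> \<le> p * f * a" if "norm w \<le> 1" for w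
    using p[of "e b + w"] mult_left_mono[OF za[OF that], of "p * f"] p0 f(1) by simp
  have N1: "norm (N (e b + w)) \<le> f * a + p * f * a * a" if w: "norm w \<le> 1" for w
  proof -
    have "norm (N (e b + w)) \<le> norm (F *v (e b + w)) + \<bar>\<phi> b \<bullet> (F *v (e b + w))\<bar> * norm (e b + w)"
      unfolding N_def by (rule order_trans[OF norm_triangle_ineq4]) simp
    also have "\<dots> \<le> f * a + p * f * a * a"
    proof (intro add_mono mult_mono pa[OF w] za[OF w])
      show "norm (F *v (e b + w)) \<le> f * a"
        using f(2)[of "e b + w"] mult_right_mono[OF za[OF w], of f] f(1) unfolding mult.commute[of f a] by linarith
    qed (use p0 a0 f(1) in auto)
    finally show ?thesis .
  qed
  have N2: "norm (N (e b + w) - N (e b + w')) \<le> (f + 2 * p * f * a) * norm (w - w')"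
    if w: "norm w \<le> 1" and w': "norm w' \<le> 1" for w w'
  proof -
    let ?z = "e b + w" and ?z' = "e b + w'"
    have z: "?z - ?z' = w - w'" by simp
    \<comment> \<open>The quadratic term is split by varying one of its two factors at a
      time.\<close>
    have "N ?z - N ?z' = F *v (w - w') - (\<phi> b \<bullet> (F *v (w - w'))) *\<^sub>R ?z - (\<phi> b \<bullet> (F *v ?z')) *\<^sub>R (w - w')"
      unfolding N_def
      by (simp add: matrix_vector_mult_diff_distrib matrix_vector_right_distrib inner_diff_right inner_add_right algebra_simps)
    also have "norm \<dots> \<le> norm (F *v (w - w')) + \<bar>\<phi> b \<bullet> (F *v (w - w'))\<bar> * norm ?z
       + \<bar>\<phi> b \<bullet> (F *v ?z')\<bar> * norm (w - w')"
      by (rule order_trans[OF norm_triangle_ineq4] add_mono | simp)+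
    also have "\<dots> \<le> f * norm (w - w') + p * f * norm (w - w') * a + p * f * a * norm (w - w')"
      using f p[of "w - w'"] za[OF w] pa[OF w'] p0 a0
      by (intro add_mono mult_mono) (auto simp: mult.commute)
    finally show ?thesis by (simp add: algebra_simps)
  qed
  define B where "B = (f * a + p * f * a * a) + (f + 2 * p * f * a)"
  have B0: "f * a + p * f * a * a \<ge> 0" "f + 2 * p * f * a \<ge> 0" using f p0 a0 by simp_all
  show ?thesis
  proof (intro exI[of _ B] conjI allI impI)
    show "B \<ge> 0" using B0 by (simp add: B_def)
    fix w w' :: "real^'n" assume w: "norm w \<le> 1 \<and> norm w' \<le> 1"
    show "norm (N (e b + w)) \<le> B" using N1[of w] w B0 by (simp add: B_def)
    have "(f + 2 * p * f * a) * norm (w - w') \<le> B * norm (w - w')"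
      using B0 by (intro mult_right_mono) (auto simp: B_def)
    then show "norm (N (e b + w) - N (e b + w')) \<le> B * norm (w - w')"
      using N2[of w w'] w by linarith
  qed
qed

definition T\<^sub>N :: "(real \<Rightarrow> real^'n) \<Rightarrow> real \<Rightarrow> real^'n" where
  "T\<^sub>N w = T (\<lambda>s. \<gamma> s *\<^sub>R N (e b + w s))"

lemma TN_control:
  assumes "periodic_control \<theta> w"
  shows "periodic_control \<theta> (\<lambda>s. \<gamma> s *\<^sub>R N (e b + w s))"
  by (intro periodic_control_scaleR gamma N_control periodic_control_add periodic_control_const assms)

text \<open>The distance enters as a number \<open>D\<close> bounding all pointwise differences, so
  that the sup distance of bounded continuous functions can be inserted later.\<close>

lemma TN_bounds:
  "\<exists>C\<ge>0. \<forall>w w' D. periodic_control \<theta> w \<and> periodic_control \<theta> w' \<and>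
      (\<forall>t. norm (w t) \<le> 1) \<and> (\<forall>t. norm (w' t) \<le> 1) \<and> (\<forall>t. norm (w t - w' t) \<le> D) \<longrightarrow>
     (\<forall>t. norm (T\<^sub>N w t) \<le> C \<and> norm (T\<^sub>N w t - T\<^sub>N w' t) \<le> C * D)"
proof -
  obtain B where B: "B \<ge> 0" "\<And>w w'. norm w \<le> 1 \<Longrightarrow> norm w' \<le> 1 \<Longrightarrow>
    norm (N (e b + w)) \<le> B \<and> norm (N (e b + w) - N (e b + w')) \<le> B * norm (w - w')"
    using N_bounds by blast
  obtain g where g: "\<And>t. \<bar>\<gamma> t\<bar> \<le> g"
    using periodic_controlD(2)[OF gamma] unfolding bounded_iff by auto
  have g0: "g \<ge> 0" using g[of 0] by linarith
  show ?thesis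
  proof (intro exI[of _ "T_bound * (g * B)"] conjI allI impI)
    show "0 \<le> T_bound * (g * B)" using T_bound_nonneg g0 B(1) by simp
    fix w w' :: "real \<Rightarrow> real^'n" and D t
    assume *: "periodic_control \<theta> w \<and> periodic_control \<theta> w' \<and>
      (\<forall>t. norm (w t) \<le> 1) \<and> (\<forall>t. norm (w' t) \<le> 1) \<and> (\<forall>t. norm (w t - w' t) \<le> D)"
    then have w: "periodic_control \<theta> w" and w': "periodic_control \<theta> w'"
      and n: "\<And>t. norm (w t) \<le> 1" "\<And>t. norm (w' t) \<le> 1" "\<And>t. norm (w t - w' t) \<le> D" by auto
    show "norm (T\<^sub>N w t) \<le> T_bound * (g * B)"
      unfolding T\<^sub>N_def
    proof (rule T_norm_le[OF TN_control[OF w]])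
      fix t show "norm (\<gamma> t *\<^sub>R N (e b + w t)) \<le> g * B"
        using mult_mono[OF g[of t] conjunct1[OF B(2)[OF n(1)[of t] n(1)[of t]]]] g0 by simp
    qed
    have "norm (T (\<lambda>t. \<gamma> t *\<^sub>R N (e b + w t) - \<gamma> t *\<^sub>R N (e b + w' t)) t) \<le> T_bound * (g * (B * D))"
    proof (rule T_norm_le[OF periodic_control_diff[OF TN_control[OF w] TN_control[OF w']]])
      fix t
      have "norm (N (e b + w t) - N (e b + w' t)) \<le> B * D"
        using B(2)[OF n(1)[of t] n(2)[of t]] mult_left_mono[OF n(3)[of t] B(1)] by linarith
      then show "norm (\<gamma> t *\<^sub>R N (e b + w t) - \<gamma> t *\<^sub>R N (e b + w' t)) \<le> g * (B * D)"
        using mult_mono[OF g[of t] _ g0 norm_ge_zero] by (simp add: scaleR_right_diff_distrib[symmetric])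
    qed
    then show "norm (T\<^sub>N w t - T\<^sub>N w' t) \<le> T_bound * (g * B) * D"
      unfolding T\<^sub>N_def by (simp add: T_diff[OF TN_control[OF w] TN_control[OF w']] mult_ac)
  qed
qed

lemma TN_continuous: "periodic_control \<theta> w \<Longrightarrow> continuous_on UNIV (T\<^sub>N w)"
  unfolding T\<^sub>N_def using has_lb_derivative_continuous[OF T_derivative[OF TN_control]] .

lemma TN_periodic: "periodic_control \<theta> w \<Longrightarrow> T\<^sub>N w (t + \<theta>) = T\<^sub>N w t"
  unfolding T\<^sub>N_def using T_periodic[OF TN_control] .

text \<open>Banach's theorem is applied for each fixed \<epsilon>. The dependence on \<epsilon> is
  then read off the fixed point equation: comparing two parameters gives the Lipschitz bound, and
  inserting that bound once more into the equation gives the quadratic remainder.\<close>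

lemma projective_fixed_point:
  "\<exists>\<epsilon>0>0. \<exists>C\<ge>0. \<exists>w. \<forall>\<epsilon>. \<bar>\<epsilon>\<bar> \<le> \<epsilon>0 \<longrightarrow> periodic_control \<theta> (w \<epsilon>) \<and>
     (\<forall>t. w \<epsilon> t = \<epsilon> *\<^sub>R T\<^sub>N (w \<epsilon>) t \<and> norm (w \<epsilon> t) \<le> C * \<bar>\<epsilon>\<bar> \<and>
       norm (w \<epsilon> t - \<epsilon> *\<^sub>R T\<^sub>N (\<lambda>_. 0) t) \<le> C * \<epsilon>\<^sup>2 \<and>
       (\<forall>\<epsilon>'. \<bar>\<epsilon>'\<bar> \<le> \<epsilon>0 \<longrightarrow> norm (w \<epsilon> t - w \<epsilon>' t) \<le> C * \<bar>\<epsilon> - \<epsilon>'\<bar>))"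
proof -
  obtain C where C: "C \<ge> 0" "\<And>w w' D t. periodic_control \<theta> w \<Longrightarrow> periodic_control \<theta> w' \<Longrightarrow>
      (\<And>t. norm (w t) \<le> 1) \<Longrightarrow> (\<And>t. norm (w' t) \<le> 1) \<Longrightarrow> (\<And>t. norm (w t - w' t) \<le> D) \<Longrightarrow>
      norm (T\<^sub>N w t) \<le> C \<and> norm (T\<^sub>N w t - T\<^sub>N w' t) \<le> C * D"
    using TN_bounds by metis
  \<comment> \<open>Ensures |\<epsilon>| C <= 1/2, so that the map sends the unit ball to itself and
    contracts by 1/2.\<close>
  define \<epsilon>0 where "\<epsilon>0 = 1 / (2 * (C + 1))"
  have e0: "\<epsilon>0 > 0" using C(1) by (simp add: \<epsilon>0_def)
  have e0C: "\<bar>\<epsilon>\<bar> * C \<le> 1/2" if "\<bar>\<epsilon>\<bar> \<le> \<epsilon>0" for \<epsilon>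
  proof -
    have "\<bar>\<epsilon>\<bar> * C \<le> \<epsilon>0 * C" using that C(1) by (rule mult_right_mono)
    also have "\<dots> \<le> 1/2" using C(1) by (simp add: \<epsilon>0_def field_simps)
    finally show ?thesis .
  qed
  \<comment> \<open>Periodicity is built into the set because \<open>T\<^sub>N\<close> is controlled
    only on periodic functions; the radius 1 is that of \<open>N_bounds\<close>.\<close>
  define S where "S = {w :: real \<Rightarrow>\<^sub>C (real^'n). (\<forall>t. apply_bcontfun w (t + \<theta>) = apply_bcontfun w t) \<and> norm w \<le> 1}"
  have S: "periodic_control \<theta> (apply_bcontfun w)" "norm (w t) \<le> 1" if "w \<in> S" for w t
  proof -
    show "periodic_control \<theta> (apply_bcontfun w)"
      using that by (intro continuous_periodic_control theta_pos) (auto simp: S_def)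
    show "norm (w t) \<le> 1" using norm_bounded[of w t] that by (auto simp: S_def)
  qed
  have "closed S"
  proof (subst closed_sequential_limits, intro allI impI, elim conjE)
    fix x l assume x: "\<forall>n. x n \<in> S" and l: "x \<longlonglongrightarrow> l"
    have lim: "(\<lambda>n. apply_bcontfun (x n) t) \<longlonglongrightarrow> l t" for t
    proof (rule tendsto_dist_iff[THEN iffD2], rule tendsto_sandwich[of "\<lambda>_. 0"])
      show "(\<lambda>n. dist (x n) l) \<longlonglongrightarrow> 0" using l by (simp add: tendsto_dist_iff[symmetric])
    qed (auto simp: dist_bounded)
    have "l (t + \<theta>) = l t" for t
      using LIMSEQ_unique[OF lim[of "t + \<theta>"]] lim[of t] x by (simp add: S_def)
    moreover have "norm l \<le> 1"
      using tendsto_norm[OF l] x by (intro LIMSEQ_le_const2[of _ "norm l"]) (auto simp: S_def)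
    ultimately show "l \<in> S" by (simp add: S_def)
  qed
  then have Sc: "complete S" by (simp add: complete_eq_closed)
  have S0: "0 \<in> S" by (simp add: S_def)
  \<comment> \<open>\<open>Bcontfun\<close> has a known value only on bounded continuous functions,
    which is guaranteed for arguments in \<open>S\<close>.\<close>
  define P where "P \<epsilon> w = Bcontfun (\<lambda>t. \<epsilon> *\<^sub>R T\<^sub>N (apply_bcontfun w) t)" for \<epsilon> w
  have P: "apply_bcontfun (P \<epsilon> w) t = \<epsilon> *\<^sub>R T\<^sub>N (apply_bcontfun w) t" if "w \<in> S" for \<epsilon> w t
  proof -
    have "(\<lambda>t. \<epsilon> *\<^sub>R T\<^sub>N (apply_bcontfun w) t) \<in> bcontfun"
    proof (rule bcontfun_normI[where b = "\<bar>\<epsilon>\<bar> * C"])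
      show "continuous_on UNIV (\<lambda>t. \<epsilon> *\<^sub>R T\<^sub>N (apply_bcontfun w) t)"
        by (intro continuous_intros TN_continuous S that)
      fix t show "norm (\<epsilon> *\<^sub>R T\<^sub>N (apply_bcontfun w) t) \<le> \<bar>\<epsilon>\<bar> * C"
        using conjunct1[OF C(2)[OF S(1)[OF that] S(1)[OF that] S(2)[OF that] S(2)[OF that], of 0 t]]
        by (simp add: mult_left_mono)
    qed
    then show ?thesis by (simp add: P_def Bcontfun_inverse)
  qed
  have TC: "norm (T\<^sub>N w t) \<le> C" "norm (T\<^sub>N w t - T\<^sub>N w' t) \<le> C * dist w w'"
    if w: "w \<in> S" "w' \<in> S" for w w' :: "real \<Rightarrow>\<^sub>C (real^'n)" and t
    using C(2)[OF S(1)[OF w(1)] S(1)[OF w(2)] S(2)[OF w(1)] S(2)[OF w(2)], of "dist w w'" t]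
      dist_bounded[of w _ w'] by (auto simp: dist_norm)
  have ex: "\<exists>!w. w \<in> S \<and> P \<epsilon> w = w" if eps: "\<bar>\<epsilon>\<bar> \<le> \<epsilon>0" for \<epsilon>
  proof (rule Banach_fix[OF Sc, of "1/2"])
    show "S \<noteq> {}" using S0 by auto
    show "P \<epsilon> ` S \<subseteq> S"
    proof safe
      fix w assume w: "w \<in> S"
      have "norm (P \<epsilon> w) \<le> 1"
      proof (rule norm_bound)
        fix t
        have "norm (P \<epsilon> w t) \<le> \<bar>\<epsilon>\<bar> * C" using TC(1)[OF w w] P[OF w] by (simp add: mult_left_mono)
        then show "norm (P \<epsilon> w t) \<le> 1" using e0C[OF eps] by linarith
      qed
      then show "P \<epsilon> w \<in> S" using P[OF w] TN_periodic[OF S(1)[OF w]] by (simp add: S_def)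
    qed
    fix w w' assume w: "w \<in> S" "w' \<in> S"
    show "dist (P \<epsilon> w) (P \<epsilon> w') \<le> 1/2 * dist w w'"
    proof (rule dist_bound)
      fix t
      have "dist (P \<epsilon> w t) (P \<epsilon> w' t) = \<bar>\<epsilon>\<bar> * norm (T\<^sub>N w t - T\<^sub>N w' t)"
        using P w by (simp add: dist_norm scaleR_right_diff_distrib[symmetric])
      also have "\<dots> \<le> \<bar>\<epsilon>\<bar> * (C * dist w w')" by (intro mult_left_mono TC w) auto
      also have "\<dots> \<le> 1/2 * dist w w'"
        using mult_right_mono[OF e0C[OF eps], of "dist w w'"] by (simp add: mult.assoc)
      finally show "dist (P \<epsilon> w t) (P \<epsilon> w' t) \<le> 1/2 * dist w w'" .
    qed
  qed auto
  define w where "w \<epsilon> = (THE w. w \<in> S \<and> P \<epsilon> w = w)" for \<epsilon>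
  have w: "w \<epsilon> \<in> S" "P \<epsilon> (w \<epsilon>) = w \<epsilon>" if "\<bar>\<epsilon>\<bar> \<le> \<epsilon>0" for \<epsilon>
    using theI'[OF ex[OF that]] unfolding w_def by auto
  have fp: "w \<epsilon> t = \<epsilon> *\<^sub>R T\<^sub>N (w \<epsilon>) t" if "\<bar>\<epsilon>\<bar> \<le> \<epsilon>0" for \<epsilon> t
    using P[OF w(1)[OF that], of \<epsilon> t] w(2)[OF that] by simp
  have lip: "dist (w \<epsilon>) (w \<epsilon>') \<le> 2 * C * \<bar>\<epsilon> - \<epsilon>'\<bar>" if eps: "\<bar>\<epsilon>\<bar> \<le> \<epsilon>0" "\<bar>\<epsilon>'\<bar> \<le> \<epsilon>0" for \<epsilon> \<epsilon>'
  proof -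
    note W = w(1)[OF eps(1)] w(1)[OF eps(2)]
    \<comment> \<open>Absorbing the half distance on the left yields the Lipschitz constant
      \<open>2 * C\<close>.\<close>
    have "dist (w \<epsilon>) (w \<epsilon>') \<le> 1/2 * dist (w \<epsilon>) (w \<epsilon>') + \<bar>\<epsilon> - \<epsilon>'\<bar> * C"
    proof (rule dist_bound)
      fix t
      have "w \<epsilon> t - w \<epsilon>' t = \<epsilon> *\<^sub>R (T\<^sub>N (w \<epsilon>) t - T\<^sub>N (w \<epsilon>') t) + (\<epsilon> - \<epsilon>') *\<^sub>R T\<^sub>N (w \<epsilon>') t"
        using fp[OF eps(1)] fp[OF eps(2)] by (simp add: algebra_simps)
      then have "dist (w \<epsilon> t) (w \<epsilon>' t) \<le> \<bar>\<epsilon>\<bar> * norm (T\<^sub>N (w \<epsilon>) t - T\<^sub>N (w \<epsilon>') t) + \<bar>\<epsilon> - \<epsilon>'\<bar> * norm (T\<^sub>N (w \<epsilon>') t)"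
        by (metis dist_norm norm_triangle_ineq norm_scaleR)
      also have "\<dots> \<le> \<bar>\<epsilon>\<bar> * (C * dist (w \<epsilon>) (w \<epsilon>')) + \<bar>\<epsilon> - \<epsilon>'\<bar> * C"
        by (intro add_mono mult_left_mono TC(2)[OF W] TC(1)[OF W(2) W(2)]) auto
      also have "\<bar>\<epsilon>\<bar> * (C * dist (w \<epsilon>) (w \<epsilon>')) \<le> 1/2 * dist (w \<epsilon>) (w \<epsilon>')"
        using mult_right_mono[OF e0C[OF eps(1)], of "dist (w \<epsilon>) (w \<epsilon>')"] by (simp add: mult.assoc)
      finally show "dist (w \<epsilon> t) (w \<epsilon>' t) \<le> 1/2 * dist (w \<epsilon>) (w \<epsilon>') + \<bar>\<epsilon> - \<epsilon>'\<bar> * C" by simp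
    qed
    then show ?thesis by (simp add: mult_ac)
  qed
  have z0: "\<bar>0::real\<bar> \<le> \<epsilon>0" using e0 by simp
  have w0: "w 0 = 0" by (rule bcontfun_eqI) (use fp[OF z0] in simp)
  have n: "dist (w \<epsilon>) 0 \<le> 2 * C * \<bar>\<epsilon>\<bar>" if "\<bar>\<epsilon>\<bar> \<le> \<epsilon>0" for \<epsilon>
    using lip[OF that z0] w0 by simp
  \<comment> \<open>Majorises both the Lipschitz constant \<open>2 * C\<close> and the constant
    \<open>2 * C * C\<close> of the quadratic remainder.\<close>
  define C' where "C' = 2 * C + 2 * C * C"
  have C': "C' \<ge> 0" "2 * C \<le> C'" "2 * C * C \<le> C'" using C(1) by (simp_all add: C'_def)
  show ?thesis
  proof (rule exI[of _ \<epsilon>0], rule conjI[OF e0], rule exI[of _ C'], rule conjI[OF C'(1)],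
      rule exI[of _ "\<lambda>\<epsilon>. apply_bcontfun (w \<epsilon>)"], intro conjI allI impI)
    fix \<epsilon> t assume eps: "\<bar>\<epsilon>\<bar> \<le> \<epsilon>0"
    show "periodic_control \<theta> (apply_bcontfun (w \<epsilon>))" by (rule S(1)[OF w(1)[OF eps]])
    show "w \<epsilon> t = \<epsilon> *\<^sub>R T\<^sub>N (w \<epsilon>) t" by (rule fp[OF eps])
    have "norm (w \<epsilon> t) \<le> 2 * C * \<bar>\<epsilon>\<bar>" using norm_bounded[of "w \<epsilon>" t] n[OF eps] by simp
    also have "\<dots> \<le> C' * \<bar>\<epsilon>\<bar>" using C' by (intro mult_right_mono) auto
    finally show "norm (w \<epsilon> t) \<le> C' * \<bar>\<epsilon>\<bar>" .
    have "w \<epsilon> t - \<epsilon> *\<^sub>R T\<^sub>N (\<lambda>_. 0) t = \<epsilon> *\<^sub>R (T\<^sub>N (w \<epsilon>) t - T\<^sub>N (apply_bcontfun 0) t)"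
      using fp[OF eps, of t] by (simp add: scaleR_right_diff_distrib zero_bcontfun.rep_eq)
    also have "norm \<dots> \<le> \<bar>\<epsilon>\<bar> * (C * dist (w \<epsilon>) 0)"
      unfolding norm_scaleR by (intro mult_left_mono TC w[OF eps] S0) auto
    also have "\<dots> \<le> \<bar>\<epsilon>\<bar> * (C * (2 * C * \<bar>\<epsilon>\<bar>))"
      by (intro mult_left_mono n eps C) auto
    also have "\<dots> = 2 * C * C * \<epsilon>\<^sup>2" by (simp add: power2_eq_square abs_mult_self_eq mult_ac)
    also have "\<dots> \<le> C' * \<epsilon>\<^sup>2" using C' by (intro mult_right_mono) auto
    finally show "norm (w \<epsilon> t - \<epsilon> *\<^sub>R T\<^sub>N (\<lambda>_. 0) t) \<le> C' * \<epsilon>\<^sup>2" .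
    fix \<epsilon>' assume eps': "\<bar>\<epsilon>'\<bar> \<le> \<epsilon>0"
    have "norm (w \<epsilon> t - w \<epsilon>' t) \<le> 2 * C * \<bar>\<epsilon> - \<epsilon>'\<bar>"
      using dist_bounded[of "w \<epsilon>" t "w \<epsilon>'"] lip[OF eps eps'] by (simp add: dist_norm)
    also have "\<dots> \<le> C' * \<bar>\<epsilon> - \<epsilon>'\<bar>" using C' by (intro mult_right_mono) auto
    finally show "norm (w \<epsilon> t - w \<epsilon>' t) \<le> C' * \<bar>\<epsilon> - \<epsilon>'\<bar>" .
  qed
qed

end

text \<open>The explicit linear term is \<open>T\<^sub>N\<close> at the zero function. For
  \<open>i\<close> other than \<open>b\<close> the functional \<open>\<phi> i\<close> kills the
  \<open>e b\<close> part of \<open>N (e b)\<close>, so only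
  \<open>\<phi> i \<bullet> (F *v e b)\<close> times the filtered control remains.\<close>

lemma (in spectral_frame) projective_family:
  "\<exists>\<epsilon>0>0. \<exists>C\<ge>0. \<exists>z. \<forall>\<epsilon>. \<bar>\<epsilon>\<bar> \<le> \<epsilon>0 \<longrightarrow> periodic_control \<theta> (z \<epsilon>) \<and>
     has_lb_derivative (z \<epsilon>)
       (\<lambda>t. L *v z \<epsilon> t + (\<epsilon> * \<gamma> t) *\<^sub>R (F *v z \<epsilon> t - (\<phi> b \<bullet> (F *v z \<epsilon> t)) *\<^sub>R z \<epsilon> t)) \<and>
     (\<forall>t. \<phi> b \<bullet> z \<epsilon> t = 1 \<and> norm (z \<epsilon> t - e b) \<le> C * \<bar>\<epsilon>\<bar> \<and>
       norm (z \<epsilon> t - e b - \<epsilon> *\<^sub>R (\<Sum>i\<in>-{b}. ((\<phi> i \<bullet> (F *v e b)) * periodic_filter \<theta> (k i) \<gamma> t) *\<^sub>R e i))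
         \<le> C * \<epsilon>\<^sup>2 \<and>
       (\<forall>\<epsilon>'. \<bar>\<epsilon>'\<bar> \<le> \<epsilon>0 \<longrightarrow> norm (z \<epsilon> t - z \<epsilon>' t) \<le> C * \<bar>\<epsilon> - \<epsilon>'\<bar>))"
proof -
  obtain \<epsilon>0 C w where e0: "\<epsilon>0 > 0" and C: "C \<ge> 0" and w: "\<forall>\<epsilon>. \<bar>\<epsilon>\<bar> \<le> \<epsilon>0 \<longrightarrow> periodic_control \<theta> (w \<epsilon>) \<and>
     (\<forall>t. w \<epsilon> t = \<epsilon> *\<^sub>R T\<^sub>N (w \<epsilon>) t \<and> norm (w \<epsilon> t) \<le> C * \<bar>\<epsilon>\<bar> \<and>
       norm (w \<epsilon> t - \<epsilon> *\<^sub>R T\<^sub>N (\<lambda>_. 0) t) \<le> C * \<epsilon>\<^sup>2 \<and>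
       (\<forall>\<epsilon>'. \<bar>\<epsilon>'\<bar> \<le> \<epsilon>0 \<longrightarrow> norm (w \<epsilon> t - w \<epsilon>' t) \<le> C * \<bar>\<epsilon> - \<epsilon>'\<bar>))"
    using projective_fixed_point by blast
  have first: "T\<^sub>N (\<lambda>_. 0) t = (\<Sum>i\<in>-{b}. ((\<phi> i \<bullet> (F *v e b)) * periodic_filter \<theta> (k i) \<gamma> t) *\<^sub>R e i)" for t
  proof -
    have "periodic_filter \<theta> (k i) (\<lambda>s. \<phi> i \<bullet> (\<gamma> s *\<^sub>R N (e b + 0))) t
      = (\<phi> i \<bullet> (F *v e b)) * periodic_filter \<theta> (k i) \<gamma> t" if "i \<noteq> b" for i
    proof -
      have "(\<lambda>s. \<phi> i \<bullet> (\<gamma> s *\<^sub>R N (e b + 0))) = (\<lambda>s. (\<phi> i \<bullet> (F *v e b)) * \<gamma> s)"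
        using that by (simp add: N_def inner_diff_right dual mult.commute)
      then show ?thesis by (simp add: periodic_filter_cmult)
    qed
    then show ?thesis unfolding T\<^sub>N_def T_def by (intro sum.cong) auto
  qed
  define z where "z \<epsilon> t = e b + w \<epsilon> t" for \<epsilon> t
  show ?thesis
  proof (rule exI[of _ \<epsilon>0], rule conjI[OF e0], rule exI[of _ C], rule conjI[OF C],
      rule exI[of _ z], intro allI impI)
    fix \<epsilon> assume eps: "\<bar>\<epsilon>\<bar> \<le> \<epsilon>0"
    have wp: "periodic_control \<theta> (w \<epsilon>)" and fp: "\<And>t. w \<epsilon> t = \<epsilon> *\<^sub>R T\<^sub>N (w \<epsilon>) t"
      using w eps by blast+
    \<comment> \<open>The normalisation is automatic: \<open>T\<close> takes values in the kernel of
      \<open>\<phi> b\<close>.\<close>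
    have one: "\<phi> b \<bullet> z \<epsilon> t = 1" for t
      by (simp add: z_def inner_add_right dual fp[of t]) (simp add: T\<^sub>N_def phi_T)
    have "has_lb_derivative (\<lambda>t. \<epsilon> *\<^sub>R T\<^sub>N (w \<epsilon>) t) (\<lambda>t. \<epsilon> *\<^sub>R (L *v T\<^sub>N (w \<epsilon>) t + \<gamma> t *\<^sub>R N (z \<epsilon> t)))"
    proof (rule has_lb_derivative_linear[OF bounded_linear_scaleR_right])
      show "has_lb_derivative (T\<^sub>N (w \<epsilon>)) (\<lambda>t. L *v T\<^sub>N (w \<epsilon>) t + \<gamma> t *\<^sub>R N (z \<epsilon> t))"
        using T_derivative[OF TN_control[OF wp]] phi_N[OF one]
        by (simp add: T\<^sub>N_def z_def)
    qed
    moreover have "(\<lambda>t. \<epsilon> *\<^sub>R T\<^sub>N (w \<epsilon>) t) = w \<epsilon>"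
      using fp[symmetric] by (rule ext)
    ultimately have "has_lb_derivative (\<lambda>t. e b + w \<epsilon> t) (\<lambda>t. 0 + \<epsilon> *\<^sub>R (L *v T\<^sub>N (w \<epsilon>) t + \<gamma> t *\<^sub>R N (z \<epsilon> t)))"
      by (intro has_lb_derivative_add has_lb_derivative_const) simp
    moreover have "0 + \<epsilon> *\<^sub>R (L *v T\<^sub>N (w \<epsilon>) t + \<gamma> t *\<^sub>R N (z \<epsilon> t))
      = L *v z \<epsilon> t + (\<epsilon> * \<gamma> t) *\<^sub>R (F *v z \<epsilon> t - (\<phi> b \<bullet> (F *v z \<epsilon> t)) *\<^sub>R z \<epsilon> t)" for t
    proof -
      have "L *v z \<epsilon> t = \<epsilon> *\<^sub>R (L *v T\<^sub>N (w \<epsilon>) t)"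
        by (simp add: z_def matrix_vector_right_distrib L_e k_b fp[of t] matrix_vector_mult_scaleR)
      then show ?thesis by (simp add: N_def scaleR_right_distrib)
    qed
    ultimately have der: "has_lb_derivative (z \<epsilon>)
       (\<lambda>t. L *v z \<epsilon> t + (\<epsilon> * \<gamma> t) *\<^sub>R (F *v z \<epsilon> t - (\<phi> b \<bullet> (F *v z \<epsilon> t)) *\<^sub>R z \<epsilon> t))"
      by (simp add: z_def[abs_def])
    have "periodic_control \<theta> (z \<epsilon>)"
      unfolding z_def[abs_def] by (intro periodic_control_add periodic_control_const wp)
    moreover have "\<forall>t. norm (w \<epsilon> t) \<le> C * \<bar>\<epsilon>\<bar> \<and> norm (w \<epsilon> t - \<epsilon> *\<^sub>R T\<^sub>N (\<lambda>_. 0) t) \<le> C * \<epsilon>\<^sup>2 \<and>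
       (\<forall>\<epsilon>'. \<bar>\<epsilon>'\<bar> \<le> \<epsilon>0 \<longrightarrow> norm (w \<epsilon> t - w \<epsilon>' t) \<le> C * \<bar>\<epsilon> - \<epsilon>'\<bar>)"
      using w eps by blast
    moreover have "z \<epsilon> t - e b = w \<epsilon> t" "z \<epsilon> t - z \<epsilon>' t = w \<epsilon> t - w \<epsilon>' t" for t \<epsilon>'
      by (simp_all add: z_def)
    ultimately show "periodic_control \<theta> (z \<epsilon>) \<and>
     has_lb_derivative (z \<epsilon>)
       (\<lambda>t. L *v z \<epsilon> t + (\<epsilon> * \<gamma> t) *\<^sub>R (F *v z \<epsilon> t - (\<phi> b \<bullet> (F *v z \<epsilon> t)) *\<^sub>R z \<epsilon> t)) \<and>
     (\<forall>t. \<phi> b \<bullet> z \<epsilon> t = 1 \<and> norm (z \<epsilon> t - e b) \<le> C * \<bar>\<epsilon>\<bar> \<and>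
       norm (z \<epsilon> t - e b - \<epsilon> *\<^sub>R (\<Sum>i\<in>-{b}. ((\<phi> i \<bullet> (F *v e b)) * periodic_filter \<theta> (k i) \<gamma> t) *\<^sub>R e i))
         \<le> C * \<epsilon>\<^sup>2 \<and>
       (\<forall>\<epsilon>'. \<bar>\<epsilon>'\<bar> \<le> \<epsilon>0 \<longrightarrow> norm (z \<epsilon> t - z \<epsilon>' t) \<le> C * \<bar>\<epsilon> - \<epsilon>'\<bar>))"
      using der one unfolding first[symmetric] by simp
  qed
qed

text \<open>The integrand of a Caratheodory solution is not known to be bounded. Continuity comes
  first; with periodicity it bounds the solution, and the equation then supplies a bounded
  integrand.\<close>

lemma has_ae_derivative_continuous:
  assumes "has_ae_derivative x v"
  shows "continuous_on UNIV x"
proof -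
  have "isCont x t" for t
  proof -
    have "v integrable_on {t-1..t+1}"
      using assms set_lebesgue_integral_eq_integral(1)[of "{t-1..t+1}" v]
      unfolding has_ae_derivative_def by simp
    then have "continuous_on {t-1..t+1} (\<lambda>s. x (t-1) + integral {t-1..s} v)"
      by (intro continuous_intros indefinite_integral_continuous_1)
    moreover have "x (t-1) + integral {t-1..s} v = x s" if "s \<in> {t-1..t+1}" for s
    proof -
      have "x s - x (t-1) = integral {t-1..s} v"
        using assms that unfolding has_ae_derivative_def by simp
      then show ?thesis by (metis add.commute diff_add_cancel)
    qed
    ultimately have "continuous_on {t-1..t+1} x"
      by (rule continuous_on_eq)
    then show ?thesis by (rule continuous_on_interior) simp
  qed
  then show ?thesis by (simp add: continuous_on_eq_continuous_at)
qed

text \<open>With \<open>Q\<close> a primitive of \<open>q\<close>, the product of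
  \<open>exp (- Q t)\<close> and \<open>p t\<close> is constant. Since \<open>p\<close> returns to
  the same nonzero value after a period, so does \<open>Q\<close>.\<close>

lemma periodic_log_derivative_integral:
  fixes p q :: "real \<Rightarrow> real"
  assumes "\<theta> > 0" and p: "has_lb_derivative p (\<lambda>t. q t * p t)" and q: "periodic_control \<theta> q"
    and pos: "\<And>t. p t > 0" and per: "\<And>t. p (t + \<theta>) = p t"
  shows "integral {0..\<theta>} q = 0"
proof -
  obtain Q where Q: "has_lb_derivative Q q"
    using has_lb_derivative_exists periodic_controlD(1,4)[OF q] by blast
  have nQ: "has_lb_derivative (\<lambda>t. - Q t) (\<lambda>t. - q t)"
    using has_lb_derivative_linear[OF bounded_linear_minus[OF bounded_linear_ident] Q] .
  have "exp (- Q \<theta>) * p \<theta> = exp (- Q 0) * p 0"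
    by (rule has_lb_derivative_zero_const[OF has_lb_derivative_prod[OF bounded_bilinear_mult
            has_lb_derivative_exp[OF nQ] p]]) (simp add: algebra_simps)
  moreover have "p \<theta> = p 0" using per[of 0] by simp
  ultimately have "Q \<theta> = Q 0" using pos[of 0] by simp
  then show ?thesis using has_lb_derivativeD(4)[OF Q, of 0 \<theta>] assms(1) by simp
qed

section \<open>The Floquet eigenvalue and the adjoint equation\<close>

lemma time_average_add:
  "f integrable_on {0..\<theta>} \<Longrightarrow> g integrable_on {0..\<theta>} \<Longrightarrow>
    time_average \<theta> (\<lambda>t. f t + g t) = time_average \<theta> f + time_average \<theta> g"
  by (simp add: time_average_def integral_add distrib_left)

lemma time_average_diff:
  "f integrable_on {0..\<theta>} \<Longrightarrow> g integrable_on {0..\<theta>} \<Longrightarrow>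
    time_average \<theta> (\<lambda>t. f t - g t) = time_average \<theta> f - time_average \<theta> g"
  by (simp add: time_average_def integral_diff right_diff_distrib diff_divide_distrib)

lemma time_average_cmult: "time_average \<theta> (\<lambda>t. c * f t) = c * time_average \<theta> f"
  by (simp add: time_average_def)

lemma time_average_const: "\<theta> > 0 \<Longrightarrow> time_average \<theta> (\<lambda>_. c) = c"
  by (simp add: time_average_def)

lemma time_average_bound:
  assumes "\<theta> > 0" "periodic_control \<theta> f" "\<And>t. \<bar>f t\<bar> \<le> B"
  shows "\<bar>time_average \<theta> f\<bar> \<le> B"
proof -
  have "\<bar>integral {0..\<theta>} f\<bar> \<le> B * (\<theta> - 0)"
    using has_integral_Icc_norm_bound[OF integrable_integral[OF periodic_controlD(5)[OF assms(2)]], of 0 \<theta> B]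
      assms(1,3) by simp
  then show ?thesis using assms(1) by (simp add: time_average_def field_simps)
qed

lemma has_lb_derivative_cong:
  "has_lb_derivative x v \<Longrightarrow> (\<And>t. v t = w t) \<Longrightarrow> has_lb_derivative x w"
  by (metis ext)

lemma time_average_derivative:
  assumes "\<theta> > 0" "has_lb_derivative x v" "\<And>t. x (t + \<theta>) = x t"
  shows "time_average \<theta> v = 0"
proof -
  have "x \<theta> = x 0" using assms(3)[of 0] by simp
  then show ?thesis
    using has_lb_derivativeD(4)[OF assms(2), of 0 \<theta>] assms(1) by (simp add: time_average_def)
qed

text \<open>Collects what Perron-Frobenius theory has to provide at the base point: positive left
  and right eigenvectors for \<open>b\<close>, and an eigenvalue \<open>lam b\<close> distinct from
  the others.\<close>

locale floquet_frame =
  fixes G F A :: "real^'n^'n" and \<alpha>s :: real and lam :: "'n \<Rightarrow> real" and e \<phi> :: "'n \<Rightarrow> real^'n"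
    and b :: 'n and \<theta> :: real and \<gamma> :: "real \<Rightarrow> real"
  assumes A_def: "A = G + \<alpha>s *\<^sub>R F"
    and theta_pos: "\<theta> > 0" and gamma: "periodic_control \<theta> \<gamma>"
    and A_e: "\<And>i. A *v e i = lam i *\<^sub>R e i" and phi_A: "\<And>i. \<phi> i v* A = lam i *\<^sub>R \<phi> i"
    and lam_neq: "\<And>i. i \<noteq> b \<Longrightarrow> lam i \<noteq> lam b"
    and dual: "\<And>i j. \<phi> i \<bullet> e j = (if i = j then 1 else 0)"
    and expansion: "\<And>x. x = (\<Sum>i\<in>UNIV. (\<phi> i \<bullet> x) *\<^sub>R e i)"
    and e_pos: "\<And>i. e b $ i > 0" and phi_pos: "\<And>i. \<phi> b $ i > 0"
begin

lemma dual_expansion: "x = (\<Sum>i\<in>UNIV. (e i \<bullet> x) *\<^sub>R \<phi> i)"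
proof -
  have "x \<bullet> y = (\<Sum>i\<in>UNIV. (e i \<bullet> x) *\<^sub>R \<phi> i) \<bullet> y" for y
  proof -
    have "x \<bullet> y = x \<bullet> (\<Sum>i\<in>UNIV. (\<phi> i \<bullet> y) *\<^sub>R e i)" using expansion[of y] by simp
    then show ?thesis by (simp add: inner_sum_right inner_sum_left inner_commute mult.commute)
  qed
  then show ?thesis by (metis vector_eq_rdot)
qed

sublocale primal: spectral_frame "A - lam b *\<^sub>R mat 1" F "\<lambda>i. lam b - lam i" e \<phi> b \<theta> \<gamma>
proof
  show "(A - lam b *\<^sub>R mat 1) *v e i = - (lam b - lam i) *\<^sub>R e i" for i
    by (simp add: matrix_vector_mult_diff_rdistrib A_e scaleR_matrix_vector_assoc[symmetric] algebra_simps)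
  show "lam b - lam i \<noteq> 0" if "i \<noteq> b" for i using lam_neq[OF that] by simp
qed (use theta_pos gamma dual expansion in auto)

text \<open>The adjoint is taken with a minus sign, so that at \<epsilon> = 0 its pairing with
  primal solutions is conserved. The roles of \<open>e\<close> and \<open>\<phi>\<close> are
  exchanged and the spectrum changes sign, hence the opposite filter rates.\<close>

sublocale adjoint: spectral_frame "lam b *\<^sub>R mat 1 - transpose A" "- transpose F" "\<lambda>i. lam i - lam b" \<phi> e b \<theta> \<gamma>
proof
  show "(lam b *\<^sub>R mat 1 - transpose A) *v \<phi> i = - (lam i - lam b) *\<^sub>R \<phi> i" for i
    by (simp add: matrix_vector_mult_diff_rdistrib phi_A scaleR_matrix_vector_assoc[symmetric] algebra_simps)
  show "e i \<bullet> \<phi> j = (if i = j then 1 else 0)" for i j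
    using dual[of j i] by (auto simp: inner_commute)
qed (use theta_pos gamma lam_neq dual_expansion in auto)

text \<open>\<open>Zsol\<close> and \<open>Ysol\<close> are the projective equations of \<open>x' = (A + \<epsilon> \<gamma> F) x\<close> and of its adjoint; both are
  instances of the equation of \<open>spectral_frame\<close>.\<close>

definition Zsol :: "real \<Rightarrow> (real \<Rightarrow> real^'n) \<Rightarrow> bool" where
  "Zsol \<epsilon> z \<longleftrightarrow> periodic_control \<theta> z \<and>
     has_lb_derivative z (\<lambda>t. A *v z t - lam b *\<^sub>R z t
       + (\<epsilon> * \<gamma> t) *\<^sub>R (F *v z t - (\<phi> b \<bullet> (F *v z t)) *\<^sub>R z t)) \<and>
     (\<forall>t. \<phi> b \<bullet> z t = 1 \<and> (\<forall>i. z t $ i > 0))"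

definition Ysol :: "real \<Rightarrow> (real \<Rightarrow> real^'n) \<Rightarrow> bool" where
  "Ysol \<epsilon> y \<longleftrightarrow> periodic_control \<theta> y \<and>
     has_lb_derivative y (\<lambda>t. lam b *\<^sub>R y t - y t v* A
       - (\<epsilon> * \<gamma> t) *\<^sub>R (y t v* F - (y t \<bullet> (F *v e b)) *\<^sub>R y t)) \<and>
     (\<forall>t. y t \<bullet> e b = 1 \<and> (\<forall>i. y t $ i > 0))"

text \<open>The first order coefficients in \<open>\<epsilon>\<close> of the solutions of \<open>Zsol\<close> and \<open>Ysol\<close>.\<close>

definition z1 :: "real \<Rightarrow> real^'n" where
  "z1 t = (\<Sum>i\<in>-{b}. ((\<phi> i \<bullet> (F *v e b)) * periodic_filter \<theta> (lam b - lam i) \<gamma> t) *\<^sub>R e i)"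

definition y1 :: "real \<Rightarrow> real^'n" where
  "y1 t = - (\<Sum>i\<in>-{b}. ((\<phi> b \<bullet> (F *v e i)) * periodic_filter \<theta> (lam i - lam b) \<gamma> t) *\<^sub>R \<phi> i)"

lemma positive_near:
  fixes c :: "real^'n"
  assumes "\<And>i. c $ i > 0"
  shows "\<exists>d>0. \<forall>x. norm (x - c) < d \<longrightarrow> (\<forall>i. x $ i > 0)"
proof -
  define d where "d = Min (range (\<lambda>i. c $ i))"
  have d: "d > 0" unfolding d_def using assms by (subst Min_gr_iff) auto
  have dl: "d \<le> c $ i" for i unfolding d_def by (rule Min_le) auto
  have "x $ i > 0" if "norm (x - c) < d" for x i
    using component_le_norm_cart[of "x - c" i] that dl[of i] by simp
  then show ?thesis using d by blast
qed

lemma solution_families: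
  "\<exists>\<epsilon>1>0. \<exists>C\<ge>0. \<exists>z y. \<forall>\<epsilon>. \<bar>\<epsilon>\<bar> \<le> \<epsilon>1 \<longrightarrow> Zsol \<epsilon> (z \<epsilon>) \<and> Ysol \<epsilon> (y \<epsilon>) \<and>
    (\<forall>t. norm (z \<epsilon> t - e b) \<le> C * \<bar>\<epsilon>\<bar> \<and> norm (y \<epsilon> t - \<phi> b) \<le> C * \<bar>\<epsilon>\<bar> \<and>
      norm (z \<epsilon> t - e b - \<epsilon> *\<^sub>R z1 t) \<le> C * \<epsilon>\<^sup>2 \<and> norm (y \<epsilon> t - \<phi> b - \<epsilon> *\<^sub>R y1 t) \<le> C * \<epsilon>\<^sup>2 \<and>
      (\<forall>\<epsilon>'. \<bar>\<epsilon>'\<bar> \<le> \<epsilon>1 \<longrightarrow> norm (z \<epsilon> t - z \<epsilon>' t) \<le> C * \<bar>\<epsilon> - \<epsilon>'\<bar>))"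
proof -
  obtain ez Cz z where ez: "ez > 0" and Cz: "Cz \<ge> 0" and Z: "\<forall>\<epsilon>. \<bar>\<epsilon>\<bar> \<le> ez \<longrightarrow> periodic_control \<theta> (z \<epsilon>) \<and>
     has_lb_derivative (z \<epsilon>)
       (\<lambda>t. (A - lam b *\<^sub>R mat 1) *v z \<epsilon> t + (\<epsilon> * \<gamma> t) *\<^sub>R (F *v z \<epsilon> t - (\<phi> b \<bullet> (F *v z \<epsilon> t)) *\<^sub>R z \<epsilon> t)) \<and>
     (\<forall>t. \<phi> b \<bullet> z \<epsilon> t = 1 \<and> norm (z \<epsilon> t - e b) \<le> Cz * \<bar>\<epsilon>\<bar> \<and>
       norm (z \<epsilon> t - e b - \<epsilon> *\<^sub>R (\<Sum>i\<in>-{b}. ((\<phi> i \<bullet> (F *v e b)) * periodic_filter \<theta> (lam b - lam i) \<gamma> t) *\<^sub>R e i))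
         \<le> Cz * \<epsilon>\<^sup>2 \<and>
       (\<forall>\<epsilon>'. \<bar>\<epsilon>'\<bar> \<le> ez \<longrightarrow> norm (z \<epsilon> t - z \<epsilon>' t) \<le> Cz * \<bar>\<epsilon> - \<epsilon>'\<bar>))"
    using primal.projective_family by blast
  obtain ey Cy y where ey: "ey > 0" and Cy: "Cy \<ge> 0" and Y: "\<forall>\<epsilon>. \<bar>\<epsilon>\<bar> \<le> ey \<longrightarrow> periodic_control \<theta> (y \<epsilon>) \<and>
     has_lb_derivative (y \<epsilon>)
       (\<lambda>t. (lam b *\<^sub>R mat 1 - transpose A) *v y \<epsilon> t
         + (\<epsilon> * \<gamma> t) *\<^sub>R (- transpose F *v y \<epsilon> t - (e b \<bullet> (- transpose F *v y \<epsilon> t)) *\<^sub>R y \<epsilon> t)) \<and>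
     (\<forall>t. e b \<bullet> y \<epsilon> t = 1 \<and> norm (y \<epsilon> t - \<phi> b) \<le> Cy * \<bar>\<epsilon>\<bar> \<and>
       norm (y \<epsilon> t - \<phi> b - \<epsilon> *\<^sub>R (\<Sum>i\<in>-{b}. ((e i \<bullet> (- transpose F *v \<phi> b)) * periodic_filter \<theta> (lam i - lam b) \<gamma> t) *\<^sub>R \<phi> i))
         \<le> Cy * \<epsilon>\<^sup>2 \<and>
       (\<forall>\<epsilon>'. \<bar>\<epsilon>'\<bar> \<le> ey \<longrightarrow> norm (y \<epsilon> t - y \<epsilon>' t) \<le> Cy * \<bar>\<epsilon> - \<epsilon>'\<bar>))"
    using adjoint.projective_family by blast
  obtain dz where dz: "dz > 0" "\<forall>x. norm (x - e b) < dz \<longrightarrow> (\<forall>i. x $ i > 0)"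
    using positive_near[OF e_pos] by blast
  obtain dy where dy: "dy > 0" "\<forall>x. norm (x - \<phi> b) < dy \<longrightarrow> (\<forall>i. x $ i > 0)"
    using positive_near[OF phi_pos] by blast
  define C where "C = Cz + Cy"
  have C: "C \<ge> 0" "Cz \<le> C" "Cy \<le> C" using Cz Cy by (simp_all add: C_def)
  \<comment> \<open>The last entry makes C |\<epsilon>| smaller than \<open>dz\<close> and
    \<open>dy\<close>, so both solutions stay in the balls around \<open>e b\<close> and
    \<open>\<phi> b\<close> where all components are positive.\<close>
  define \<epsilon>1 where "\<epsilon>1 = min (min ez ey) (min dz dy / (2 * (C + 1)))"
  have e1: "\<epsilon>1 > 0" using ez ey dz(1) dy(1) C(1) by (simp add: \<epsilon>1_def)
  have tF: "e i \<bullet> (- transpose F *v y) = - (y \<bullet> (F *v e i))" for i y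
  proof -
    have "- transpose F *v y = - (y v* F)"
      using matrix_vector_mult_diff_rdistrib[of 0 "transpose F" y] by simp
    then show ?thesis by (simp add: inner_commute[of "e i"] dot_lmul_matrix)
  qed
  have y1: "(\<Sum>i\<in>-{b}. ((e i \<bullet> (- transpose F *v \<phi> b)) * periodic_filter \<theta> (lam i - lam b) \<gamma> t) *\<^sub>R \<phi> i) = y1 t" for t
    by (simp add: tF y1_def sum_negf)
  have small: "C * \<bar>\<epsilon>\<bar> < dz" "C * \<bar>\<epsilon>\<bar> < dy" "\<bar>\<epsilon>\<bar> \<le> ez" "\<bar>\<epsilon>\<bar> \<le> ey" if "\<bar>\<epsilon>\<bar> \<le> \<epsilon>1" for \<epsilon>
  proof -
    define m where "m = min dz dy"
    have m: "m > 0" using dz dy by (simp add: m_def)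
    have "\<bar>\<epsilon>\<bar> \<le> m / (2 * (C + 1))" using that by (simp add: \<epsilon>1_def m_def)
    then have "C * \<bar>\<epsilon>\<bar> \<le> C * (m / (2 * (C + 1)))" using C(1) by (rule mult_left_mono)
    also have "\<dots> < m"
    proof -
      have "0 \<le> C * m" using m C(1) by simp
      then have "C * m < m * (2 * (C + 1))" using m by (simp add: algebra_simps)
      then show ?thesis using C(1) by (simp add: divide_less_eq)
    qed
    finally show "C * \<bar>\<epsilon>\<bar> < dz" "C * \<bar>\<epsilon>\<bar> < dy" by (simp_all add: m_def)
    show "\<bar>\<epsilon>\<bar> \<le> ez" "\<bar>\<epsilon>\<bar> \<le> ey" using that by (simp_all add: \<epsilon>1_def)
  qed
  have up: "x \<le> C * u" if "x \<le> c * u" "c \<le> C" "u \<ge> 0" for x c u :: real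
    using mult_right_mono[OF that(2,3)] that(1) by linarith
  show ?thesis
  proof (rule exI[of _ \<epsilon>1], rule conjI[OF e1], rule exI[of _ C], rule conjI[OF C(1)],
      rule exI[of _ z], rule exI[of _ y], intro allI impI)
    fix \<epsilon> assume eps: "\<bar>\<epsilon>\<bar> \<le> \<epsilon>1"
    note s = small[OF eps]
    note ZE = Z[rule_format, OF s(3)] and YE = Y[rule_format, OF s(4)]
    have nz: "norm (z \<epsilon> t - e b) \<le> C * \<bar>\<epsilon>\<bar>" for t using ZE up[OF _ C(2)] by auto
    have ny: "norm (y \<epsilon> t - \<phi> b) \<le> C * \<bar>\<epsilon>\<bar>" for t using YE up[OF _ C(3)] by auto
    have posz: "z \<epsilon> t $ i > 0" for t i using dz(2) nz[of t] s(1) by (meson le_less_trans)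
    have posy: "y \<epsilon> t $ i > 0" for t i using dy(2) ny[of t] s(2) by (meson le_less_trans)
    have "has_lb_derivative (z \<epsilon>) (\<lambda>t. A *v z \<epsilon> t - lam b *\<^sub>R z \<epsilon> t
       + (\<epsilon> * \<gamma> t) *\<^sub>R (F *v z \<epsilon> t - (\<phi> b \<bullet> (F *v z \<epsilon> t)) *\<^sub>R z \<epsilon> t))"
      by (rule has_lb_derivative_cong[OF conjunct1[OF conjunct2[OF ZE]]])
        (simp add: matrix_vector_mult_diff_rdistrib scaleR_matrix_vector_assoc[symmetric])
    then have zs: "Zsol \<epsilon> (z \<epsilon>)" unfolding Zsol_def using ZE posz by blast
    have "has_lb_derivative (y \<epsilon>) (\<lambda>t. lam b *\<^sub>R y \<epsilon> t - y \<epsilon> t v* A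
       - (\<epsilon> * \<gamma> t) *\<^sub>R (y \<epsilon> t v* F - (y \<epsilon> t \<bullet> (F *v e b)) *\<^sub>R y \<epsilon> t))"
    proof (rule has_lb_derivative_cong[OF conjunct1[OF conjunct2[OF YE]]])
      fix t
      have "- transpose F *v y \<epsilon> t = - (y \<epsilon> t v* F)"
        using matrix_vector_mult_diff_rdistrib[of 0 "transpose F" "y \<epsilon> t"] by simp
      moreover have "e b \<bullet> (y \<epsilon> t v* F) = y \<epsilon> t \<bullet> (F *v e b)"
        by (simp add: inner_commute[of "e b"] dot_lmul_matrix)
      ultimately show "(lam b *\<^sub>R mat 1 - transpose A) *v y \<epsilon> t
         + (\<epsilon> * \<gamma> t) *\<^sub>R (- transpose F *v y \<epsilon> t - (e b \<bullet> (- transpose F *v y \<epsilon> t)) *\<^sub>R y \<epsilon> t)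
        = lam b *\<^sub>R y \<epsilon> t - y \<epsilon> t v* A
       - (\<epsilon> * \<gamma> t) *\<^sub>R (y \<epsilon> t v* F - (y \<epsilon> t \<bullet> (F *v e b)) *\<^sub>R y \<epsilon> t)"
        by (simp add: matrix_vector_mult_diff_rdistrib scaleR_matrix_vector_assoc[symmetric] algebra_simps)
    qed
    then have ys: "Ysol \<epsilon> (y \<epsilon>)" unfolding Ysol_def using YE posy by (simp add: inner_commute)
    have "norm (z \<epsilon> t - e b - \<epsilon> *\<^sub>R z1 t) \<le> C * \<epsilon>\<^sup>2" for t
      unfolding z1_def using ZE up[OF _ C(2), of _ "\<epsilon>\<^sup>2"] by simp
    moreover have "norm (y \<epsilon> t - \<phi> b - \<epsilon> *\<^sub>R y1 t) \<le> C * \<epsilon>\<^sup>2" for t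
      unfolding y1[symmetric] using YE up[OF _ C(3), of _ "\<epsilon>\<^sup>2"] by simp
    moreover have "norm (z \<epsilon> t - z \<epsilon>' t) \<le> C * \<bar>\<epsilon> - \<epsilon>'\<bar>" if "\<bar>\<epsilon>'\<bar> \<le> \<epsilon>1" for t \<epsilon>'
      using ZE small(3)[OF that] up[OF _ C(2), of _ "\<bar>\<epsilon> - \<epsilon>'\<bar>"] by simp
    ultimately show "Zsol \<epsilon> (z \<epsilon>) \<and> Ysol \<epsilon> (y \<epsilon>) \<and>
    (\<forall>t. norm (z \<epsilon> t - e b) \<le> C * \<bar>\<epsilon>\<bar> \<and> norm (y \<epsilon> t - \<phi> b) \<le> C * \<bar>\<epsilon>\<bar> \<and>
      norm (z \<epsilon> t - e b - \<epsilon> *\<^sub>R z1 t) \<le> C * \<epsilon>\<^sup>2 \<and> norm (y \<epsilon> t - \<phi> b - \<epsilon> *\<^sub>R y1 t) \<le> C * \<epsilon>\<^sup>2 \<and>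
      (\<forall>\<epsilon>'. \<bar>\<epsilon>'\<bar> \<le> \<epsilon>1 \<longrightarrow> norm (z \<epsilon> t - z \<epsilon>' t) \<le> C * \<bar>\<epsilon> - \<epsilon>'\<bar>))"
      using zs ys nz ny by blast
  qed
qed

lemma positive_inner:
  fixes x y :: "real^'n"
  assumes "\<And>i. x $ i > 0" "\<And>i. y $ i > 0"
  shows "x \<bullet> y > 0"
  unfolding inner_vec_def using assms by (intro sum_pos) auto

lemma F_control: "periodic_control \<theta> x \<Longrightarrow> periodic_control \<theta> (\<lambda>t. F *v x t)"
  by (rule periodic_control_linear[OF matrix_vector_mul_bounded_linear])

lemma F_continuous: "continuous_on UNIV x \<Longrightarrow> continuous_on UNIV (\<lambda>t. F *v x t)"
  by (rule bounded_linear.continuous_on[OF matrix_vector_mul_bounded_linear])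

text \<open>The pairing of an adjoint solution with a positive periodic solution \<open>f\<close> has logarithmic
  derivative \<open>lam b + \<epsilon>' \<gamma> (y \<bullet> F e) + (\<epsilon> - \<epsilon>') \<gamma> (y \<bullet> F f) / (y \<bullet> f) - m\<close>, whose mean vanishes. This gives both
  the uniqueness of the Floquet eigenvalue and its difference quotients.\<close>

lemma pairing:
  assumes y: "Ysol \<epsilon>' y" and f: "periodic_control \<theta> f" "\<And>t i. f t $ i > 0"
    and f': "has_lb_derivative f (\<lambda>t. A *v f t + (\<epsilon> * \<gamma> t) *\<^sub>R (F *v f t) - m t *\<^sub>R f t)"
    and m: "periodic_control \<theta> m"
  shows "lam b + time_average \<theta> (\<lambda>t. \<epsilon>' * \<gamma> t * (y t \<bullet> (F *v e b)))
     + (\<epsilon> - \<epsilon>') * time_average \<theta> (\<lambda>t. \<gamma> t * (y t \<bullet> (F *v f t) / (y t \<bullet> f t))) = time_average \<theta> m"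
    and "periodic_control \<theta> (\<lambda>t. \<gamma> t * (y t \<bullet> (F *v f t) / (y t \<bullet> f t)))"
proof -
  have yc: "periodic_control \<theta> y" and y': "has_lb_derivative y (\<lambda>t. lam b *\<^sub>R y t - y t v* A
       - (\<epsilon>' * \<gamma> t) *\<^sub>R (y t v* F - (y t \<bullet> (F *v e b)) *\<^sub>R y t))"
    and ypos: "\<And>t i. y t $ i > 0" using y unfolding Ysol_def by auto
  define p where "p t = y t \<bullet> f t" for t
  have pos: "p t > 0" for t unfolding p_def using positive_inner ypos f(2) by blast
  define r where "r t = y t \<bullet> (F *v f t) / p t" for t
  have cy: "continuous_on UNIV y" and cf: "continuous_on UNIV f"
    using has_lb_derivative_continuous y' f' by blast+
  have "continuous_on UNIV r"
    unfolding r_def[abs_def] p_def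
    by (intro continuous_intros cy cf F_continuous) (use pos in \<open>auto simp: p_def less_imp_neq[symmetric]\<close>)
  then have rc: "periodic_control \<theta> r"
    by (rule continuous_periodic_control[OF theta_pos])
      (simp add: r_def p_def periodic_controlD(3)[OF yc] periodic_controlD(3)[OF f(1)])
  show gr: "periodic_control \<theta> (\<lambda>t. \<gamma> t * (y t \<bullet> (F *v f t) / (y t \<bullet> f t)))"
    using periodic_control_mult[OF gamma rc] by (simp add: r_def p_def)
  define q where "q t = lam b + \<epsilon>' * \<gamma> t * (y t \<bullet> (F *v e b)) + (\<epsilon> - \<epsilon>') * (\<gamma> t * r t) - m t" for t
  have c1: "periodic_control \<theta> (\<lambda>t. \<epsilon>' * \<gamma> t * (y t \<bullet> (F *v e b)))"
    by (intro periodic_control_mult periodic_control_const periodic_control_inner gamma yc)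
  have c2: "periodic_control \<theta> (\<lambda>t. (\<epsilon> - \<epsilon>') * (\<gamma> t * r t))"
    by (intro periodic_control_mult periodic_control_const gamma rc)
  have c3: "periodic_control \<theta> (\<lambda>t. lam b + \<epsilon>' * \<gamma> t * (y t \<bullet> (F *v e b)))"
    by (intro periodic_control_add periodic_control_const c1)
  have c4: "periodic_control \<theta> (\<lambda>t. lam b + \<epsilon>' * \<gamma> t * (y t \<bullet> (F *v e b)) + (\<epsilon> - \<epsilon>') * (\<gamma> t * r t))"
    by (intro periodic_control_add c3 c2)
  have qc: "periodic_control \<theta> q"
    unfolding q_def[abs_def] by (intro periodic_control_diff c4 m)
  have "has_lb_derivative p (\<lambda>t. q t * p t)"
    unfolding p_def[abs_def]
  proof (rule has_lb_derivative_cong[OF has_lb_derivative_prod[OF bounded_bilinear_inner y' f']])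
    fix t
    \<comment> \<open>The \<open>A\<close> terms of the two equations cancel; writing the remaining
      \<open>F\<close> term through \<open>r\<close> turns the derivative of \<open>p\<close> into a
      multiple of \<open>p\<close>.\<close>
    have "y t \<bullet> (F *v f t) = r t * (y t \<bullet> f t)" using pos[of t] by (simp add: r_def p_def)
    then show "y t \<bullet> (A *v f t + (\<epsilon> * \<gamma> t) *\<^sub>R (F *v f t) - m t *\<^sub>R f t)
      + (lam b *\<^sub>R y t - y t v* A - (\<epsilon>' * \<gamma> t) *\<^sub>R (y t v* F - (y t \<bullet> (F *v e b)) *\<^sub>R y t)) \<bullet> f t
      = q t * (y t \<bullet> f t)"
      by (simp add: q_def inner_diff_left inner_diff_right inner_add_right dot_lmul_matrix algebra_simps)
  qed
  then have "integral {0..\<theta>} q = 0"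
    by (rule periodic_log_derivative_integral[OF theta_pos _ qc pos])
      (simp add: p_def periodic_controlD(3)[OF yc] periodic_controlD(3)[OF f(1)])
  then have "time_average \<theta> q = 0" by (simp add: time_average_def)
  moreover have "time_average \<theta> q = lam b + time_average \<theta> (\<lambda>t. \<epsilon>' * \<gamma> t * (y t \<bullet> (F *v e b)))
     + (\<epsilon> - \<epsilon>') * time_average \<theta> (\<lambda>t. \<gamma> t * r t) - time_average \<theta> m"
    unfolding q_def[abs_def]
    by (simp only: time_average_diff[OF periodic_controlD(5)[OF c4] periodic_controlD(5)[OF m]]
        time_average_add[OF periodic_controlD(5)[OF c3] periodic_controlD(5)[OF c2]]
        time_average_add[OF periodic_controlD(5)[OF periodic_control_const] periodic_controlD(5)[OF c1]]
        time_average_const[OF theta_pos] time_average_cmult[of _ "\<epsilon> - \<epsilon>'"])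
  ultimately show "lam b + time_average \<theta> (\<lambda>t. \<epsilon>' * \<gamma> t * (y t \<bullet> (F *v e b)))
     + (\<epsilon> - \<epsilon>') * time_average \<theta> (\<lambda>t. \<gamma> t * (y t \<bullet> (F *v f t) / (y t \<bullet> f t))) = time_average \<theta> m"
    by (simp add: r_def p_def)
qed

lemma perturbed_mult:
  "(G + (\<alpha>s + c) *\<^sub>R F) *v x = A *v x + c *\<^sub>R (F *v x)"
  unfolding A_def
  by (simp add: matrix_vector_mult_add_rdistrib scaleR_matrix_vector_assoc[symmetric] scaleR_left_distrib)

text \<open>Pairing at equal parameters removes the quotient term, and with the constant
  \<open>m = l\<close> it leaves a formula for \<open>l\<close> that depends on \<open>y\<close>
  alone.\<close>

lemma floquet_eigenvalue_unique:
  assumes y: "Ysol \<epsilon> y" and l: "is_floquet_eigenvalue G F \<theta> (\<lambda>t. \<alpha>s + \<epsilon> * \<gamma> t) l"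
  shows "l = lam b + time_average \<theta> (\<lambda>t. \<epsilon> * \<gamma> t * (y t \<bullet> (F *v e b)))"
proof -
  obtain f f' where pos: "\<And>t i. f t $ i > 0" and per: "\<And>t. f (t + \<theta>) = f t"
    and f': "has_ae_derivative f f'"
    and eq: "AE t in lebesgue. f' t + l *\<^sub>R f t = (G + (\<alpha>s + \<epsilon> * \<gamma> t) *\<^sub>R F) *v f t"
    using l unfolding is_floquet_eigenvalue_def by blast
  have fc: "periodic_control \<theta> f"
    by (rule continuous_periodic_control[OF theta_pos has_ae_derivative_continuous[OF f'] per])
  define w where "w t = A *v f t + (\<epsilon> * \<gamma> t) *\<^sub>R (F *v f t) - l *\<^sub>R f t" for t
  have wc: "periodic_control \<theta> w"
    unfolding w_def[abs_def]
    by (intro periodic_control_diff periodic_control_add periodic_control_scaleR periodic_control_mult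
        periodic_control_const F_control gamma fc periodic_control_linear[OF matrix_vector_mul_bounded_linear])
  have "AE t in lebesgue. f' t = w t"
    using eq by (rule AE_mp) (auto simp: perturbed_mult w_def eq_diff_eq)
  then have "has_lb_derivative f w"
    by (rule has_ae_derivative_imp_lb[OF f']) (use periodic_controlD[OF wc] in auto)
  then have "has_lb_derivative f (\<lambda>t. A *v f t + (\<epsilon> * \<gamma> t) *\<^sub>R (F *v f t) - l *\<^sub>R f t)"
    by (simp add: w_def[abs_def])
  from pairing(1)[OF y fc pos this periodic_control_const] show ?thesis
    by (simp add: time_average_const[OF theta_pos])
qed

text \<open>\<open>z\<close> solves the linear equation with the time dependent rate
  \<open>lam b + h t\<close>. Multiplying by \<open>exp (U t)\<close>, where \<open>U\<close> is a
  primitive of \<open>h\<close> minus its mean, makes the rate constant; \<open>U\<close> is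
  periodic because its integrand has mean zero.\<close>

lemma Zsol_is_floquet:
  assumes z: "Zsol \<epsilon> z"
  shows "is_floquet_eigenvalue G F \<theta> (\<lambda>t. \<alpha>s + \<epsilon> * \<gamma> t)
    (lam b + time_average \<theta> (\<lambda>t. \<epsilon> * \<gamma> t * (\<phi> b \<bullet> (F *v z t))))"
proof -
  have zc: "periodic_control \<theta> z" and z': "has_lb_derivative z (\<lambda>t. A *v z t - lam b *\<^sub>R z t
       + (\<epsilon> * \<gamma> t) *\<^sub>R (F *v z t - (\<phi> b \<bullet> (F *v z t)) *\<^sub>R z t))"
    and pos: "\<And>t i. z t $ i > 0"
    using z unfolding Zsol_def by auto
  define h where "h t = \<epsilon> * \<gamma> t * (\<phi> b \<bullet> (F *v z t))" for t
  define \<mu> where "\<mu> = time_average \<theta> h"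
  have hc: "periodic_control \<theta> h"
    unfolding h_def[abs_def]
    by (intro periodic_control_mult periodic_control_const periodic_control_inner gamma F_control zc)
  define v where "v t = h t - \<mu>" for t
  have vc: "periodic_control \<theta> v" unfolding v_def[abs_def] by (intro periodic_control_diff hc periodic_control_const)
  obtain U where U: "has_lb_derivative U v"
    using has_lb_derivative_exists periodic_controlD(1,4)[OF vc] by blast
  have "integral {0..\<theta>} v = 0"
  proof -
    have "time_average \<theta> v = 0"
      unfolding v_def[abs_def] time_average_diff[OF periodic_controlD(5)[OF hc] periodic_controlD(5)[OF periodic_control_const]]
      by (simp add: \<mu>_def time_average_const[OF theta_pos])
    then show ?thesis using theta_pos by (simp add: time_average_def)
  qed
  then have U0: "U \<theta> = U 0" using has_lb_derivativeD(4)[OF U, of 0 \<theta>] theta_pos by simp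
  have Us: "has_lb_derivative (\<lambda>t. U (t + \<theta>)) v"
    by (rule has_lb_derivative_shift[OF U]) (use periodic_controlD[OF vc] in auto)
  have "U (t + \<theta>) - U t = U (0 + \<theta>) - U 0" for t
    by (rule has_lb_derivative_zero_const[OF has_lb_derivative_diff[OF Us U]]) simp
  then have Up: "U (t + \<theta>) = U t" for t using U0 by simp
  define x where "x t = exp (U t) *\<^sub>R z t" for t
  have "has_lb_derivative x (\<lambda>t. A *v x t + (\<epsilon> * \<gamma> t) *\<^sub>R (F *v x t) - (lam b + \<mu>) *\<^sub>R x t)"
    unfolding x_def[abs_def]
    by (rule has_lb_derivative_cong[OF has_lb_derivative_prod[OF bounded_bilinear_scaleR has_lb_derivative_exp[OF U] z']])
      (simp add: v_def h_def matrix_vector_mult_scaleR algebra_simps)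
  then have "has_ae_derivative x (\<lambda>t. A *v x t + (\<epsilon> * \<gamma> t) *\<^sub>R (F *v x t) - (lam b + \<mu>) *\<^sub>R x t)"
    by (rule has_lb_derivative_imp_ae)
  moreover have "x (t + \<theta>) = x t" for t using Up periodic_controlD(3)[OF zc] by (simp add: x_def)
  moreover have "x t $ i > 0" for t i using pos by (simp add: x_def)
  ultimately show ?thesis
    unfolding is_floquet_eigenvalue_def perturbed_mult h_def[symmetric] \<mu>_def[symmetric]
    by (intro exI[of _ x] exI[of _ "\<lambda>t. A *v x t + (\<epsilon> * \<gamma> t) *\<^sub>R (F *v x t) - (lam b + \<mu>) *\<^sub>R x t"]) auto
qed

text \<open>Existence comes from the primal solution and uniqueness from the adjoint one. The second
  formula is the form in which the eigenvalue appears at the parameter of the adjoint solution in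
  \<open>pairing\<close>.\<close>

lemma floquet_eigenvalue_eq:
  assumes "Zsol \<epsilon> z" "Ysol \<epsilon> y"
  shows "floquet_eigenvalue G F \<theta> (\<lambda>t. \<alpha>s + \<epsilon> * \<gamma> t) =
      lam b + time_average \<theta> (\<lambda>t. \<epsilon> * \<gamma> t * (\<phi> b \<bullet> (F *v z t)))" (is "?l = ?Z")
    and "floquet_eigenvalue G F \<theta> (\<lambda>t. \<alpha>s + \<epsilon> * \<gamma> t) =
      lam b + time_average \<theta> (\<lambda>t. \<epsilon> * \<gamma> t * (y t \<bullet> (F *v e b)))" (is "_ = ?Y")
proof -
  note Z = Zsol_is_floquet[OF assms(1)] and Y = floquet_eigenvalue_unique[OF assms(2)]
  show "?l = ?Z"
    unfolding floquet_eigenvalue_def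
  proof (rule the_equality, rule Z)
    fix l assume "is_floquet_eigenvalue G F \<theta> (\<lambda>t. \<alpha>s + \<epsilon> * \<gamma> t) l"
    then show "l = ?Z" using Y[of l] Y[OF Z] by metis
  qed
  then show "?l = ?Y" using Y[OF Z] by simp
qed

text \<open>Here \<open>z\<close> itself is the function \<open>f\<close> of \<open>pairing\<close>,
  with the nonconstant rate \<open>m = lam b + h\<close>. The mean of \<open>m\<close> is the
  eigenvalue at \<epsilon>, and the first two terms of the pairing are the eigenvalue at
  \<epsilon>'.\<close>

lemma floquet_eigenvalue_difference:
  assumes "Zsol \<epsilon> z" "Ysol \<epsilon> y" "Zsol \<epsilon>' z'" "Ysol \<epsilon>' y'"
  shows "floquet_eigenvalue G F \<theta> (\<lambda>t. \<alpha>s + \<epsilon> * \<gamma> t) - floquet_eigenvalue G F \<theta> (\<lambda>t. \<alpha>s + \<epsilon>' * \<gamma> t)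
    = (\<epsilon> - \<epsilon>') * time_average \<theta> (\<lambda>t. \<gamma> t * (y' t \<bullet> (F *v z t) / (y' t \<bullet> z t)))" (is ?A)
    and "periodic_control \<theta> (\<lambda>t. \<gamma> t * (y' t \<bullet> (F *v z t) / (y' t \<bullet> z t)))" (is ?B)
proof -
  have zc: "periodic_control \<theta> z" and z': "has_lb_derivative z (\<lambda>t. A *v z t - lam b *\<^sub>R z t
       + (\<epsilon> * \<gamma> t) *\<^sub>R (F *v z t - (\<phi> b \<bullet> (F *v z t)) *\<^sub>R z t))"
    and pos: "\<And>t i. z t $ i > 0"
    using assms(1) unfolding Zsol_def by auto
  define h where "h t = \<epsilon> * \<gamma> t * (\<phi> b \<bullet> (F *v z t))" for t
  have hc: "periodic_control \<theta> h"
    unfolding h_def[abs_def]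
    by (intro periodic_control_mult periodic_control_const periodic_control_inner gamma F_control zc)
  have mc: "periodic_control \<theta> (\<lambda>t. lam b + h t)" by (intro periodic_control_add hc periodic_control_const)
  have "has_lb_derivative z (\<lambda>t. A *v z t + (\<epsilon> * \<gamma> t) *\<^sub>R (F *v z t) - (lam b + h t) *\<^sub>R z t)"
    by (rule has_lb_derivative_cong[OF z']) (simp add: h_def algebra_simps)
  note P = pairing[OF assms(4) zc pos this mc]
  show ?B by (rule P(2))
  have "time_average \<theta> (\<lambda>t. lam b + h t) = lam b + time_average \<theta> h"
    using time_average_add[OF periodic_controlD(5)[OF periodic_control_const] periodic_controlD(5)[OF hc]]
      time_average_const[OF theta_pos] by simp
  then show ?A
    using P(1) floquet_eigenvalue_eq(1)[OF assms(1,2)] floquet_eigenvalue_eq(2)[OF assms(3,4)]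
    by (simp add: h_def[abs_def])
qed

end

section \<open>Derivatives of the Floquet eigenvalue\<close>

text \<open>Clearing the denominator gives g' = k \<gamma> - k g, so \<open>g\<close> is the filter
  of the control scaled by \<open>k\<close>.\<close>

lemma is_filtered_control_iff:
  assumes "\<theta> > 0" "k \<noteq> 0" and gamma: "periodic_control \<theta> \<gamma>"
  shows "is_filtered_control \<theta> k \<gamma> g \<longleftrightarrow> g = (\<lambda>t. k * periodic_filter \<theta> k \<gamma> t)"
proof
  assume "is_filtered_control \<theta> k \<gamma> g"
  then obtain g' where per: "\<And>t. g (t + \<theta>) = g t" and g': "has_ae_derivative g g'"
    and eq: "AE t in lebesgue. g' t / k + g t = \<gamma> t"
    unfolding is_filtered_control_def by blast
  have gc: "periodic_control \<theta> g"
    by (rule continuous_periodic_control[OF assms(1) has_ae_derivative_continuous[OF g'] per])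
  have kc: "periodic_control \<theta> (\<lambda>t. k * \<gamma> t)" by (intro periodic_control_mult periodic_control_const gamma)
  have wc: "periodic_control \<theta> (\<lambda>t. k * \<gamma> t - k * g t)"
    by (intro periodic_control_diff kc periodic_control_mult periodic_control_const gc)
  have "AE t in lebesgue. g' t = k * \<gamma> t - k * g t"
    using eq by (rule AE_mp) (use assms(2) in \<open>auto simp: field_simps\<close>)
  then have "has_lb_derivative g (\<lambda>t. k * \<gamma> t - k * g t)"
    by (rule has_ae_derivative_imp_lb[OF g']) (use periodic_controlD[OF wc] in auto)
  then have "g = periodic_filter \<theta> k (\<lambda>t. k * \<gamma> t)"
    using per by (rule periodic_filter_unique[OF assms(1,2) kc])
  then show "g = (\<lambda>t. k * periodic_filter \<theta> k \<gamma> t)"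
    by (simp add: fun_eq_iff periodic_filter_cmult)
next
  note F = periodic_filter_derivative[OF assms]
  assume g: "g = (\<lambda>t. k * periodic_filter \<theta> k \<gamma> t)"
  have "has_lb_derivative g (\<lambda>t. k * (\<gamma> t - k * periodic_filter \<theta> k \<gamma> t))"
    unfolding g by (rule has_lb_derivative_linear[OF bounded_linear_mult_right F(1)])
  then have "has_ae_derivative g (\<lambda>t. k * (\<gamma> t - k * periodic_filter \<theta> k \<gamma> t))"
    by (rule has_lb_derivative_imp_ae)
  then show "is_filtered_control \<theta> k \<gamma> g"
    unfolding is_filtered_control_def
    using F(2) assms(2) by (intro conjI exI[of _ "\<lambda>t. k * (\<gamma> t - k * periodic_filter \<theta> k \<gamma> t)"]) (auto simp: g)
qed

lemma filtered_control_eq: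
  assumes "\<theta> > 0" "k \<noteq> 0" "periodic_control \<theta> \<gamma>"
  shows "filtered_control \<theta> k \<gamma> = (\<lambda>t. k * periodic_filter \<theta> k \<gamma> t)"
  unfolding filtered_control_def is_filtered_control_iff[OF assms] by simp

lemma periodic_filter_control:
  assumes "\<theta> > 0" "k \<noteq> 0" "periodic_control \<theta> \<gamma>"
  shows "periodic_control \<theta> (periodic_filter \<theta> k \<gamma>)"
  using periodic_filter_derivative[OF assms] has_lb_derivative_continuous
  by (intro continuous_periodic_control[OF assms(1)]) auto

text \<open>Derivatives of periodic functions have mean zero. For the filter Y with rate k, applying
  this to Y^2 gives <\<gamma> Y> = k <Y^2>, while the filtered control is k Y. For the filter Z with
  rate -k, the rates cancel in (Y Z)' = \<gamma> Y + \<gamma> Z.\<close>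

lemma time_average_filter:
  assumes "\<theta> > 0" "k \<noteq> 0" "periodic_control \<theta> \<gamma>"
  shows "time_average \<theta> (\<lambda>t. \<gamma> t * periodic_filter \<theta> k \<gamma> t)
    = time_average \<theta> (\<lambda>t. (filtered_control \<theta> k \<gamma> t)\<^sup>2) / k"
    and "time_average \<theta> (\<lambda>t. \<gamma> t * periodic_filter \<theta> (- k) \<gamma> t)
    = - time_average \<theta> (\<lambda>t. \<gamma> t * periodic_filter \<theta> k \<gamma> t)"
proof -
  define Y where "Y = periodic_filter \<theta> k \<gamma>"
  define Z where "Z = periodic_filter \<theta> (- k) \<gamma>"
  have nk: "- k \<noteq> 0" using assms(2) by simp
  note Y = periodic_filter_derivative[OF assms, folded Y_def]
  note Z = periodic_filter_derivative[OF assms(1) nk assms(3), folded Z_def]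
  have Yc: "periodic_control \<theta> Y" and Zc: "periodic_control \<theta> Z"
    unfolding Y_def Z_def using periodic_filter_control[OF assms] periodic_filter_control[OF assms(1) nk assms(3)] by auto
  have gY: "periodic_control \<theta> (\<lambda>t. \<gamma> t * Y t)" and gZ: "periodic_control \<theta> (\<lambda>t. \<gamma> t * Z t)"
    and YY: "periodic_control \<theta> (\<lambda>t. k * (Y t * Y t))"
    by (intro periodic_control_mult periodic_control_const assms(3) Yc Zc)+
  have "has_lb_derivative (\<lambda>t. Y t * Y t) (\<lambda>t. 2 * (\<gamma> t * Y t - k * (Y t * Y t)))"
    by (rule has_lb_derivative_cong[OF has_lb_derivative_prod[OF bounded_bilinear_mult Y(1) Y(1)]])
      (simp add: algebra_simps)
  then have "time_average \<theta> (\<lambda>t. 2 * (\<gamma> t * Y t - k * (Y t * Y t))) = 0"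
    by (rule time_average_derivative[OF assms(1)]) (simp add: Y(2))
  then have "time_average \<theta> (\<lambda>t. \<gamma> t * Y t) = k * time_average \<theta> (\<lambda>t. Y t * Y t)"
    unfolding time_average_cmult time_average_diff[OF periodic_controlD(5)[OF gY] periodic_controlD(5)[OF YY]]
    by simp
  moreover have "time_average \<theta> (\<lambda>t. (filtered_control \<theta> k \<gamma> t)\<^sup>2) = k\<^sup>2 * time_average \<theta> (\<lambda>t. Y t * Y t)"
    unfolding filtered_control_eq[OF assms] Y_def[symmetric]
    by (simp add: power_mult_distrib time_average_cmult power2_eq_square[of "Y _"])
  ultimately show "time_average \<theta> (\<lambda>t. \<gamma> t * periodic_filter \<theta> k \<gamma> t)
    = time_average \<theta> (\<lambda>t. (filtered_control \<theta> k \<gamma> t)\<^sup>2) / k"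
    using assms(2) by (simp add: Y_def[symmetric] power2_eq_square)
  have "has_lb_derivative (\<lambda>t. Y t * Z t) (\<lambda>t. \<gamma> t * Y t + \<gamma> t * Z t)"
    by (rule has_lb_derivative_cong[OF has_lb_derivative_prod[OF bounded_bilinear_mult Y(1) Z(1)]])
      (simp add: algebra_simps)
  then have "time_average \<theta> (\<lambda>t. \<gamma> t * Y t + \<gamma> t * Z t) = 0"
    by (rule time_average_derivative[OF assms(1)]) (simp add: Y(2) Z(2))
  then show "time_average \<theta> (\<lambda>t. \<gamma> t * periodic_filter \<theta> (- k) \<gamma> t)
    = - time_average \<theta> (\<lambda>t. \<gamma> t * periodic_filter \<theta> k \<gamma> t)"
    unfolding time_average_add[OF periodic_controlD(5)[OF gY] periodic_controlD(5)[OF gZ]]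
    by (simp add: Y_def Z_def)
qed

section \<open>Difference quotients of functions of one real parameter\<close>

lemma has_real_derivative_quadratic_error:
  fixes f :: "real \<Rightarrow> real"
  assumes "\<delta> > 0" "\<And>x. \<bar>x - a\<bar> \<le> \<delta> \<Longrightarrow> \<bar>f x - f a - D * (x - a)\<bar> \<le> K * (x - a)\<^sup>2"
  shows "(f has_real_derivative D) (at a)"
proof -
  have "((\<lambda>x. (f x - f a) / (x - a) - D) \<longlongrightarrow> 0) (at a)"
  proof (rule tendsto_sandwich[of "\<lambda>x. - (K * \<bar>x - a\<bar>)" _ _ "\<lambda>x. K * \<bar>x - a\<bar>"])
    have ev: "\<forall>\<^sub>F x in at a. \<bar>(f x - f a) / (x - a) - D\<bar> \<le> K * \<bar>x - a\<bar>"
      unfolding eventually_at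
    proof (intro exI[of _ \<delta>] conjI ballI impI assms(1))
      fix x assume x: "x \<noteq> a \<and> dist x a < \<delta>"
      then have "\<bar>f x - f a - D * (x - a)\<bar> \<le> K * \<bar>x - a\<bar> * \<bar>x - a\<bar>"
        using assms(2)[of x] by (simp add: dist_real_def power2_eq_square abs_mult_self_eq mult.assoc)
      moreover have "(f x - f a) / (x - a) - D = (f x - f a - D * (x - a)) / (x - a)"
        using x by (simp add: field_simps)
      ultimately show "\<bar>(f x - f a) / (x - a) - D\<bar> \<le> K * \<bar>x - a\<bar>"
        using x by (simp add: divide_le_eq)
    qed
    show "\<forall>\<^sub>F x in at a. - (K * \<bar>x - a\<bar>) \<le> (f x - f a) / (x - a) - D"
      using ev by eventually_elim linarith
    show "\<forall>\<^sub>F x in at a. (f x - f a) / (x - a) - D \<le> K * \<bar>x - a\<bar>"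
      using ev by eventually_elim linarith
    have "((\<lambda>x. K * \<bar>x - a\<bar>) \<longlongrightarrow> K * \<bar>a - a\<bar>) (at a)" by (intro tendsto_intros)
    then show "((\<lambda>x. K * \<bar>x - a\<bar>) \<longlongrightarrow> 0) (at a)" by simp
    then show "((\<lambda>x. - (K * \<bar>x - a\<bar>)) \<longlongrightarrow> 0) (at a)" using tendsto_minus by fastforce
  qed
  then show ?thesis
    unfolding has_field_derivative_iff by (rule LIM_zero_cancel)
qed

text \<open>The Lipschitz bound in the first argument identifies the derivative at every interior
  \<open>y\<close> as \<open>R y y\<close>, without differentiating \<open>R\<close>. The expansion
  of the diagonal at 0 then gives the second derivative there.\<close>

lemma derivatives_of_quotient_family:
  fixes \<Lambda> :: "real \<Rightarrow> real"
  assumes d: "\<delta> > 0"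
    and diff: "\<And>x y. \<bar>x\<bar> \<le> \<delta> \<Longrightarrow> \<bar>y\<bar> \<le> \<delta> \<Longrightarrow> \<Lambda> x - \<Lambda> y = (x - y) * R x y"
    and lip: "\<And>x y. \<bar>x\<bar> \<le> \<delta> \<Longrightarrow> \<bar>y\<bar> \<le> \<delta> \<Longrightarrow> \<bar>R x y - R y y\<bar> \<le> K * \<bar>x - y\<bar>"
    and quad: "\<And>x. \<bar>x\<bar> \<le> \<delta> \<Longrightarrow> \<bar>R x x - (c + x * s)\<bar> \<le> K * x\<^sup>2"
  shows "(\<Lambda> has_real_derivative c) (at 0)" "\<forall>\<^sub>F x in nhds 0. \<Lambda> field_differentiable (at x)"
    and "(deriv \<Lambda> has_real_derivative s) (at 0)"
proof -
  have der: "(\<Lambda> has_real_derivative R y y) (at y)" if y: "\<bar>y\<bar> < \<delta>" for y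
  \<comment> \<open>This radius keeps \<open>x\<close> within the range where the hypotheses on
    \<open>R\<close> apply.\<close>
  proof (rule has_real_derivative_quadratic_error[of "\<delta> - \<bar>y\<bar>" _ _ _ K])
    show "\<delta> - \<bar>y\<bar> > 0" using y by simp
    fix x assume "\<bar>x - y\<bar> \<le> \<delta> - \<bar>y\<bar>"
    then have x: "\<bar>x\<bar> \<le> \<delta>" by linarith
    have "\<Lambda> x - \<Lambda> y - R y y * (x - y) = (x - y) * (R x y - R y y)"
      using diff[OF x less_imp_le[OF y]] by (simp add: algebra_simps)
    then have "\<bar>\<Lambda> x - \<Lambda> y - R y y * (x - y)\<bar> \<le> \<bar>x - y\<bar> * (K * \<bar>x - y\<bar>)"
      using lip[OF x less_imp_le[OF y]] by (simp add: abs_mult mult_left_mono)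
    then show "\<bar>\<Lambda> x - \<Lambda> y - R y y * (x - y)\<bar> \<le> K * (x - y)\<^sup>2"
      by (simp add: power2_eq_square abs_mult_self_eq mult.left_commute)
  qed
  have R0: "R 0 0 = c" using quad[of 0] d by simp
  show "(\<Lambda> has_real_derivative c) (at 0)" using der[of 0] d R0 by simp
  have ev: "\<forall>\<^sub>F x in nhds 0. \<bar>x\<bar> < \<delta>"
    unfolding eventually_nhds_metric using d by (intro exI[of _ \<delta>]) (auto simp: dist_real_def)
  show "\<forall>\<^sub>F x in nhds 0. \<Lambda> field_differentiable (at x)"
    using ev by eventually_elim (use der field_differentiable_def in blast)
  have dv: "deriv \<Lambda> x = R x x" if "\<bar>x\<bar> < \<delta>" for x
    using der[OF that] by (rule DERIV_imp_deriv)
  show "(deriv \<Lambda> has_real_derivative s) (at 0)"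
  \<comment> \<open>Half the radius, because \<open>deriv\<close> is identified only where |x| <
    \<delta> strictly.\<close>
  proof (rule has_real_derivative_quadratic_error[of "\<delta>/2" _ _ _ K])
    show "\<delta>/2 > 0" using d by simp
    fix x assume "\<bar>x - 0\<bar> \<le> \<delta>/2"
    then show "\<bar>deriv \<Lambda> x - deriv \<Lambda> 0 - s * (x - 0)\<bar> \<le> K * (x - 0)\<^sup>2"
      using quad[of x] dv[of x] dv[of 0] d R0 by (simp add: algebra_simps)
  qed
qed

text \<open>Numerator and denominator are changed one at a time. One reciprocal, at most 2,
  multiplies the change of the numerator; two reciprocals multiply the change of the denominator,
  whence the factor 4.\<close>

lemma quotient_lipschitz:
  fixes a a' d d' :: real
  assumes "d \<ge> 1/2" "d' \<ge> 1/2" "\<bar>a'\<bar> \<le> M" "\<bar>a - a'\<bar> \<le> A * \<delta>" "\<bar>d - d'\<bar> \<le> D * \<delta>"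
  shows "\<bar>a / d - a' / d'\<bar> \<le> (2 * A + 4 * M * D) * \<delta>"
proof -
  have inv: "0 < inverse d" "inverse d \<le> 2" "0 < inverse d'" "inverse d' \<le> 2"
    using assms(1,2) le_imp_inverse_le[of "1/2" d] le_imp_inverse_le[of "1/2" d'] by simp_all
  have M: "M \<ge> 0" using assms(3) by linarith
  have D: "D * \<delta> \<ge> 0" and A: "A * \<delta> \<ge> 0" using assms(4,5) by linarith+
  have "a / d - a' / d' = (a - a') * inverse d + a' * (d' - d) * (inverse d * inverse d')"
    using assms(1,2) by (simp add: field_simps)
  then have "\<bar>a / d - a' / d'\<bar> \<le> \<bar>a - a'\<bar> * inverse d + \<bar>a'\<bar> * \<bar>d - d'\<bar> * (inverse d * inverse d')"
    using abs_triangle_ineq[of "(a - a') * inverse d" "a' * (d' - d) * (inverse d * inverse d')"] inv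
    by (simp add: abs_mult abs_minus_commute)
  also have "\<dots> \<le> (A * \<delta>) * 2 + M * (D * \<delta>) * (2 * 2)"
    using inv assms M D A by (intro add_mono mult_mono) auto
  finally show ?thesis by (simp add: algebra_simps)
qed

context floquet_frame
begin

lemma first_order_control: "periodic_control \<theta> z1" "periodic_control \<theta> y1"
proof -
  have "periodic_control \<theta> (\<lambda>t. \<Sum>i\<in>I. (c i * periodic_filter \<theta> (k i) \<gamma> t) *\<^sub>R (v i :: real^'n))"
    if "\<forall>i\<in>I. k i \<noteq> 0" for I :: "'n set" and c k v
    using finite[of I] that
  proof (induction I rule: finite_induct)
    case empty
    then show ?case by (simp add: periodic_control_const)
  next
    case (insert j J)
    then show ?case
      by (auto intro!: periodic_control_add periodic_control_scaleR periodic_control_mult periodic_control_const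
          periodic_filter_control theta_pos gamma)
  qed
  note S = this
  have nz: "\<forall>i\<in>-{b}. lam b - lam i \<noteq> 0" "\<forall>i\<in>-{b}. lam i - lam b \<noteq> 0"
  proof safe
    fix i assume "i \<noteq> b"
    then have "lam i \<noteq> lam b" by (rule lam_neq)
    then show "lam b - lam i = 0 \<Longrightarrow> False" "lam i - lam b = 0 \<Longrightarrow> False" by auto
  qed
  show "periodic_control \<theta> z1" unfolding z1_def[abs_def] by (rule S[OF nz(1)])
  have "periodic_control \<theta> (\<lambda>t. \<Sum>i\<in>-{b}. ((\<phi> b \<bullet> (F *v e i)) * periodic_filter \<theta> (lam i - lam b) \<gamma> t) *\<^sub>R \<phi> i)"
    by (rule S[OF nz(2)])
  then show "periodic_control \<theta> y1"
    unfolding y1_def[abs_def] by (rule periodic_control_linear[OF bounded_linear_minus[OF bounded_linear_ident]])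
qed

lemma floquet_derivatives:
  defines "\<Lambda> \<equiv> \<lambda>\<epsilon>. floquet_eigenvalue G F \<theta> (\<lambda>t. \<alpha>s + \<epsilon> * \<gamma> t)"
  shows "(\<Lambda> has_real_derivative (\<phi> b \<bullet> (F *v e b)) * time_average \<theta> \<gamma>) (at 0)"
    and "\<forall>\<^sub>F \<epsilon> in nhds 0. \<Lambda> field_differentiable (at \<epsilon>)"
    and "(deriv \<Lambda> has_real_derivative time_average \<theta> (\<lambda>t. \<gamma> t * (y1 t \<bullet> (F *v e b) + \<phi> b \<bullet> (F *v z1 t)))) (at 0)"
proof -
  obtain \<epsilon>1 C z y where e1: "\<epsilon>1 > 0" and C: "C \<ge> 0" and H: "\<And>\<epsilon>. \<bar>\<epsilon>\<bar> \<le> \<epsilon>1 \<Longrightarrow> Zsol \<epsilon> (z \<epsilon>) \<and> Ysol \<epsilon> (y \<epsilon>) \<and>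
    (\<forall>t. norm (z \<epsilon> t - e b) \<le> C * \<bar>\<epsilon>\<bar> \<and> norm (y \<epsilon> t - \<phi> b) \<le> C * \<bar>\<epsilon>\<bar> \<and>
      norm (z \<epsilon> t - e b - \<epsilon> *\<^sub>R z1 t) \<le> C * \<epsilon>\<^sup>2 \<and> norm (y \<epsilon> t - \<phi> b - \<epsilon> *\<^sub>R y1 t) \<le> C * \<epsilon>\<^sup>2 \<and>
      (\<forall>\<epsilon>'. \<bar>\<epsilon>'\<bar> \<le> \<epsilon>1 \<longrightarrow> norm (z \<epsilon> t - z \<epsilon>' t) \<le> C * \<bar>\<epsilon> - \<epsilon>'\<bar>))"
    using solution_families by metis
  \<comment> \<open>Makes C |\<epsilon>| <= 1/2 for both parameters, so the pairings
    \<open>y \<epsilon>' t \<bullet> z \<epsilon> t\<close> differ from 1 by at most 1/4.\<close>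
  define \<delta> where "\<delta> = min \<epsilon>1 (1 / (2 * (C + 1)))"
  have d: "\<delta> > 0" "\<delta> \<le> \<epsilon>1" using e1 C by (simp_all add: \<delta>_def)
  have Cd: "C * \<bar>\<epsilon>\<bar> \<le> 1/2" if "\<bar>\<epsilon>\<bar> \<le> \<delta>" for \<epsilon>
  proof -
    have "C * \<bar>\<epsilon>\<bar> \<le> C * (1 / (2 * (C + 1)))" using that C by (intro mult_left_mono) (auto simp: \<delta>_def)
    also have "\<dots> \<le> 1/2" using C by (simp add: field_simps)
    finally show ?thesis .
  qed
  obtain f where f: "f > 0" "\<And>x. norm (F *v x) \<le> norm x * f"
    using bounded_linear.pos_bounded[OF matrix_vector_mul_bounded_linear[of F]] by blast
  have bF: "\<bar>u \<bullet> (F *v v)\<bar> \<le> p * f * q" if "norm u \<le> p" "norm v \<le> q" for u v p q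
  proof -
    have p0: "p \<ge> 0" using that(1) norm_ge_zero order_trans by blast
    have "\<bar>u \<bullet> (F *v v)\<bar> \<le> norm u * norm (F *v v)" by (rule Cauchy_Schwarz_ineq2)
    also have "\<dots> \<le> p * (q * f)"
    proof (intro mult_mono that(1) p0)
      show "norm (F *v v) \<le> q * f" using f(2)[of v] mult_right_mono[OF that(2), of f] f(1) by linarith
    qed simp
    finally show ?thesis by (simp add: mult_ac)
  qed
  have bI: "\<bar>u \<bullet> v\<bar> \<le> p * q" if "norm u \<le> p" "norm v \<le> q" for u v :: "real^'n" and p q
    using Cauchy_Schwarz_ineq2[of u v] mult_mono[OF that] norm_ge_zero[of u] norm_ge_zero[of v] that
    by (meson order_trans)
  define P where "P = norm (\<phi> b) + 1"
  define E where "E = norm (e b) + 1"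
  have PE: "P \<ge> 0" "E \<ge> 0" by (simp_all add: P_def E_def)
  have Hz: "Zsol \<epsilon> (z \<epsilon>)" "norm (z \<epsilon> t - e b) \<le> C * \<bar>\<epsilon>\<bar>" "norm (z \<epsilon> t - e b - \<epsilon> *\<^sub>R z1 t) \<le> C * \<epsilon>\<^sup>2"
    "\<bar>\<epsilon>'\<bar> \<le> \<delta> \<Longrightarrow> norm (z \<epsilon> t - z \<epsilon>' t) \<le> C * \<bar>\<epsilon> - \<epsilon>'\<bar>" and
    Hy: "Ysol \<epsilon> (y \<epsilon>)" "norm (y \<epsilon> t - \<phi> b) \<le> C * \<bar>\<epsilon>\<bar>" "norm (y \<epsilon> t - \<phi> b - \<epsilon> *\<^sub>R y1 t) \<le> C * \<epsilon>\<^sup>2"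
    if "\<bar>\<epsilon>\<bar> \<le> \<delta>" for \<epsilon> \<epsilon>' t
    using H[of \<epsilon>] that d(2) by auto
  have zE: "norm (z \<epsilon> t) \<le> E" and yP: "norm (y \<epsilon> t) \<le> P" if "\<bar>\<epsilon>\<bar> \<le> \<delta>" for \<epsilon> t
    using norm_triangle_ineq[of "z \<epsilon> t - e b" "e b"] Hz(2)[OF that, of t] Cd[OF that]
      norm_triangle_ineq[of "y \<epsilon> t - \<phi> b" "\<phi> b"] Hy(2)[OF that, of t]
    by (simp_all add: E_def P_def)
  text \<open>Since \<open>\<phi> b \<bullet> z = 1 = y \<bullet> e b\<close>, the denominator differs from \<open>1\<close> only in second order.\<close>
  have den: "y \<epsilon>' t \<bullet> z \<epsilon> t - 1 = (y \<epsilon>' t - \<phi> b) \<bullet> (z \<epsilon> t - e b)" if "\<bar>\<epsilon>\<bar> \<le> \<delta>" "\<bar>\<epsilon>'\<bar> \<le> \<delta>" for \<epsilon> \<epsilon>' t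
    using Hz(1)[OF that(1)] Hy(1)[OF that(2)] dual[of b b]
    by (simp add: Zsol_def Ysol_def inner_diff_left inner_diff_right)
  have denb: "\<bar>y \<epsilon>' t \<bullet> z \<epsilon> t - 1\<bar> \<le> (C * \<bar>\<epsilon>'\<bar>) * (C * \<bar>\<epsilon>\<bar>)" if "\<bar>\<epsilon>\<bar> \<le> \<delta>" "\<bar>\<epsilon>'\<bar> \<le> \<delta>" for \<epsilon> \<epsilon>' t
    unfolding den[OF that] using bI[OF Hy(2)[OF that(2)] Hz(2)[OF that(1)]] .
  have denh: "y \<epsilon>' t \<bullet> z \<epsilon> t \<ge> 1/2" if "\<bar>\<epsilon>\<bar> \<le> \<delta>" "\<bar>\<epsilon>'\<bar> \<le> \<delta>" for \<epsilon> \<epsilon>' t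
  proof -
    have "(C * \<bar>\<epsilon>'\<bar>) * (C * \<bar>\<epsilon>\<bar>) \<le> 1/2 * (1/2)"
      using Cd[OF that(1)] Cd[OF that(2)] C by (intro mult_mono) auto
    then show ?thesis using denb[OF that, of t] by linarith
  qed
  define r where "r \<epsilon> \<epsilon>' t = y \<epsilon>' t \<bullet> (F *v z \<epsilon> t) / (y \<epsilon>' t \<bullet> z \<epsilon> t)" for \<epsilon> \<epsilon>' t
  define R where "R \<epsilon> \<epsilon>' = time_average \<theta> (\<lambda>t. \<gamma> t * r \<epsilon> \<epsilon>' t)" for \<epsilon> \<epsilon>'
  have rc: "periodic_control \<theta> (\<lambda>t. \<gamma> t * r \<epsilon> \<epsilon>' t)" if "\<bar>\<epsilon>\<bar> \<le> \<delta>" "\<bar>\<epsilon>'\<bar> \<le> \<delta>" for \<epsilon> \<epsilon>'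
    using floquet_eigenvalue_difference(2)[OF Hz(1)[OF that(1)] Hy(1)[OF that(1)] Hz(1)[OF that(2)] Hy(1)[OF that(2)]]
    by (simp add: r_def)
  have diff: "\<Lambda> \<epsilon> - \<Lambda> \<epsilon>' = (\<epsilon> - \<epsilon>') * R \<epsilon> \<epsilon>'" if "\<bar>\<epsilon>\<bar> \<le> \<delta>" "\<bar>\<epsilon>'\<bar> \<le> \<delta>" for \<epsilon> \<epsilon>'
    using floquet_eigenvalue_difference(1)[OF Hz(1)[OF that(1)] Hy(1)[OF that(1)] Hz(1)[OF that(2)] Hy(1)[OF that(2)]]
    by (simp add: r_def R_def \<Lambda>_def)
  obtain g where g: "\<And>t. \<bar>\<gamma> t\<bar> \<le> g"
    using periodic_controlD(2)[OF gamma] unfolding bounded_iff by auto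
  have g0: "g \<ge> 0" using g[of 0] by linarith
  have avg: "\<bar>time_average \<theta> (\<lambda>t. \<gamma> t * u t) - time_average \<theta> (\<lambda>t. \<gamma> t * v t)\<bar> \<le> g * B"
    if c: "periodic_control \<theta> (\<lambda>t. \<gamma> t * u t)" "periodic_control \<theta> (\<lambda>t. \<gamma> t * v t)"
      and uv: "\<And>t. \<bar>u t - v t\<bar> \<le> B" for u v B
  proof -
    have "\<bar>time_average \<theta> (\<lambda>t. \<gamma> t * u t - \<gamma> t * v t)\<bar> \<le> g * B"
    proof (rule time_average_bound[OF theta_pos periodic_control_diff[OF c]])
      fix t show "\<bar>\<gamma> t * u t - \<gamma> t * v t\<bar> \<le> g * B"
        using mult_mono[OF g[of t] uv[of t] g0] by (simp add: abs_mult right_diff_distrib[symmetric])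
    qed
    then show ?thesis
      using time_average_diff[OF periodic_controlD(5)[OF c(1)] periodic_controlD(5)[OF c(2)]] by simp
  qed
  \<comment> \<open>The constant of \<open>quotient_lipschitz\<close>, with numerators bounded by
    \<open>P * f * E\<close> and with Lipschitz constants \<open>P * f * C\<close> for the numerator
    and \<open>P * C\<close> for the denominator.\<close>
  define K1 where "K1 = 2 * (P * f * C) + 4 * (P * f * E) * (P * C)"
  have lip: "\<bar>R \<epsilon> \<epsilon>' - R \<epsilon>' \<epsilon>'\<bar> \<le> g * (K1 * \<bar>\<epsilon> - \<epsilon>'\<bar>)" if e: "\<bar>\<epsilon>\<bar> \<le> \<delta>" "\<bar>\<epsilon>'\<bar> \<le> \<delta>" for \<epsilon> \<epsilon>'
    unfolding R_def
  proof (rule avg[OF rc[OF e] rc[OF e(2) e(2)]])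
    fix t
    show "\<bar>r \<epsilon> \<epsilon>' t - r \<epsilon>' \<epsilon>' t\<bar> \<le> K1 * \<bar>\<epsilon> - \<epsilon>'\<bar>"
      unfolding r_def K1_def
    proof (rule quotient_lipschitz[OF denh[OF e] denh[OF e(2) e(2)]])
      show "\<bar>y \<epsilon>' t \<bullet> (F *v z \<epsilon>' t)\<bar> \<le> P * f * E" by (rule bF[OF yP[OF e(2)] zE[OF e(2)]])
      show "\<bar>y \<epsilon>' t \<bullet> (F *v z \<epsilon> t) - y \<epsilon>' t \<bullet> (F *v z \<epsilon>' t)\<bar> \<le> P * f * C * \<bar>\<epsilon> - \<epsilon>'\<bar>"
        using bF[OF yP[OF e(2)] Hz(4)[OF e], of t t]
        by (simp add: matrix_vector_mult_diff_distrib inner_diff_right mult.assoc)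
      show "\<bar>y \<epsilon>' t \<bullet> z \<epsilon> t - y \<epsilon>' t \<bullet> z \<epsilon>' t\<bar> \<le> P * C * \<bar>\<epsilon> - \<epsilon>'\<bar>"
        using bI[OF yP[OF e(2)] Hz(4)[OF e], of t t] by (simp add: inner_diff_right mult.assoc)
    qed
  qed
  define s where "s t = y1 t \<bullet> (F *v e b) + \<phi> b \<bullet> (F *v z1 t)" for t
  define c0 where "c0 = \<phi> b \<bullet> (F *v e b)"
  \<comment> \<open>The first summand pays for replacing the denominator by 1, the other three for
    the remainders in the expansion of the numerator.\<close>
  define K2 where "K2 = 2 * (P * f * E) * (C * C) + C * f * E + P * f * C + C * f * C"
  have sc: "periodic_control \<theta> (\<lambda>t. \<gamma> t * s t)"
    unfolding s_def
    by (intro periodic_control_mult gamma periodic_control_add periodic_control_inner periodic_control_const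
        first_order_control F_control)
  have lc: "periodic_control \<theta> (\<lambda>t. \<gamma> t * (c0 + \<epsilon> * s t))" for \<epsilon>
  proof -
    have "periodic_control \<theta> (\<lambda>t. c0 * \<gamma> t + \<epsilon> * (\<gamma> t * s t))"
      by (intro periodic_control_add periodic_control_mult[OF periodic_control_const] gamma sc)
    then show ?thesis by (simp add: algebra_simps)
  qed
  have quad: "\<bar>R \<epsilon> \<epsilon> - (c0 * time_average \<theta> \<gamma> + \<epsilon> * time_average \<theta> (\<lambda>t. \<gamma> t * s t))\<bar> \<le> g * (K2 * \<epsilon>\<^sup>2)"
    if e: "\<bar>\<epsilon>\<bar> \<le> \<delta>" for \<epsilon>
  proof -
    have "time_average \<theta> (\<lambda>t. c0 * \<gamma> t + \<epsilon> * (\<gamma> t * s t)) = c0 * time_average \<theta> \<gamma> + \<epsilon> * time_average \<theta> (\<lambda>t. \<gamma> t * s t)"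
      by (simp only: time_average_add[OF periodic_controlD(5)[OF periodic_control_mult[OF periodic_control_const gamma]]
          periodic_controlD(5)[OF periodic_control_mult[OF periodic_control_const sc]]] time_average_cmult)
    moreover have "(\<lambda>t. c0 * \<gamma> t + \<epsilon> * (\<gamma> t * s t)) = (\<lambda>t. \<gamma> t * (c0 + \<epsilon> * s t))"
      by (simp add: algebra_simps)
    moreover have "\<bar>R \<epsilon> \<epsilon> - time_average \<theta> (\<lambda>t. \<gamma> t * (c0 + \<epsilon> * s t))\<bar> \<le> g * (K2 * \<epsilon>\<^sup>2)"
      unfolding R_def
    proof (rule avg[OF rc[OF e e] lc])
      fix t
      define u where "u = z \<epsilon> t - e b"
      define v where "v = y \<epsilon> t - \<phi> b"
      define a where "a = y \<epsilon> t \<bullet> (F *v z \<epsilon> t)"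
      define d where "d = y \<epsilon> t \<bullet> z \<epsilon> t"
      have aE: "\<bar>a\<bar> \<le> P * f * E" unfolding a_def by (rule bF[OF yP[OF e] zE[OF e]])
      have dh: "d \<ge> 1/2" unfolding d_def by (rule denh[OF e e])
      have d1: "\<bar>1 - d\<bar> \<le> C * C * \<epsilon>\<^sup>2"
        using denb[OF e e, of t] by (simp add: d_def abs_minus_commute power2_eq_square mult_ac abs_mult_self_eq)
      have "\<bar>a / d - a\<bar> = \<bar>a\<bar> * \<bar>1 - d\<bar> * inverse d"
      proof -
        have "a / d - a = a * (1 - d) * inverse d" using dh by (simp add: field_simps)
        then show ?thesis using dh by (simp add: abs_mult)
      qed
      also have "\<dots> \<le> (P * f * E) * (C * C * \<epsilon>\<^sup>2) * 2"
        using aE d1 dh le_imp_inverse_le[of "1/2" d] f(1) PE C by (intro mult_mono) auto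
      finally have 1: "\<bar>a / d - a\<bar> \<le> 2 * (P * f * E) * (C * C) * \<epsilon>\<^sup>2" by (simp add: mult_ac)
      \<comment> \<open>Bilinear expansion around the pair \<open>\<phi> b\<close>,
        \<open>e b\<close>: the two linear parts minus their first order terms, plus the product of
        the two deviations.\<close>
      have "a - (c0 + \<epsilon> * s t) = (v - \<epsilon> *\<^sub>R y1 t) \<bullet> (F *v e b) + \<phi> b \<bullet> (F *v (u - \<epsilon> *\<^sub>R z1 t)) + v \<bullet> (F *v u)"
        unfolding a_def c0_def s_def u_def v_def
        by (simp add: matrix_vector_mult_diff_distrib matrix_vector_mult_scaleR inner_diff_left inner_diff_right algebra_simps)
      moreover have "\<bar>(v - \<epsilon> *\<^sub>R y1 t) \<bullet> (F *v e b)\<bar> \<le> (C * \<epsilon>\<^sup>2) * f * E"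
        unfolding v_def by (rule bF[OF Hy(3)[OF e]]) (simp add: E_def)
      moreover have "\<bar>\<phi> b \<bullet> (F *v (u - \<epsilon> *\<^sub>R z1 t))\<bar> \<le> P * f * (C * \<epsilon>\<^sup>2)"
        unfolding u_def by (rule bF[OF _ Hz(3)[OF e]]) (simp add: P_def)
      moreover have "\<bar>v \<bullet> (F *v u)\<bar> \<le> C * f * C * \<epsilon>\<^sup>2"
        using bF[OF Hy(2)[OF e] Hz(2)[OF e], of t t]
        by (simp add: u_def v_def power2_eq_square mult_ac abs_mult_self_eq)
      ultimately have 2: "\<bar>a - (c0 + \<epsilon> * s t)\<bar> \<le> (C * \<epsilon>\<^sup>2) * f * E + P * f * (C * \<epsilon>\<^sup>2) + C * f * C * \<epsilon>\<^sup>2"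
        by linarith
      have "\<bar>a / d - (c0 + \<epsilon> * s t)\<bar> \<le> 2 * (P * f * E) * (C * C) * \<epsilon>\<^sup>2
        + ((C * \<epsilon>\<^sup>2) * f * E + P * f * (C * \<epsilon>\<^sup>2) + C * f * C * \<epsilon>\<^sup>2)"
        using 1 2 by linarith
      also have "\<dots> = K2 * \<epsilon>\<^sup>2" by (simp add: K2_def algebra_simps)
      finally show "\<bar>r \<epsilon> \<epsilon> t - (c0 + \<epsilon> * s t)\<bar> \<le> K2 * \<epsilon>\<^sup>2" by (simp add: r_def a_def d_def)
    qed
    ultimately show ?thesis by simp
  qed
  define K where "K = max (g * K1) (g * K2)"
  have lip': "\<bar>R \<epsilon> \<epsilon>' - R \<epsilon>' \<epsilon>'\<bar> \<le> K * \<bar>\<epsilon> - \<epsilon>'\<bar>" if "\<bar>\<epsilon>\<bar> \<le> \<delta>" "\<bar>\<epsilon>'\<bar> \<le> \<delta>" for \<epsilon> \<epsilon>'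
    using lip[OF that] mult_right_mono[of "g * K1" K "\<bar>\<epsilon> - \<epsilon>'\<bar>"] by (simp add: K_def mult.assoc)
  have quad': "\<bar>R \<epsilon> \<epsilon> - (c0 * time_average \<theta> \<gamma> + \<epsilon> * time_average \<theta> (\<lambda>t. \<gamma> t * s t))\<bar> \<le> K * \<epsilon>\<^sup>2"
    if "\<bar>\<epsilon>\<bar> \<le> \<delta>" for \<epsilon>
    using quad[OF that] mult_right_mono[of "g * K2" K "\<epsilon>\<^sup>2"] by (simp add: K_def mult.assoc)
  note D = derivatives_of_quotient_family[OF d(1) diff lip' quad']
  show "(\<Lambda> has_real_derivative (\<phi> b \<bullet> (F *v e b)) * time_average \<theta> \<gamma>) (at 0)"
    using D(1) by (simp add: c0_def)
  show "\<forall>\<^sub>F \<epsilon> in nhds 0. \<Lambda> field_differentiable (at \<epsilon>)" by (rule D(2))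
  show "(deriv \<Lambda> has_real_derivative time_average \<theta> (\<lambda>t. \<gamma> t * (y1 t \<bullet> (F *v e b) + \<phi> b \<bullet> (F *v z1 t)))) (at 0)"
    using D(3) by (simp add: s_def)
qed

text \<open>The adjoint coefficient \<open>y1\<close> has the opposite filter rate and an explicit
  minus sign. Reversing the rate also reverses the sign of the mean, so both halves contribute
  equally and the factor 2 appears.\<close>

lemma second_order_average:
  "time_average \<theta> (\<lambda>t. \<gamma> t * (y1 t \<bullet> (F *v e b) + \<phi> b \<bullet> (F *v z1 t))) =
    2 * (\<Sum>i\<in>-{b}. time_average \<theta> (\<lambda>t. (filtered_control \<theta> (lam b - lam i) \<gamma> t)\<^sup>2) *
       ((\<phi> b \<bullet> (F *v e i)) * (\<phi> i \<bullet> (F *v e b)) / (lam b - lam i)))"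
proof -
  define c where "c i = (\<phi> b \<bullet> (F *v e i)) * (\<phi> i \<bullet> (F *v e b))" for i
  let ?Y = "\<lambda>i. periodic_filter \<theta> (lam b - lam i) \<gamma>"
  let ?Z = "\<lambda>i. periodic_filter \<theta> (lam i - lam b) \<gamma>"
  have nz: "lam b - lam i \<noteq> 0" "lam i - lam b \<noteq> 0" if "i \<in> -{b}" for i using lam_neq[of i] that by auto
  have Yc: "periodic_control \<theta> (\<lambda>t. \<gamma> t * ?Y i t)" "periodic_control \<theta> (\<lambda>t. \<gamma> t * ?Z i t)" if "i \<in> -{b}" for i
    by (intro periodic_control_mult gamma periodic_filter_control theta_pos nz that)+
  have "\<gamma> t * (y1 t \<bullet> (F *v e b) + \<phi> b \<bullet> (F *v z1 t)) = (\<Sum>i\<in>-{b}. c i * (\<gamma> t * ?Y i t - \<gamma> t * ?Z i t))" for t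
    unfolding y1_def z1_def c_def linear_sum[OF matrix_vector_mul_linear]
    by (simp add: matrix_vector_mult_scaleR inner_sum_left inner_sum_right sum_distrib_left sum_subtractf
        right_diff_distrib mult_ac)
  then have "time_average \<theta> (\<lambda>t. \<gamma> t * (y1 t \<bullet> (F *v e b) + \<phi> b \<bullet> (F *v z1 t)))
    = time_average \<theta> (\<lambda>t. \<Sum>i\<in>-{b}. c i * (\<gamma> t * ?Y i t - \<gamma> t * ?Z i t))" by simp
  also have "\<dots> = (\<Sum>i\<in>-{b}. time_average \<theta> (\<lambda>t. c i * (\<gamma> t * ?Y i t - \<gamma> t * ?Z i t)))"
    unfolding time_average_def
    by (subst integral_sum)
      (auto simp: sum_distrib_left intro!: periodic_controlD(5)[OF periodic_control_mult[OF periodic_control_const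
            periodic_control_diff]] Yc)
  also have "\<dots> = (\<Sum>i\<in>-{b}. c i * (2 * (time_average \<theta> (\<lambda>t. (filtered_control \<theta> (lam b - lam i) \<gamma> t)\<^sup>2) / (lam b - lam i))))"
  proof (rule sum.cong[OF refl])
    fix i assume i: "i \<in> -{b}"
    have n: "lam i - lam b = - (lam b - lam i)" by simp
    note T = time_average_filter[OF theta_pos nz(1)[OF i] gamma]
    have "time_average \<theta> (\<lambda>t. \<gamma> t * ?Z i t) = - time_average \<theta> (\<lambda>t. \<gamma> t * ?Y i t)"
      unfolding n by (rule T(2))
    then show "time_average \<theta> (\<lambda>t. c i * (\<gamma> t * ?Y i t - \<gamma> t * ?Z i t))
      = c i * (2 * (time_average \<theta> (\<lambda>t. (filtered_control \<theta> (lam b - lam i) \<gamma> t)\<^sup>2) / (lam b - lam i)))"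
      unfolding time_average_cmult T(1)[symmetric]
        time_average_diff[OF periodic_controlD(5)[OF Yc(1)[OF i]] periodic_controlD(5)[OF Yc(2)[OF i]]] by simp
  qed
  finally show ?thesis by (simp add: c_def sum_distrib_left mult_ac)
qed

end

section \<open>Perron eigenvectors\<close>

lemma irreducible_matrixD:
  assumes "irreducible_matrix A" "I \<noteq> {}" "I \<noteq> UNIV"
  obtains i j where "i \<in> I" "j \<notin> I" "A $ i $ j \<noteq> 0"
proof -
  have "\<not> (I \<noteq> {} \<and> I \<noteq> UNIV \<and> (\<forall>i\<in>I. \<forall>j\<in>-I. A $ i $ j = 0))"
    using assms(1) unfolding irreducible_matrix_def by (rule contrapos_nn) (rule exI)
  then show ?thesis using assms(2,3) that by auto
qed

lemma irreducible_transpose: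
  assumes "irreducible_matrix A"
  shows "irreducible_matrix (transpose A)"
  unfolding irreducible_matrix_def
proof
  assume "\<exists>I. I \<noteq> {} \<and> I \<noteq> UNIV \<and> (\<forall>i\<in>I. \<forall>j\<in>-I. transpose A $ i $ j = 0)"
  then obtain I where I: "I \<noteq> {}" "I \<noteq> UNIV" "\<forall>i\<in>I. \<forall>j\<in>-I. A $ j $ i = 0"
    by (auto simp: transpose_def)
  have "-I \<noteq> {}" "-I \<noteq> UNIV" using I(1,2) by auto
  moreover have "\<forall>i\<in>-I. \<forall>j\<in>-(-I). A $ i $ j = 0"
    unfolding double_complement using I(3) by blast
  ultimately have "\<exists>I. I \<noteq> {} \<and> I \<noteq> UNIV \<and> (\<forall>i\<in>I. \<forall>j\<in>-I. A $ i $ j = 0)"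
    by (intro exI[of _ "-I"] conjI)
  then show False using assms unfolding irreducible_matrix_def by (rule notE[rotated])
qed

lemma metzler_transpose: "metzler A \<Longrightarrow> metzler (transpose A)"
  by (simp add: metzler_def transpose_def)

lemma sum_UNIV_remove:
  fixes f :: "'n::finite \<Rightarrow> 'a::comm_monoid_add"
  shows "(\<Sum>j\<in>UNIV. f j) = f i + (\<Sum>j\<in>-{i}. f j)"
  unfolding Compl_eq_Diff_UNIV by (rule sum.remove) auto

lemma mult_component_split:
  fixes A :: "real^'n^'n"
  shows "(A *v x) $ i = A $ i $ i * x $ i + (\<Sum>j\<in>-{i}. A $ i $ j * x $ j)"
  unfolding matrix_vector_mult_def by (simp add: sum_UNIV_remove[of _ i])

text \<open>In a row where \<open>v\<close> vanishes, the off-diagonal terms of the eigenvalue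
  equation are nonnegative with sum zero, so all vanish. The zero set of \<open>v\<close> would thus
  reduce the matrix.\<close>

lemma nonneg_eigenvector_pos:
  fixes A :: "real^'n^'n"
  assumes m: "metzler A" and irr: "irreducible_matrix A"
    and v: "\<And>i. v $ i \<ge> 0" "v \<noteq> 0" and ev: "A *v v = r *\<^sub>R v"
  shows "v $ i > 0"
proof -
  define I where "I = {i. v $ i = 0}"
  have "A $ i $ j = 0" if "i \<in> I" "j \<in> -I" for i j
  proof -
    have "v $ i = 0" using that by (simp add: I_def)
    then have "(\<Sum>j\<in>-{i}. A $ i $ j * v $ j) = 0"
      using mult_component_split[of A v i] ev by simp
    moreover have "A $ i $ j * v $ j \<ge> 0" if "j \<in> -{i}" for j
      using m v(1) that unfolding metzler_def by auto
    ultimately have "\<forall>j\<in>-{i}. A $ i $ j * v $ j = 0"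
      by (subst (asm) sum_nonneg_eq_0_iff) auto
    then show ?thesis using that by (auto simp: I_def)
  qed
  moreover have "I \<noteq> UNIV" using v(2) by (auto simp: I_def vec_eq_iff)
  ultimately have "I = {}" using irr unfolding irreducible_matrix_def by blast
  then show ?thesis using v(1)[of i] by (auto simp: I_def less_le)
qed

text \<open>Brouwer's theorem for the normalised map x -> (A + c) x on the standard simplex; a fixed
  point is a nonnegative eigenvector, and irreducibility makes it positive.\<close>

lemma perron_eigenvector_exists:
  fixes A :: "real^'n^'n"
  assumes m: "metzler A" and irr: "irreducible_matrix A"
  shows "\<exists>r v. (\<forall>i. v $ i > 0) \<and> A *v v = r *\<^sub>R v"
proof -
  \<comment> \<open>Raises every diagonal entry to at least 1. Then \<open>B x \<ge> x\<close>
    componentwise on the simplex, so the normalising sum is at least 1.\<close>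
  define c where "c = 1 + (\<Sum>i\<in>UNIV. \<bar>A $ i $ i\<bar>)"
  define S where "S = {x :: real^'n. (\<forall>i. 0 \<le> x $ i) \<and> (\<Sum>i\<in>UNIV. x $ i) = 1}"
  define B where "B x = A *v x + c *\<^sub>R x" for x
  define f where "f x = (1 / (\<Sum>i\<in>UNIV. B x $ i)) *\<^sub>R B x" for x
  have cA: "A $ i $ i + c \<ge> 1" for i
  proof -
    have "\<bar>A $ i $ i\<bar> \<le> (\<Sum>i\<in>UNIV. \<bar>A $ i $ i\<bar>)" by (rule member_le_sum) auto
    then show ?thesis by (simp add: c_def)
  qed
  have Bge: "B x $ i \<ge> x $ i" if "x \<in> S" for x i
  proof -
    have "(\<Sum>j\<in>-{i}. A $ i $ j * x $ j) \<ge> 0"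
      using m that unfolding metzler_def S_def by (intro sum_nonneg) auto
    moreover have "1 * x $ i \<le> (A $ i $ i + c) * x $ i"
      using cA[of i] that by (intro mult_right_mono) (auto simp: S_def)
    ultimately show ?thesis by (simp add: B_def mult_component_split algebra_simps)
  qed
  have Bs: "(\<Sum>i\<in>UNIV. B x $ i) \<ge> 1" if "x \<in> S" for x
    using sum_mono[of UNIV "\<lambda>i. x $ i" "\<lambda>i. B x $ i"] Bge[OF that] that by (simp add: S_def)
  have "compact S"
  proof (rule compact_eq_bounded_closed[THEN iffD2], rule conjI)
    have "norm x \<le> 1" if "x \<in> S" for x
      using norm_le_l1_cart[of x] that by (simp add: S_def)
    then show "bounded S" by (auto simp: bounded_iff)
    have "S = (\<Inter>i. {x. 0 \<le> x $ i}) \<inter> {x. (\<Sum>i\<in>UNIV. x $ i) = 1}" by (auto simp: S_def)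
    then show "closed S"
      by (auto intro!: closed_INT closed_Collect_le closed_Collect_eq continuous_intros)
  qed
  moreover have "convex S"
    unfolding convex_def S_def
    by (auto simp: sum.distrib sum_distrib_left[symmetric])
  moreover have "axis undefined 1 \<in> S"
    by (auto simp: S_def axis_def)
  moreover have cB: "continuous_on S B"
    unfolding B_def
    by (intro continuous_intros bounded_linear.continuous_on[OF matrix_vector_mul_bounded_linear])
  then have "continuous_on S f"
    unfolding f_def using Bs by (intro continuous_intros) force+
  moreover have "f \<in> S \<rightarrow> S"
  proof
    fix x assume x: "x \<in> S"
    have "0 \<le> B x $ i" for i using Bge[OF x, of i] x by (auto simp: S_def intro: order_trans)
    then have "0 \<le> f x $ i" for i using Bs[OF x] by (simp add: f_def)
    moreover have "(\<Sum>i\<in>UNIV. f x $ i) = 1"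
      using Bs[OF x] by (simp add: f_def sum_divide_distrib[symmetric])
    ultimately show "f x \<in> S" by (simp add: S_def)
  qed
  ultimately obtain x where x: "x \<in> S" "f x = x" using brouwer[of S f] by blast
  define s where "s = (\<Sum>i\<in>UNIV. B x $ i)"
  have s: "s \<ge> 1" using Bs[OF x(1)] by (simp add: s_def)
  have "B x = s *\<^sub>R f x" using s by (simp add: f_def s_def[symmetric])
  then have ev: "A *v x = (s - c) *\<^sub>R x" using x(2) by (simp add: B_def algebra_simps)
  have nz: "x \<noteq> 0" using x(1) by (auto simp: S_def)
  have "x $ i > 0" for i
    by (rule nonneg_eigenvector_pos[OF m irr _ nz ev]) (use x(1) in \<open>simp add: S_def\<close>)
  then show ?thesis using ev by blast
qed

text \<open>Subtract from \<open>w\<close> the largest multiple of \<open>v\<close> lying below it.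
  The result is a nonnegative vector in the eigenspace with a zero component, hence zero by
  \<open>nonneg_eigenvector_pos\<close>.\<close>

lemma perron_eigenspace:
  fixes A :: "real^'n^'n"
  assumes m: "metzler A" and irr: "irreducible_matrix A"
    and v: "\<And>i. v $ i > 0" "A *v v = r *\<^sub>R v" and w: "A *v w = r *\<^sub>R w"
  shows "\<exists>c. w = c *\<^sub>R v"
proof -
  define c where "c = Min (range (\<lambda>i. w $ i / v $ i))"
  have cl: "c \<le> w $ i / v $ i" for i unfolding c_def by (rule Min_le) auto
  have "c \<in> range (\<lambda>i. w $ i / v $ i)" unfolding c_def by (rule Min_in) auto
  then obtain i where i: "c = w $ i / v $ i" by blast
  define x where "x = w - c *\<^sub>R v"
  have "x $ j \<ge> 0" for j using cl[of j] v(1)[of j] by (simp add: x_def field_simps)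
  moreover have "x $ i = 0" using v(1)[of i] by (simp add: x_def i)
  moreover have "A *v x = r *\<^sub>R x"
    by (simp add: x_def matrix_vector_mult_diff_distrib matrix_vector_mult_scaleR v(2) w algebra_simps)
  ultimately have "x = 0" using nonneg_eigenvector_pos[OF m irr, of x r i] by force
  then show ?thesis by (auto simp: x_def)
qed

text \<open>A Gershgorin argument scaled by \<open>v\<close>: in the row where
  \<open>cmod (w $ i) / v $ i\<close> is largest, \<open>z\<close> lies in the disc with centre
  \<open>A $ i $ i\<close> and radius \<open>r - A $ i $ i\<close>. This disc meets the half plane
  Re >= r only at \<open>r\<close>.\<close>

lemma perron_dominance:
  fixes A :: "real^'n^'n"
  assumes m: "metzler A" and v: "\<And>i. v $ i > 0" "A *v v = r *\<^sub>R v"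
    and z: "is_eigenvalue (\<chi> i j. complex_of_real (A $ i $ j)) z" "z \<noteq> complex_of_real r"
  shows "Re z < r"
proof -
  obtain w where w: "w \<noteq> 0" "(\<chi> i j. complex_of_real (A $ i $ j)) *v w = z *s w"
    using z(1) unfolding is_eigenvalue_def by blast
  define q where "q i = cmod (w $ i) / v $ i" for i
  have "Max (range q) \<in> range q" by (rule Max_in) auto
  then obtain i where i: "Max (range q) = q i" by blast
  have qi: "q j \<le> q i" for j unfolding i[symmetric] by (rule Max_ge) auto
  have le: "cmod (w $ j) \<le> q i * v $ j" for j
    using qi[of j] v(1)[of j] by (simp add: q_def divide_le_eq)
  obtain j where "w $ j \<noteq> 0" using w(1) by (auto simp: vec_eq_iff)
  then have "q j > 0" using v(1)[of j] by (simp add: q_def)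
  then have "q i > 0" using qi[of j] by linarith
  then have wi: "cmod (w $ i) > 0" using v(1)[of i] by (simp add: q_def zero_less_divide_iff)
  have "z * w $ i = (\<Sum>j\<in>UNIV. complex_of_real (A $ i $ j) * w $ j)"
    using arg_cong[OF w(2), of "\<lambda>x. x $ i"] by (simp add: matrix_vector_mult_def)
  also have "\<dots> = complex_of_real (A $ i $ i) * w $ i + (\<Sum>j\<in>-{i}. complex_of_real (A $ i $ j) * w $ j)"
    by (rule sum_UNIV_remove)
  finally have "(z - complex_of_real (A $ i $ i)) * w $ i = (\<Sum>j\<in>-{i}. complex_of_real (A $ i $ j) * w $ j)"
    by (simp add: algebra_simps)
  then have "cmod (z - complex_of_real (A $ i $ i)) * cmod (w $ i)
    = cmod (\<Sum>j\<in>-{i}. complex_of_real (A $ i $ j) * w $ j)"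
    by (metis norm_mult)
  also have "\<dots> \<le> (\<Sum>j\<in>-{i}. cmod (complex_of_real (A $ i $ j) * w $ j))" by (rule norm_sum)
  also have "\<dots> \<le> (\<Sum>j\<in>-{i}. A $ i $ j * (q i * v $ j))"
  proof (rule sum_mono)
    fix j assume "j \<in> -{i}"
    then have "A $ i $ j \<ge> 0" using m unfolding metzler_def by auto
    then show "cmod (complex_of_real (A $ i $ j) * w $ j) \<le> A $ i $ j * (q i * v $ j)"
      using le[of j] by (simp add: norm_mult mult_left_mono)
  qed
  also have "\<dots> = q i * (\<Sum>j\<in>-{i}. A $ i $ j * v $ j)" by (simp add: sum_distrib_left mult_ac)
  also have "(\<Sum>j\<in>-{i}. A $ i $ j * v $ j) = (r - A $ i $ i) * v $ i"
    using mult_component_split[of A v i] v(2) by (simp add: algebra_simps)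
  also have "q i * ((r - A $ i $ i) * v $ i) = (r - A $ i $ i) * cmod (w $ i)"
    using v(1)[of i] by (simp add: q_def)
  finally have le1: "cmod (z - complex_of_real (A $ i $ i)) \<le> r - A $ i $ i" using wi by simp
  show ?thesis
  proof (rule ccontr)
    assume "\<not> Re z < r"
    then have re: "Re (z - complex_of_real (A $ i $ i)) \<ge> r - A $ i $ i" by simp
    have "\<bar>Re (z - complex_of_real (A $ i $ i))\<bar> \<le> r - A $ i $ i"
      using abs_Re_le_cmod le1 by (rule order_trans)
    then have eq: "Re (z - complex_of_real (A $ i $ i)) = r - A $ i $ i" using re by linarith
    have "(cmod (z - complex_of_real (A $ i $ i)))\<^sup>2 \<le> (r - A $ i $ i)\<^sup>2"
      using le1 by (intro power_mono) auto
    then have "Im z = 0" unfolding cmod_power2 eq by simp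
    then have "z = complex_of_real r" using eq by (simp add: complex_eq_iff)
    then show False using z(2) by simp
  qed
qed

section \<open>Simplicity of the Perron root in dimension three, through the principal 2 x 2 minors
  of r - A\<close>

lemma pderiv_charpoly_3:
  fixes A :: "real^3^3"
  shows "poly (pderiv (charpoly A)) r =
     ((r - A$1$1) * (r - A$2$2) - A$1$2 * A$2$1) + ((r - A$1$1) * (r - A$3$3) - A$1$3 * A$3$1)
     + ((r - A$2$2) * (r - A$3$3) - A$2$3 * A$3$2)"
  unfolding charpoly_def det_3
  by (simp add: mat_def pderiv_mult pderiv_diff pderiv_add pderiv_pCons algebra_simps)

lemma poly_charpoly_3:
  fixes A :: "real^3^3"
  shows "poly (charpoly A) r = det (r *\<^sub>R mat 1 - A)"
  unfolding charpoly_def det_3 by (simp add: mat_def algebra_simps)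

text \<open>\<open>a11\<close> and \<open>a22\<close> stand for diagonal entries of r - A, and
  \<open>e1\<close>, \<open>e2\<close> for two rows of the eigenvector equation. After
  multiplication by \<open>x * y\<close> the negative term cancels; irreducibility for the row sets
  {1}, {2} and {1, 2}, expressed by \<open>r1\<close>, \<open>r2\<close> and \<open>r12\<close>,
  makes one of the remaining nonnegative terms positive.\<close>

lemma principal_minor_pos:
  fixes a11 a12 a13 a21 a22 a23 x y z :: real
  assumes pos: "x > 0" "y > 0" "z > 0" and nn: "a12 \<ge> 0" "a13 \<ge> 0" "a21 \<ge> 0" "a23 \<ge> 0"
    and e1: "a11 * x = a12 * y + a13 * z" and e2: "a22 * y = a21 * x + a23 * z"
    and r1: "a12 + a13 > 0" and r2: "a21 + a23 > 0" and r12: "a13 + a23 > 0"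
  shows "a11 * a22 - a12 * a21 > 0"
proof -
  have "(a11 * a22 - a12 * a21) * (x * y) = (a11 * x) * (a22 * y) - a12 * a21 * (x * y)"
    by (simp add: algebra_simps)
  also have "\<dots> = a12 * a23 * (y * z) + a13 * a21 * (x * z) + a13 * a23 * (z * z)"
    unfolding e1 e2 by (simp add: algebra_simps)
  also have "\<dots> > 0"
  proof -
    have nonneg: "a12 * a23 * (y * z) \<ge> 0" "a13 * a21 * (x * z) \<ge> 0" "a13 * a23 * (z * z) \<ge> 0"
      using pos nn by simp_all
    have "a12 * a23 > 0 \<or> a13 * a21 > 0 \<or> a13 * a23 > 0"
      using nn r1 r2 r12 by (cases "a13 = 0"; cases "a23 = 0") (auto simp: less_le)
    then have "a12 * a23 * (y * z) > 0 \<or> a13 * a21 * (x * z) > 0 \<or> a13 * a23 * (z * z) > 0"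
      using pos by (meson mult_pos_pos)
    then show ?thesis using nonneg by linarith
  qed
  finally have "(a11 * a22 - a12 * a21) * (x * y) > 0" .
  moreover have "x * y > 0" using pos by simp
  ultimately show ?thesis by (rule zero_less_mult_pos2)
qed

lemma is_perron_eigenvalue_3:
  fixes A :: "real^3^3"
  assumes m: "metzler A" and irr: "irreducible_matrix A"
    and v: "\<And>i. v $ i > 0" "A *v v = r *\<^sub>R v"
  shows "is_perron_eigenvalue A r"
proof -
  have nn: "A $ i $ j \<ge> 0" if "i \<noteq> j" for i j using m that unfolding metzler_def by auto
  have comp: "(A *v v) $ i = A$i$1 * v$1 + A$i$2 * v$2 + A$i$3 * v$3" for i
    by (simp add: matrix_vector_mult_def sum_3)
  have ev: "(r - A$1$1) * v$1 = A$1$2 * v$2 + A$1$3 * v$3" "(r - A$2$2) * v$2 = A$2$1 * v$1 + A$2$3 * v$3"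
    "(r - A$3$3) * v$3 = A$3$1 * v$1 + A$3$2 * v$2"
    using comp[of 1] comp[of 2] comp[of 3] v(2) by (simp_all add: algebra_simps)
  have irr': "\<exists>i\<in>I. \<exists>j\<in>-I. A $ i $ j > 0" if ne_I: "I \<noteq> {}" "I \<noteq> UNIV" for I
  proof -
    obtain i j where ij: "i \<in> I" "j \<notin> I" "A $ i $ j \<noteq> 0"
      by (rule irreducible_matrixD[OF irr ne_I])
    then have "i \<noteq> j" by auto
    then have "A $ i $ j > 0" using nn[of i j] ij(3) by simp
    then show ?thesis using ij(1,2) by auto
  qed
  have ne: "(1::3) \<noteq> 2" "(1::3) \<noteq> 3" "(2::3) \<noteq> 3" by simp_all
  have n: "A$1$2 \<ge> 0" "A$1$3 \<ge> 0" "A$2$1 \<ge> 0" "A$2$3 \<ge> 0" "A$3$1 \<ge> 0" "A$3$2 \<ge> 0"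
    using nn ne by auto
  have sing: "{i} \<noteq> UNIV" "-{i} \<noteq> {}" for i :: 3
  proof -
    obtain j :: 3 where "j \<noteq> i" using ne(1) by metis
    then show "{i} \<noteq> UNIV" "-{i} \<noteq> {}" by auto
  qed
  have ex: "\<exists>j. j \<noteq> i \<and> A $ i $ j > 0" "\<exists>j. j \<noteq> i \<and> A $ j $ i > 0" for i
  proof -
    show "\<exists>j. j \<noteq> i \<and> A $ i $ j > 0" using irr'[of "{i}"] sing[of i] by blast
    have "-{i} \<noteq> UNIV" by blast
    then show "\<exists>j. j \<noteq> i \<and> A $ j $ i > 0" using irr'[of "-{i}"] sing[of i] by blast
  qed
  have ex1: "P 2 \<or> P 3" if "\<exists>j. j \<noteq> (1::3) \<and> P j" for P using that exhaust_3 by metis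
  have ex2: "P 1 \<or> P 3" if "\<exists>j. j \<noteq> (2::3) \<and> P j" for P using that exhaust_3 by metis
  have ex3: "P 1 \<or> P 2" if "\<exists>j. j \<noteq> (3::3) \<and> P j" for P using that exhaust_3 by metis
  have row: "A$1$2 + A$1$3 > 0" "A$2$1 + A$2$3 > 0" "A$3$1 + A$3$2 > 0"
  proof -
    have "A$1$2 > 0 \<or> A$1$3 > 0" using ex1[OF ex(1)[of 1]] by simp
    then show "A$1$2 + A$1$3 > 0" using n by linarith
    have "A$2$1 > 0 \<or> A$2$3 > 0" using ex2[OF ex(1)[of 2]] by simp
    then show "A$2$1 + A$2$3 > 0" using n by linarith
    have "A$3$1 > 0 \<or> A$3$2 > 0" using ex3[OF ex(1)[of 3]] by simp
    then show "A$3$1 + A$3$2 > 0" using n by linarith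
  qed
  have col: "A$1$3 + A$2$3 > 0" "A$1$2 + A$3$2 > 0" "A$2$1 + A$3$1 > 0"
  proof -
    have "A$1$3 > 0 \<or> A$2$3 > 0" using ex3[OF ex(2)[of 3]] by simp
    then show "A$1$3 + A$2$3 > 0" using n by linarith
    have "A$1$2 > 0 \<or> A$3$2 > 0" using ex2[OF ex(2)[of 2]] by simp
    then show "A$1$2 + A$3$2 > 0" using n by linarith
    have "A$2$1 > 0 \<or> A$3$1 > 0" using ex1[OF ex(2)[of 1]] by simp
    then show "A$2$1 + A$3$1 > 0" using n by linarith
  qed
  have "(r - A$1$1) * (r - A$2$2) - A$1$2 * A$2$1 > 0"
    by (rule principal_minor_pos[OF v(1)[of 1] v(1)[of 2] v(1)[of 3] n(1-4) ev(1,2) row(1,2) col(1)])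
  \<comment> \<open>The other two minors follow by renaming indices; the unfolded commutations only
    reorder sums to match.\<close>
  moreover have "(r - A$1$1) * (r - A$3$3) - A$1$3 * A$3$1 > 0"
    by (rule principal_minor_pos[OF v(1)[of 1] v(1)[of 3] v(1)[of 2] n(2,1,5,6)
          ev(1)[unfolded add.commute[of "A$1$2 * _"]] ev(3) row(1)[unfolded add.commute[of "A$1$2"]] row(3) col(2)])
  moreover have "(r - A$2$2) * (r - A$3$3) - A$2$3 * A$3$2 > 0"
    by (rule principal_minor_pos[OF v(1)[of 2] v(1)[of 3] v(1)[of 1] n(4,3,6,5)
          ev(2)[unfolded add.commute[of "A$2$1 * _"]] ev(3)[unfolded add.commute[of "A$3$1 * _"]]
          row(2)[unfolded add.commute[of "A$2$1"]] row(3)[unfolded add.commute[of "A$3$1"]] col(3)])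
  ultimately have dp: "poly (pderiv (charpoly A)) r \<noteq> 0"
    unfolding pderiv_charpoly_3 by linarith
  have v0: "v \<noteq> 0" using v(1)[of 1] by auto
  have root: "poly (charpoly A) r = 0"
  proof -
    have "(r *\<^sub>R mat 1 - A) *v v = 0"
      by (simp add: matrix_vector_mult_diff_rdistrib scaleR_matrix_vector_assoc[symmetric] v(2))
    then have "\<not> invertible (r *\<^sub>R mat 1 - A)"
      using v0 invertible_def matrix_left_invertible_ker by metis
    then show ?thesis by (simp add: poly_charpoly_3 invertible_det_nz)
  qed
  have "order r (charpoly A) = Suc (order r (pderiv (charpoly A)))"
    using dp root by (intro order_pderiv) auto
  then have "order r (charpoly A) = 1" using order_0I[OF dp] by simp
  moreover have "is_eigenvalue A r"
    unfolding is_eigenvalue_def using v0 v(2) by (auto simp: scalar_mult_eq_scaleR)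
  ultimately show ?thesis
    unfolding is_perron_eigenvalue_def using perron_dominance[OF m v] by blast
qed

text \<open>Real eigenvectors remain eigenvectors over the complex numbers, so each of two distinct
  Perron eigenvalues would lie strictly below the other.\<close>

lemma is_perron_eigenvalue_unique:
  fixes A :: "real^'n^'n"
  assumes "is_perron_eigenvalue A l" "is_perron_eigenvalue A r"
  shows "l = r"
proof -
  have cx: "is_eigenvalue (\<chi> i j. complex_of_real (A $ i $ j)) (complex_of_real s)"
    if s: "is_eigenvalue A s" for s
  proof -
    obtain w where w: "w \<noteq> 0" "A *v w = s *s w" using s unfolding is_eigenvalue_def by blast
    have "(\<chi> i j. complex_of_real (A $ i $ j)) *v (\<chi> i. complex_of_real (w $ i))
      = complex_of_real s *s (\<chi> i. complex_of_real (w $ i))"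
    proof (rule vec_eq_iff[THEN iffD2], rule allI)
      fix i
      have "(\<Sum>j\<in>UNIV. A $ i $ j * w $ j) = s * w $ i"
        using arg_cong[OF w(2), of "\<lambda>x. x $ i"] by (simp add: matrix_vector_mult_def)
      then have "complex_of_real (\<Sum>j\<in>UNIV. A $ i $ j * w $ j) = complex_of_real (s * w $ i)" by simp
      then show "((\<chi> i j. complex_of_real (A $ i $ j)) *v (\<chi> i. complex_of_real (w $ i))) $ i
        = (complex_of_real s *s (\<chi> i. complex_of_real (w $ i))) $ i"
        by (simp add: matrix_vector_mult_def)
    qed
    moreover have "(\<chi> i. complex_of_real (w $ i)) \<noteq> 0" using w(1) by (auto simp: vec_eq_iff)
    ultimately show ?thesis unfolding is_eigenvalue_def by blast
  qed
  show ?thesis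
  proof (rule ccontr)
    assume "l \<noteq> r"
    then have "Re (complex_of_real l) < r" "Re (complex_of_real r) < l"
      using assms cx[of l] cx[of r] unfolding is_perron_eigenvalue_def by (metis of_real_eq_iff)+
    then show False by simp
  qed
qed

lemma perron_eigenvalue_3:
  fixes A :: "real^3^3"
  assumes "metzler A" "irreducible_matrix A"
  shows "\<exists>v. (\<forall>i. v $ i > 0) \<and> A *v v = perron_eigenvalue A *\<^sub>R v"
proof -
  obtain r v where v: "\<forall>i. v $ i > 0" "A *v v = r *\<^sub>R v"
    using perron_eigenvector_exists[OF assms] by blast
  have P: "is_perron_eigenvalue A r" using is_perron_eigenvalue_3[OF assms] v by blast
  have "perron_eigenvalue A = r"
    unfolding perron_eigenvalue_def
    by (rule the_equality, rule P) (rule is_perron_eigenvalue_unique[OF _ P])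
  then show ?thesis using v by blast
qed

text \<open>Pairing the positive eigenvector \<open>u\<close> of the transpose with \<open>v\<close>
  shows that its eigenvalue is \<open>r\<close>, since \<open>u \<bullet> v\<close> is positive; the
  one-dimensional eigenspace of the transpose then contains \<open>w\<close>.\<close>

lemma perron_left_eigenvector:
  fixes A :: "real^'n^'n"
  assumes m: "metzler A" and irr: "irreducible_matrix A"
    and v: "\<And>i. v $ i > 0" "A *v v = r *\<^sub>R v" and w: "w v* A = r *\<^sub>R w"
  shows "\<exists>c u. (\<forall>i. u $ i > 0) \<and> w = c *\<^sub>R u"
proof -
  note T = metzler_transpose[OF m] irreducible_transpose[OF irr]
  obtain r' u where u: "\<forall>i. u $ i > 0" "transpose A *v u = r' *\<^sub>R u"
    using perron_eigenvector_exists[OF T] by blast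
  have "u \<bullet> v > 0" unfolding inner_vec_def using u(1) v(1) by (intro sum_pos) auto
  moreover have "r' * (u \<bullet> v) = r * (u \<bullet> v)"
    using dot_lmul_matrix[of u A v] u(2) v(2) by simp
  ultimately have "r' = r" by simp
  then have "\<exists>c. w = c *\<^sub>R u"
    using perron_eigenspace[OF T, of u r w] u w by simp
  then show ?thesis using u(1) by blast
qed

text \<open>Lets an explicit witness determine the definite description. The range of \<epsilon> is
  where an adjoint solution, and with it uniqueness, is available.\<close>

lemma (in floquet_frame) floquet_eigenvalue_near:
  "\<exists>\<delta>>0. \<forall>\<epsilon> l. \<bar>\<epsilon>\<bar> \<le> \<delta> \<longrightarrow> is_floquet_eigenvalue G F \<theta> (\<lambda>t. \<alpha>s + \<epsilon> * \<gamma> t) l \<longrightarrow>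
     floquet_eigenvalue G F \<theta> (\<lambda>t. \<alpha>s + \<epsilon> * \<gamma> t) = l"
proof -
  obtain \<delta> z y where d: "\<delta> > 0" and zy: "\<And>\<epsilon>. \<bar>\<epsilon>\<bar> \<le> \<delta> \<Longrightarrow> Zsol \<epsilon> (z \<epsilon>) \<and> Ysol \<epsilon> (y \<epsilon>)"
    using solution_families by metis
  have "floquet_eigenvalue G F \<theta> (\<lambda>t. \<alpha>s + \<epsilon> * \<gamma> t) = l"
    if "\<bar>\<epsilon>\<bar> \<le> \<delta>" "is_floquet_eigenvalue G F \<theta> (\<lambda>t. \<alpha>s + \<epsilon> * \<gamma> t) l" for \<epsilon> l
  proof -
    have Z: "Zsol \<epsilon> (z \<epsilon>)" and Y: "Ysol \<epsilon> (y \<epsilon>)" using zy[OF that(1)] by auto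
    show ?thesis
      unfolding floquet_eigenvalue_eq(2)[OF Z Y] floquet_eigenvalue_unique[OF Y that(2)] ..
  qed
  then show ?thesis using d by blast
qed

section \<open>Constant controls, dual bases and the conclusion\<close>

lemma is_floquet_eigenvalue_const:
  assumes "\<And>i. v $ i > 0" "(G + a *\<^sub>R F) *v v = r *\<^sub>R v"
  shows "is_floquet_eigenvalue G F \<theta> (\<lambda>_. a) r"
  unfolding is_floquet_eigenvalue_def
proof (rule exI[of _ "\<lambda>_. v"], rule exI[of _ "\<lambda>_. 0"], intro conjI allI)
  show "has_ae_derivative (\<lambda>_. v) (\<lambda>_. 0)"
    by (rule has_lb_derivative_imp_ae[OF has_lb_derivative_const])
qed (use assms in auto)

lemma dual_basis_expansion:
  fixes e \<phi> :: "'n::finite \<Rightarrow> 'a::euclidean_space"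
  assumes span: "span (range e) = UNIV" and dual: "\<And>i j. \<phi> i \<bullet> e j = (if i = j then 1 else 0)"
  shows "x = (\<Sum>i\<in>UNIV. (\<phi> i \<bullet> x) *\<^sub>R e i)"
proof -
  have "linear (\<lambda>x. \<Sum>i\<in>UNIV. (\<phi> i \<bullet> x) *\<^sub>R e i)"
    by (intro linearI)
      (simp_all add: inner_add_right scaleR_left_distrib sum.distrib scaleR_sum_right)
  moreover have "linear (\<lambda>x::'a. x)" by (rule linear_ident)
  moreover have "y = (\<Sum>i\<in>UNIV. (\<phi> i \<bullet> y) *\<^sub>R e i)" if y: "y \<in> range e" for y
  proof -
    obtain j where j: "y = e j" using y by blast
    have "(\<Sum>i\<in>UNIV. (\<phi> i \<bullet> y) *\<^sub>R e i) = (\<Sum>i\<in>UNIV. if i = j then e i else 0)"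
      unfolding j dual by (intro sum.cong) auto
    then show ?thesis by (simp add: j)
  qed
  ultimately show ?thesis
    using linear_eq_on_span[of "\<lambda>x. x" "\<lambda>x. \<Sum>i\<in>UNIV. (\<phi> i \<bullet> x) *\<^sub>R e i" "range e" x] span by blast
qed

lemma metzler_add_scaleR:
  "metzler G \<Longrightarrow> metzler F \<Longrightarrow> a \<ge> 0 \<Longrightarrow> metzler (G + a *\<^sub>R F)"
  by (simp add: metzler_def)

theorem proposition2p2:
  fixes G F :: "real^3^3" and \<alpha>s \<theta> :: real and \<gamma> :: "real \<Rightarrow> real"
    and lam :: "3 \<Rightarrow> real" and e \<phi> :: "3 \<Rightarrow> real^3"
  defines "lamP \<equiv> \<lambda>\<alpha>. perron_eigenvalue (G + \<alpha> *\<^sub>R F)"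
    and "lamF \<equiv> \<lambda>\<epsilon>. floquet_eigenvalue G F \<theta> (\<lambda>t. \<alpha>s + \<epsilon> * \<gamma> t)"
  assumes "metzler G" and "metzler F"
    and "\<And>\<alpha>. \<alpha> > 0 \<Longrightarrow> irreducible_matrix (G + \<alpha> *\<^sub>R F)"
    and "bounded (lamP ` {0<..})"
    and "\<alpha>s > 0" and "\<And>\<alpha>. \<alpha> > 0 \<Longrightarrow> lamP \<alpha> \<le> lamP \<alpha>s"
    and "inj e" and "independent (range e)" and "span (range e) = UNIV"
    and "\<And>i. (G + \<alpha>s *\<^sub>R F) *v e i = lam i *\<^sub>R e i"
    and "lam 1 = lamP \<alpha>s"
    and "\<And>i. \<phi> i v* (G + \<alpha>s *\<^sub>R F) = lam i *\<^sub>R \<phi> i"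
    and "\<And>i j. \<phi> i \<bullet> e j = (if i = j then 1 else 0)"
    and "\<theta> > 0"
    and "bounded (range \<gamma>)" and "\<gamma> \<in> borel_measurable lebesgue"
    and "\<And>t. \<gamma> (t + \<theta>) = \<gamma> t"
  shows "(lamF has_real_derivative 0) (at 0)
    \<and> (\<forall>\<^sub>F \<epsilon> in nhds 0. lamF field_differentiable (at \<epsilon>))
    \<and> (\<forall>i\<in>{2, 3}. \<exists>!g. is_filtered_control \<theta> (lam 1 - lam i) \<gamma> g)
    \<and> (deriv lamF has_real_derivative
        2 * (\<Sum>i\<in>{2, 3}. time_average \<theta> (\<lambda>t. (filtered_control \<theta> (lam 1 - lam i) \<gamma> t)\<^sup>2) *
               ((\<phi> 1 \<bullet> (F *v e i)) * (\<phi> i \<bullet> (F *v e 1)) / (lam 1 - lam i)))) (at 0)"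
proof -
  define A where "A = G + \<alpha>s *\<^sub>R F"
  have metz: "metzler (G + \<alpha> *\<^sub>R F)" if "\<alpha> > 0" for \<alpha>
    using metzler_add_scaleR[OF assms(3,4)] that by simp
  have mA: "metzler A" and iA: "irreducible_matrix A"
    using metz[OF assms(7)] assms(5)[OF assms(7)] by (simp_all add: A_def)
  have Ae: "A *v e i = lam i *\<^sub>R e i" and pA: "\<phi> i v* A = lam i *\<^sub>R \<phi> i" for i
    using assms(12,14) by (simp_all add: A_def)
  note dual = assms(15)
  have exp: "x = (\<Sum>i\<in>UNIV. (\<phi> i \<bullet> x) *\<^sub>R e i)" for x
    by (rule dual_basis_expansion[OF assms(11) dual])
  have gamma: "periodic_control \<theta> \<gamma>"
    unfolding periodic_control_def using assms(17-19) by blast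
  obtain v where v: "\<And>i. v $ i > 0" "A *v v = lam 1 *\<^sub>R v"
    using perron_eigenvalue_3[OF mA iA] assms(13) by (auto simp: lamP_def A_def)
  obtain c where c: "e 1 = c *\<^sub>R v"
    using perron_eigenspace[OF mA iA v Ae[of 1]] by blast
  obtain c' u where u: "\<forall>i. u $ i > 0" "\<phi> 1 = c' *\<^sub>R u"
    using perron_left_eigenvector[OF mA iA v pA[of 1]] by blast
  have uv: "u \<bullet> v > 0" unfolding inner_vec_def using u(1) v(1) by (intro sum_pos) auto
  have cc: "c' * c * (u \<bullet> v) = 1" using dual[of 1 1] by (simp add: c u(2) mult_ac)
  then have cc_pos: "c' * c > 0" using uv by (metis zero_less_mult_pos2 zero_less_one)
  \<comment> \<open>An equal eigenvalue would make \<open>e i\<close> a multiple of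
    \<open>v\<close>; duality with \<open>\<phi> 1\<close> forces the factor to be zero,
    contradicting duality with \<open>\<phi> i\<close>.\<close>
  have lam_neq: "lam i \<noteq> lam 1" if "i \<noteq> 1" for i
  proof
    assume "lam i = lam 1"
    then obtain d where d: "e i = d *\<^sub>R v"
      using perron_eigenspace[OF mA iA v, of "e i"] Ae[of i] by auto
    have "d * c' * (u \<bullet> v) = 0" using dual[of 1 i] that by (simp add: d u(2) mult_ac)
    then have "d = 0" using uv cc_pos by auto
    then show False using dual[of i i] by (simp add: d)
  qed
  text \<open>The eigenvectors are only determined up to sign, and \<open>e 1\<close> and \<open>\<phi> 1\<close> have the same sign; a common
    change of sign of all eigenvectors leaves the claim unchanged.\<close>
  define s where "s = sgn c"
  have ss: "s * s = 1" using cc_pos by (auto simp: s_def sgn_if)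
  have sc: "s * c > 0" "s * c' > 0"
    using cc_pos by (auto simp: s_def sgn_if zero_less_mult_iff)
  define e' where "e' i = s *\<^sub>R e i" for i
  define \<phi>' where "\<phi>' i = s *\<^sub>R \<phi> i" for i
  \<comment> \<open>Proved for every periodic \<open>g\<close>, because the frame is needed both for
    the constant direction 1 and for \<gamma>.\<close>
  have frame: "floquet_frame G F A \<alpha>s lam e' \<phi>' 1 \<theta> g" if g: "periodic_control \<theta> g" for g
  proof
    show "A = G + \<alpha>s *\<^sub>R F" by (rule A_def)
    show "\<theta> > 0" "periodic_control \<theta> g" by (fact assms(16) g)+
    show "A *v e' i = lam i *\<^sub>R e' i" for i
      by (simp add: e'_def matrix_vector_mult_scaleR Ae)
    show "\<phi>' i v* A = lam i *\<^sub>R \<phi>' i" for i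
      using matrix_vector_mult_scaleR[of "transpose A" s "\<phi> i"] by (simp add: \<phi>'_def pA)
    show "lam i \<noteq> lam 1" if "i \<noteq> 1" for i by (rule lam_neq[OF that])
    show "\<phi>' i \<bullet> e' j = (if i = j then 1 else 0)" for i j
      using ss by (simp add: \<phi>'_def e'_def dual)
    show "x = (\<Sum>i\<in>UNIV. (\<phi>' i \<bullet> x) *\<^sub>R e' i)" for x
    proof -
      have "(\<phi>' i \<bullet> x) *\<^sub>R e' i = (\<phi> i \<bullet> x) *\<^sub>R e i" for i
      proof -
        have "(\<phi>' i \<bullet> x) *\<^sub>R e' i = ((s * s) * (\<phi> i \<bullet> x)) *\<^sub>R e i"
          by (simp add: \<phi>'_def e'_def mult_ac)
        then show ?thesis unfolding ss by simp
      qed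
      then show ?thesis using exp[of x] by simp
    qed
    show "e' 1 $ i > 0" for i using mult_pos_pos[OF sc(1) v(1)[of i]] by (simp add: e'_def c mult.assoc)
    show "\<phi>' 1 $ i > 0" for i using mult_pos_pos[OF sc(2), of "u $ i"] u by (simp add: \<phi>'_def mult.assoc)
  qed
  interpret one: floquet_frame G F A \<alpha>s lam e' \<phi>' 1 \<theta> "\<lambda>_. 1"
    by (rule frame[OF periodic_control_const])
  interpret ctl: floquet_frame G F A \<alpha>s lam e' \<phi>' 1 \<theta> \<gamma>
    by (rule frame[OF gamma])
  text \<open>Constant controls have Floquet eigenvalue \<open>lamP\<close>, so the derivative in the direction \<open>1\<close> vanishes at
    the maximum.\<close>
  have critical: "\<phi>' 1 \<bullet> (F *v e' 1) = 0"
  proof -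
    define \<Lambda> where "\<Lambda> \<epsilon> = floquet_eigenvalue G F \<theta> (\<lambda>t. \<alpha>s + \<epsilon> * 1)" for \<epsilon>
    have der: "(\<Lambda> has_real_derivative \<phi>' 1 \<bullet> (F *v e' 1)) (at 0)"
      using one.floquet_derivatives(1) unfolding \<Lambda>_def[abs_def] time_average_const[OF assms(16)] by simp
    obtain \<delta> where d: "\<delta> > 0" "\<And>\<epsilon> l. \<bar>\<epsilon>\<bar> \<le> \<delta> \<Longrightarrow> is_floquet_eigenvalue G F \<theta> (\<lambda>t. \<alpha>s + \<epsilon> * 1) l \<Longrightarrow> \<Lambda> \<epsilon> = l"
      using one.floquet_eigenvalue_near unfolding \<Lambda>_def by blast
    have L: "\<Lambda> \<epsilon> = lamP (\<alpha>s + \<epsilon>)" if "\<bar>\<epsilon>\<bar> \<le> \<delta>" "\<bar>\<epsilon>\<bar> < \<alpha>s" for \<epsilon>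
    proof -
      have pos: "\<alpha>s + \<epsilon> > 0" using that(2) by linarith
      obtain w where w: "\<And>i. w $ i > 0" "(G + (\<alpha>s + \<epsilon>) *\<^sub>R F) *v w = lamP (\<alpha>s + \<epsilon>) *\<^sub>R w"
        using perron_eigenvalue_3[OF metz[OF pos] assms(5)[OF pos]] by (auto simp: lamP_def)
      show ?thesis using d(2)[OF that(1)] is_floquet_eigenvalue_const[OF w] by simp
    qed
    \<comment> \<open>Within this radius the description of the Floquet eigenvalue is settled and
      \<open>\<alpha>s + \<epsilon>\<close> stays positive, where maximality of \<open>lamP\<close>
      at \<open>\<alpha>s\<close> applies.\<close>
    show ?thesis
    proof (rule DERIV_local_max[OF der, of "min \<delta> \<alpha>s"])
      show "0 < min \<delta> \<alpha>s" using d(1) assms(7) by simp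
      show "\<forall>\<epsilon>. \<bar>0 - \<epsilon>\<bar> < min \<delta> \<alpha>s \<longrightarrow> \<Lambda> \<epsilon> \<le> \<Lambda> 0"
      proof (intro allI impI)
        fix \<epsilon> assume "\<bar>0 - \<epsilon>\<bar> < min \<delta> \<alpha>s"
        then have "\<bar>\<epsilon>\<bar> \<le> \<delta>" "\<bar>\<epsilon>\<bar> < \<alpha>s" by simp_all
        then show "\<Lambda> \<epsilon> \<le> \<Lambda> 0"
          using L[of \<epsilon>] L[of 0] d(1) assms(7) assms(8)[of "\<alpha>s + \<epsilon>"] by simp
      qed
    qed
  qed
  have set3: "-{1} = {2, 3::3}"
  proof -
    have "(x \<noteq> 1) = (x = 2 \<or> x = 3)" for x :: 3 using exhaust_3[of x] by auto
    then show ?thesis by blast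
  qed
  \<comment> \<open>Each pairing with \<open>F\<close> carries the factor \<open>s * s = 1\<close>,
    so the sign normalisation leaves the coefficients unchanged.\<close>
  have coeff: "(\<phi>' 1 \<bullet> (F *v e' i)) * (\<phi>' i \<bullet> (F *v e' 1)) = (\<phi> 1 \<bullet> (F *v e i)) * (\<phi> i \<bullet> (F *v e 1))" for i
  proof -
    have "\<phi>' j \<bullet> (F *v e' k) = (s * s) * (\<phi> j \<bullet> (F *v e k))" for j k
      by (simp add: \<phi>'_def e'_def matrix_vector_mult_scaleR)
    then show ?thesis unfolding ss by simp
  qed
  have "\<exists>!g. is_filtered_control \<theta> (lam 1 - lam i) \<gamma> g" if "i \<noteq> 1" for i
    using is_filtered_control_iff[OF assms(16) _ gamma, of "lam 1 - lam i"] lam_neq[OF that] by auto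
  moreover have "(lamF has_real_derivative 0) (at 0)"
    using ctl.floquet_derivatives(1) critical by (simp add: lamF_def)
  moreover have "\<forall>\<^sub>F \<epsilon> in nhds 0. lamF field_differentiable (at \<epsilon>)"
    using ctl.floquet_derivatives(2) by (simp add: lamF_def)
  moreover have "(deriv lamF has_real_derivative
        2 * (\<Sum>i\<in>{2, 3}. time_average \<theta> (\<lambda>t. (filtered_control \<theta> (lam 1 - lam i) \<gamma> t)\<^sup>2) *
               ((\<phi> 1 \<bullet> (F *v e i)) * (\<phi> i \<bullet> (F *v e 1)) / (lam 1 - lam i)))) (at 0)"
    using ctl.floquet_derivatives(3) unfolding ctl.second_order_average set3 coeff lamF_def[symmetric] .
  ultimately show ?thesis by simp
qed

end
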